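(* Let $d\ge 1$ and $\alpha>d$, let $(\xi(z)\colon z\in\mathbb{Z}^d)$ be independent and identically distributed with $\operatorname{Prob}(\xi(z)<x)=1-x^{-\alpha}$ for $x\ge 1$, and let $u\colon(0,\infty)\times\mathbb{Z}^d\to[0,\infty)$ be the (almost surely unique) nonnegative solution of the parabolic Anderson problem $\partial_t u(t,z)=\Delta u(t,z)+\xi(z)u(t,z)$ for $(t,z)\in(0,\infty)\times\mathbb{Z}^d$, $u(0,z)=\mathbf{1}_{\{0\}}(z)$. Let $U(t)=\sum_{z\in\mathbb{Z}^d}u(t,z)$. Then there exist processes $(Z_t^{(1)}\colon t>0)$ and $(Z_t^{(2)}\colon t>0)$ with values in $\mathbb{Z}^d$ such that $Z_t^{(1)}\neq Z_t^{(2)}$ for all $t>0$, and $$\lim_{t\to\infty}\frac{u(t,Z_t^{(1)})+u(t,Z_t^{(2)})}{U(t)}=1\qquad\text{almost surely.}$$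
   Context: The discrete Laplacian is $(\Delta f)(z)=\sum_{y\sim z}[f(y)-f(z)]$ for $f\colon\mathbb{Z}^d\to\mathbb{R}$, where $y\sim z$ means that $y,z\in\mathbb{Z}^d$ are nearest neighbours. "Almost surely" refers to the law of the potential $\xi$. The processes $Z^{(1)},Z^{(2)}$ are random, defined on the probability space of $\xi$. It is known that the assumption $\alpha>d$ guarantees existence and uniqueness of the nonnegative solution, which is given by the Feynman--Kac formula $u(t,z)=\mathbb{E}_0[\exp\{\int_0^t\xi(X_s)\,ds\}\mathbf{1}\{X_t=z\}]$, where $(X_s)_{s\ge 0}$ is the continuous-time simple random walk on $\mathbb{Z}^d$ with generator $\Delta$ started at $0$. *)

theory Defs
  imports "HOL-Probability.Probability"
begin

text \<open>
  The lattice is \<^typ>\<open>int ^ 'd\<close>, where the index type has \<open>CARD('d) = d \<ge> 1\<close> elements.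
\<close>

definition nearest_nbr :: "int ^ 'd \<Rightarrow> int ^ 'd \<Rightarrow> bool" where
  "nearest_nbr y z \<longleftrightarrow> (\<Sum>i\<in>UNIV. \<bar>y $ i - z $ i\<bar>) = 1"

definition discrete_laplacian :: "(int ^ 'd \<Rightarrow> real) \<Rightarrow> int ^ 'd \<Rightarrow> real" where
  "discrete_laplacian f z = (\<Sum>y\<in>{y. nearest_nbr y z}. f y - f z)"

text \<open>The Laplacian is a genuine finite sum, not the default value of an infinite one.\<close>

lemma finite_nearest_nbr: "finite {y. nearest_nbr y (z :: int ^ 'd)}"
proof (rule finite_subset)
  let ?F = "PiE (UNIV :: 'd set) (\<lambda>i. {z $ i - 1 .. z $ i + 1})"
  show "{y. nearest_nbr y z} \<subseteq> vec_lambda ` ?F"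
  proof
    fix y assume "y \<in> {y. nearest_nbr y z}"
    then have s: "(\<Sum>i\<in>UNIV. \<bar>y $ i - z $ i\<bar>) = 1"
      by (simp add: nearest_nbr_def)
    have "\<bar>y $ i - z $ i\<bar> \<le> 1" for i
      using member_le_sum[of i UNIV "\<lambda>i. \<bar>y $ i - z $ i\<bar>"] s by simp
    then have "z $ i - 1 \<le> y $ i \<and> y $ i \<le> z $ i + 1" for i
      by (smt (verit))
    then have "vec_nth y \<in> ?F"
      by auto
    then show "y \<in> vec_lambda ` ?F"
      by (metis image_eqI vec_nth_inverse)
  qed
  show "finite (vec_lambda ` ?F)"
    by (intro finite_imageI finite_PiE) auto
qed

text \<open>
  Nonnegative solutions of the parabolic Anderson problem with potential \<open>V\<close>. The
  differential equation is imposed for \<open>t > 0\<close>, so the initial condition is tied to it by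
  requiring right-continuity at time 0. Values at negative times are irrelevant.
\<close>

definition nonneg_pam_solution ::
  "(int ^ 'd \<Rightarrow> real) \<Rightarrow> (real \<Rightarrow> int ^ 'd \<Rightarrow> real) \<Rightarrow> bool" where
  "nonneg_pam_solution V u \<longleftrightarrow>
     (\<forall>t>0. \<forall>z. 0 \<le> u t z) \<and>
     (\<forall>t>0. \<forall>z. ((\<lambda>s. u s z) has_real_derivative
                    (discrete_laplacian (u t) z + V z * u t z)) (at t)) \<and>
     (\<forall>z. u 0 z = indicator {0} z) \<and>
     (\<forall>z. ((\<lambda>t. u t z) \<longlongrightarrow> u 0 z) (at_right 0))"

definition total_mass :: "(real \<Rightarrow> int ^ 'd \<Rightarrow> real) \<Rightarrow> real \<Rightarrow> real" where
  "total_mass u t = (\<Sum>\<^sub>\<infinity>z\<in>UNIV. u t z)"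

end

theory Submission
  imports Defs "HOL-Real_Asymp.Real_Asymp"
begin

text \<open>
  For the functional \<open>Phi t (V m) m = t * V m - nrm m * ln (V m) + entr m\<close> the value \<open>ln (u t m)\<close> is at least
  \<open>Phi t (V m) m\<close> up to lower order terms, by going to \<open>m\<close> straight away and staying there.
  Conversely, order the sites of a large ball by decreasing potential and split the solution according to the highest site \<open>m\<close> that is visited. Each part is concentrated
  in \<open>m\<close>, since the potential drops by a diverging gap at all other admissible sites, and an explicit supersolution
  gives the matching upper bound for its mass, since high sites are far apart. So all parts are negligible except
  those of the sites where \<open>Phi\<close> is almost maximal. At a fixed time, three sites nearly tie with probability of
  the order of the square of the tolerance, while the number of times needed to control a dyadic time interval is the
  inverse of the tolerance. A tolerance that is a small negative power of time is therefore admissible: by the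
  Borel-Cantelli lemma at most two sites compete at any large time, and all error terms are of smaller order.
\<close>

section \<open>The lattice and comparison principles\<close>

text \<open>Neither path measures nor spectral theory enter: every estimate on \<open>u\<close>
  compares finite linear systems with nonnegative off-diagonal entries, so upper bounds call for
  explicit supersolutions.

  With two sites in place of three the argument fails: at a relative tolerance T powr (-a) a pair
  nearly ties at a fixed time with probability of order T powr (-a), which a grid of about T powr a
  times uses up. The third site gains the missing factor.

  The tolerance must also exceed the mismatch of the two bounds on \<open>ln (u t m)\<close>. In the
  upper bound, sites of potential up to \<rho> are treated as if they had potential \<rho>, which
  turns \<open>ln (V m)\<close> into \<open>ln (V m - \<rho>)\<close>, and a tilt \<eta> per step
  keeps the higher sites from interacting. Both losses per step, \<rho> / V m and \<eta>, have to
  lie below the relative tolerance by a power of T, while the sites above \<rho> must be at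
  distances K for which exp (- \<eta> * K) beats every power of T. These constraints fix the
  exponents of \<rho>, K and \<eta> once that of the tolerance is given.\<close>

definition nrm :: "int ^ 'd \<Rightarrow> nat" where
  "nrm x = (\<Sum>i\<in>UNIV. nat \<bar>x $ i\<bar>)"

abbreviation nb :: "int ^ 'd \<Rightarrow> (int ^ 'd) set" where
  "nb z \<equiv> {y. nearest_nbr y z}"

lemma int_nrm: "int (nrm x) = (\<Sum>i\<in>UNIV. \<bar>x $ i\<bar>)"
  by (simp add: nrm_def)

lemma nearest_nbr_nrm: "nearest_nbr y z \<longleftrightarrow> nrm (y - z) = 1"
proof -
  have "(\<Sum>i\<in>UNIV. \<bar>y $ i - z $ i\<bar>) = int (nrm (y - z))"
    by (simp add: int_nrm)
  then show ?thesis by (simp add: nearest_nbr_def)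
qed

lemma nrm_zero [simp]: "nrm 0 = 0"
  by (simp add: nrm_def)

lemma nrm_eq_0_iff [simp]: "nrm x = 0 \<longleftrightarrow> x = 0"
  by (auto simp: nrm_def vec_eq_iff)

lemma nrm_triangle: "nrm (x + y) \<le> nrm x + nrm y"
  unfolding nrm_def sum.distrib[symmetric] by (intro sum_mono) auto

lemma nrm_minus [simp]: "nrm (- x) = nrm x"
  by (simp add: nrm_def)

lemma nrm_minus_commute: "nrm (x - y) = nrm (y - x)"
  by (metis minus_diff_eq nrm_minus)

lemma nearest_nbr_sym: "nearest_nbr y z \<longleftrightarrow> nearest_nbr z y"
  by (simp add: nearest_nbr_nrm nrm_minus_commute)

lemma nb_translate: "nb (z + a) = (\<lambda>y. y + a) ` nb z"
proof (intro set_eqI iffI)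
  fix y assume "y \<in> nb (z + a)"
  then show "y \<in> (\<lambda>y. y + a) ` nb z"
    by (intro image_eqI[of _ _ "y - a"]) (auto simp: nearest_nbr_def algebra_simps)
qed (auto simp: nearest_nbr_def)

lemma nrm_nb:
  assumes "y \<in> nb z"
  shows "nrm y \<le> Suc (nrm z)" "nrm z \<le> Suc (nrm y)"
  using nrm_triangle[of "y - z" z] nrm_triangle[of "z - y" y] assms
  by (auto simp: nearest_nbr_nrm nrm_minus_commute[of z y])

lemma component_le_nrm: "nat \<bar>x $ i\<bar> \<le> nrm x"
  unfolding nrm_def by (rule member_le_sum) auto

lemma axis_nth_int: "(axis i (c::int)) $ j = (if i = j then c else 0)"
  by (simp add: axis_def)

lemma nrm_axis [simp]: "nrm (axis i 1) = 1"
proof -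
  have "nrm (axis i 1) = (\<Sum>j\<in>UNIV. if i = j then 1 else 0)"
    unfolding nrm_def by (intro sum.cong) (auto simp: axis_nth_int)
  then show ?thesis by simp
qed

lemma nb_eq: "nb z = range (\<lambda>i. z + axis i 1) \<union> range (\<lambda>i. z - axis i 1)"
proof (intro set_eqI iffI)
  fix y assume "y \<in> nb z"
  then have *: "(\<Sum>i\<in>UNIV. nat \<bar>(y - z) $ i\<bar>) = 1"
    by (simp add: nearest_nbr_nrm nrm_def)
  from sum_eq_1_iff[THEN iffD1, OF _ this]
  obtain i where i: "nat \<bar>(y - z) $ i\<bar> = 1" "\<And>j. j \<noteq> i \<Longrightarrow> nat \<bar>(y - z) $ j\<bar> = 0"
    by auto
  have "y $ i - z $ i = 1 \<or> y $ i - z $ i = -1"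
    using i(1) by auto
  then show "y \<in> range (\<lambda>i. z + axis i 1) \<union> range (\<lambda>i. z - axis i 1)"
  proof
    assume "y $ i - z $ i = 1"
    then have "y = z + axis i 1"
      using i(2) by (auto simp: vec_eq_iff axis_nth_int)
    then show ?thesis by auto
  next
    assume "y $ i - z $ i = -1"
    then have "y = z - axis i 1"
      using i(2) by (auto simp: vec_eq_iff axis_nth_int)
    then show ?thesis by auto
  qed
next
  fix y assume "y \<in> range (\<lambda>i. z + axis i 1) \<union> range (\<lambda>i. z - axis i 1)"
  then show "y \<in> nb z"
    by (auto simp: nearest_nbr_nrm nrm_axis)
qed

lemma sum_nb:
  fixes f :: "int ^ 'd \<Rightarrow> real"
  shows "(\<Sum>y\<in>nb z. f y) = (\<Sum>i\<in>UNIV. f (z + axis i 1) + f (z - axis i 1))"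
proof -
  have inj: "inj (\<lambda>i::'d. z + axis i 1)" "inj (\<lambda>i::'d. z - axis i 1)"
    by (auto simp: inj_def axis_eq_axis)
  have "z + axis i 1 \<noteq> z - axis j 1" for i j :: 'd
  proof
    assume "z + axis i 1 = z - axis j 1"
    then have "(z + axis i 1) $ i = (z - axis j 1) $ i" by simp
    then show False by (auto simp: axis_nth_int split: if_splits)
  qed
  then have "range (\<lambda>i::'d. z + axis i 1) \<inter> range (\<lambda>i::'d. z - axis i 1) = {}"
    by auto
  then show ?thesis
    unfolding nb_eq using inj
    by (subst sum.union_disjoint) (auto simp: sum.reindex sum.distrib)
qed

lemma card_nb: "real (card (nb (z :: int ^ 'd))) = 2 * real CARD('d)"
  using sum_nb[of "\<lambda>_. 1" z] by simp

lemma discrete_laplacian_eq: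
  "discrete_laplacian f z = (\<Sum>y\<in>nb z. f y) - 2 * real CARD('d) * f (z :: int ^ 'd)"
  unfolding discrete_laplacian_def by (simp add: sum_subtractf card_nb)

text \<open>The right-hand side of the equation with its off-diagonal part separated: the
  coefficients there are nonnegative, which is what comparison rests on.\<close>

abbreviation anderson :: "(int ^ 'd \<Rightarrow> real) \<Rightarrow> (int ^ 'd \<Rightarrow> real) \<Rightarrow> int ^ 'd \<Rightarrow> real" where
  "anderson V v x \<equiv> (\<Sum>y\<in>nb x. v y) + (V x - 2 * real CARD('d)) * v x"

section \<open>Balls and cubes of the lattice\<close>

definition lball :: "nat \<Rightarrow> (int ^ 'd) set" where
  "lball n = {x. nrm x \<le> n}"

text \<open>Cubes are products of intervals, so their cardinality is exact and sums of product
  functions over them factorise. Balls are compared with them in both directions.\<close>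

definition cube :: "nat \<Rightarrow> (int ^ 'd) set" where
  "cube n = {x. \<forall>i. \<bar>x $ i\<bar> \<le> int n}"

lemma cube_eq: "cube n = vec_lambda ` (PiE UNIV (\<lambda>i::'d::finite. {- int n..int n}))"
proof (intro set_eqI iffI)
  fix x :: "int ^ 'd" assume "x \<in> cube n"
  then have "vec_nth x \<in> PiE UNIV (\<lambda>i::'d::finite. {- int n..int n})"
    unfolding cube_def by (auto simp: abs_le_iff) (metis minus_le_iff)
  then show "x \<in> vec_lambda ` (PiE UNIV (\<lambda>i::'d::finite. {- int n..int n}))"
    by (metis image_eqI vec_nth_inverse)
qed (auto simp: cube_def PiE_iff abs_le_iff minus_le_iff)

lemma finite_cube: "finite (cube n)"
  unfolding cube_eq by (intro finite_imageI finite_PiE) auto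

lemma card_cube: "card (cube n :: (int ^ 'd) set) = (2 * n + 1) ^ CARD('d)"
proof -
  have "card (cube n :: (int ^ 'd) set) = card (PiE UNIV (\<lambda>i::'d::finite. {- int n..int n}))"
    unfolding cube_eq by (intro card_image inj_onI) (metis vec_lambda_inverse UNIV_I)
  also have "\<dots> = (2 * n + 1) ^ CARD('d)"
    by (subst card_PiE) (auto simp: nat_add_distrib nat_mult_distrib)
  finally show ?thesis .
qed

lemma lball_subset_cube: "lball n \<subseteq> cube n"
proof
  fix x :: "int ^ 'd" assume "x \<in> lball n"
  then have "nat \<bar>x $ i\<bar> \<le> n" for i
    using component_le_nrm[of x i] by (auto simp: lball_def)
  then show "x \<in> cube n" by (auto simp: cube_def nat_le_iff)
qed

lemma cube_subset_lball: "cube n \<subseteq> (lball (CARD('d) * n) :: (int ^ 'd) set)"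
proof
  fix x :: "int ^ 'd" assume "x \<in> cube n"
  then have "nrm x \<le> (\<Sum>i\<in>(UNIV::'d set). n)"
    unfolding nrm_def cube_def by (intro sum_mono) (auto simp: nat_le_iff)
  then show "x \<in> lball (CARD('d) * n)" by (auto simp: lball_def)
qed

lemma finite_lball: "finite (lball n)"
  using finite_subset[OF lball_subset_cube finite_cube] .

lemma card_lball: "card (lball n :: (int ^ 'd) set) \<le> (2 * n + 1) ^ CARD('d)"
  using card_mono[OF finite_cube lball_subset_cube] by (metis card_cube)

section \<open>Comparison for finite linear systems\<close>

lemma has_real_derivative_min_sq: "((\<lambda>x::real. (min 0 x)\<^sup>2) has_real_derivative 2 * min 0 x) (at x)"
proof -
  consider "x < 0" | "x > 0" | "x = 0" by linarith
  then show ?thesis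
  proof cases
    case 1
    have "((\<lambda>x::real. x\<^sup>2) has_real_derivative 2 * min 0 x) (at x)"
      using 1 by (auto intro!: derivative_eq_intros)
    then show ?thesis
      by (rule has_field_derivative_transform_within_open[of _ _ _ "{..<0}"]) (use 1 in auto)
  next
    case 2
    have "((\<lambda>x::real. 0) has_real_derivative 2 * min 0 x) (at x)"
      using 2 by (auto intro!: derivative_eq_intros)
    then show ?thesis
      by (rule has_field_derivative_transform_within_open[of _ _ _ "{0<..}"]) (use 2 in auto)
  next
    case 3
    have "(\<lambda>h::real. (min 0 h)\<^sup>2 / h) \<midarrow>0\<rightarrow> 0"
    proof (rule Lim_null_comparison)
      show "\<forall>\<^sub>F h in at (0::real). norm ((min 0 h)\<^sup>2 / h) \<le> \<bar>h\<bar>"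
        by (intro always_eventually allI) (auto simp: min_def power2_eq_square)
      show "(\<lambda>h::real. \<bar>h\<bar>) \<midarrow>0\<rightarrow> 0" by (auto intro!: tendsto_eq_intros)
    qed
    then show ?thesis using 3 by (simp add: DERIV_def)
  qed
qed

text \<open>\<open>exp (- k * t) * f t\<close> is nondecreasing. Applied to negatives such as
  \<open>- E\<close> or \<open>- W\<close> it gives upper bounds.\<close>

lemma gronwall_lower:
  fixes f f' :: "real \<Rightarrow> real"
  assumes ab: "a \<le> b" and cont: "continuous_on {a..b} f"
    and der: "\<And>t. a < t \<Longrightarrow> t < b \<Longrightarrow> (f has_real_derivative f' t) (at t)"
    and ge: "\<And>t. a < t \<Longrightarrow> t < b \<Longrightarrow> k * f t \<le> f' t"
  shows "exp (k * (b - a)) * f a \<le> f b"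
proof -
  have "exp (- k * a) * f a \<le> exp (- k * b) * f b"
  proof (cases "a = b")
    case False
    show ?thesis
    proof (rule DERIV_nonneg_imp_increasing_open[of a b "\<lambda>t. exp (- k * t) * f t"])
      fix t assume t: "a < t" "t < b"
      have "((\<lambda>t. exp (- k * t) * f t) has_real_derivative exp (- k * t) * (f' t - k * f t)) (at t)"
        using der[OF t] by - (rule derivative_eq_intros refl | simp add: algebra_simps)+
      then show "\<exists>y. ((\<lambda>t. exp (- k * t) * f t) has_real_derivative y) (at t) \<and> 0 \<le> y"
        using ge[OF t] by (intro exI conjI) auto
    qed (use ab False cont in \<open>auto intro!: continuous_intros\<close>)
  qed simp
  then have "exp (k * b) * (exp (- k * a) * f a) \<le> exp (k * b) * (exp (- k * b) * f b)"
    by (rule mult_left_mono) simp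
  then show ?thesis by (simp add: exp_minus exp_diff right_diff_distrib field_simps)
qed

text \<open>The squares of the negative parts satisfy a Gronwall inequality.\<close>

lemma differential_inequality_nonneg:
  fixes v v' :: "real \<Rightarrow> 'a \<Rightarrow> real" and c :: "'a \<Rightarrow> 'a \<Rightarrow> real"
  assumes fin: "finite A" and T: "0 \<le> T"
    and c: "\<And>x y. x \<in> A \<Longrightarrow> y \<in> A \<Longrightarrow> x \<noteq> y \<Longrightarrow> 0 \<le> c x y"
    and cont: "\<And>x. x \<in> A \<Longrightarrow> continuous_on {0..T} (\<lambda>t. v t x)"
    and der: "\<And>t x. 0 < t \<Longrightarrow> t < T \<Longrightarrow> x \<in> A \<Longrightarrow> ((\<lambda>t. v t x) has_real_derivative v' t x) (at t)"
    and ge: "\<And>t x. 0 < t \<Longrightarrow> t < T \<Longrightarrow> x \<in> A \<Longrightarrow> (\<Sum>y\<in>A. c x y * v t y) \<le> v' t x"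
    and init: "\<And>x. x \<in> A \<Longrightarrow> 0 \<le> v 0 x"
    and x: "x \<in> A"
  shows "0 \<le> v T x"
proof -
  \<comment> \<open>The negative part of \<open>v\<close>; its square is differentiable even where
    \<open>v\<close> vanishes.\<close>
  define n where "n t x = min 0 (v t x)" for t x
  define E where "E t = (\<Sum>x\<in>A. (n t x)\<^sup>2)" for t
  define C where "C = 2 * (\<Sum>x\<in>A. \<Sum>y\<in>A. \<bar>c x y\<bar>)"
  have E0: "0 \<le> E t" for t unfolding E_def by (intro sum_nonneg) auto
  have sqE: "(n t x)\<^sup>2 \<le> E t" if "x \<in> A" for t x
    unfolding E_def by (rule member_le_sum) (use that fin in auto)
  have nn: "n t x * n t y \<le> E t" "- (n t x * n t y) \<le> E t" if "x \<in> A" "y \<in> A" for t x y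
    using sqE[OF that(1), of t] sqE[OF that(2), of t] sum_squares_bound[of "n t x" "n t y"]
      sum_squares_bound[of "- n t x" "n t y"] by auto
  have dE: "(E has_real_derivative (\<Sum>x\<in>A. 2 * n t x * v' t x)) (at t)" if t: "0 < t" "t < T" for t
  proof -
    have "((\<lambda>t. (n t x)\<^sup>2) has_real_derivative (2 * n t x) * v' t x) (at t)" if "x \<in> A" for x
      unfolding n_def using DERIV_chain2[OF has_real_derivative_min_sq der[OF t that]] .
    then show ?thesis unfolding E_def by (intro DERIV_sum) auto
  qed
  have le: "(\<Sum>x\<in>A. 2 * n t x * v' t x) \<le> C * E t" if t: "0 < t" "t < T" for t
  proof -
    have "(\<Sum>x\<in>A. 2 * n t x * v' t x) \<le> (\<Sum>x\<in>A. 2 * n t x * (\<Sum>y\<in>A. c x y * v t y))"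
      by (intro sum_mono mult_left_mono_neg ge[OF t]) (auto simp: n_def)
    also have "\<dots> = (\<Sum>x\<in>A. \<Sum>y\<in>A. 2 * (n t x * (c x y * v t y)))"
      by (simp add: sum_distrib_left mult.assoc)
    also have "\<dots> \<le> (\<Sum>x\<in>A. \<Sum>y\<in>A. 2 * (\<bar>c x y\<bar> * E t))"
    proof (intro sum_mono mult_left_mono)
      fix x y assume xy: "x \<in> A" "y \<in> A"
      \<comment> \<open>On the diagonal this is an equality, since \<open>min 0 v * v\<close> is the
        square of \<open>min 0 v\<close>, so \<open>c x x\<close> may have either sign. Off the
        diagonal \<open>0 <= c x y\<close> and \<open>n t x <= 0\<close> allow \<open>v t y\<close>
        to be replaced by its negative part.\<close>
      have "n t x * (c x y * v t y) \<le> c x y * (n t x * n t y)"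
      proof (cases "x = y")
        case True
        then show ?thesis by (auto simp: n_def min_def)
      next
        case False
        have "n t x * v t y \<le> n t x * n t y"
          by (rule mult_left_mono_neg) (auto simp: n_def)
        then show ?thesis
          using mult_left_mono[OF _ c[OF xy False], of "n t x * v t y" "n t x * n t y"]
          by (simp add: mult_ac)
      qed
      also have "\<dots> \<le> \<bar>c x y\<bar> * E t"
      proof (cases "c x y \<ge> 0")
        case True
        then show ?thesis using nn(1)[OF xy] by (simp add: mult_left_mono)
      next
        case False
        then show ?thesis using mult_left_mono[OF nn(2)[OF xy], of "- c x y"] by simp
      qed
      finally show "n t x * (c x y * v t y) \<le> \<bar>c x y\<bar> * E t" .
    qed simp
    also have "\<dots> = C * E t"
      unfolding C_def by (simp add: sum_distrib_left sum_distrib_right mult_ac)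
    finally show ?thesis .
  qed
  have "exp (C * (T - 0)) * - E 0 \<le> - E T"
  proof (rule gronwall_lower[OF T, where f = "\<lambda>t. - E t"])
    show "continuous_on {0..T} (\<lambda>t. - E t)"
      unfolding E_def n_def by (intro continuous_intros cont)
  qed (use dE le in \<open>auto intro: DERIV_minus\<close>)
  also have "E 0 = 0"
    unfolding E_def n_def using init by (intro sum.neutral) auto
  finally have "E T = 0" using E0[of T] by simp
  then have "n T x = 0"
    using sqE[OF x, of T] by auto
  then show ?thesis by (auto simp: n_def min_def split: if_splits)
qed

lemma lattice_comparison:
  fixes v v' w :: "real \<Rightarrow> int ^ 'd \<Rightarrow> real" and V :: "int ^ 'd \<Rightarrow> real"
  assumes fin: "finite A" and T: "0 \<le> T"
    and cont: "\<And>x. x \<in> A \<Longrightarrow> continuous_on {0..T} (\<lambda>t. v t x)" "\<And>x. x \<in> A \<Longrightarrow> continuous_on {0..T} (\<lambda>t. w t x)"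
    and der: "\<And>t x. 0 < t \<Longrightarrow> t < T \<Longrightarrow> x \<in> A \<Longrightarrow> ((\<lambda>t. v t x) has_real_derivative v' t x) (at t)"
      "\<And>t x. 0 < t \<Longrightarrow> t < T \<Longrightarrow> x \<in> A \<Longrightarrow> ((\<lambda>t. w t x) has_real_derivative anderson V (w t) x) (at t)"
    and ge: "\<And>t x. 0 < t \<Longrightarrow> t < T \<Longrightarrow> x \<in> A \<Longrightarrow> anderson V (v t) x \<le> v' t x"
    and bd: "\<And>t x y. 0 < t \<Longrightarrow> t < T \<Longrightarrow> x \<in> A \<Longrightarrow> y \<in> nb x \<Longrightarrow> y \<notin> A \<Longrightarrow> w t y \<le> v t y"
    and init: "\<And>x. x \<in> A \<Longrightarrow> w 0 x \<le> v 0 x"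
    and x: "x \<in> A"
  shows "w T x \<le> v T x"
proof -
  define c where "c x y = (if x = y then V x - 2 * real CARD('d) else 0) + (if y \<in> nb x then 1 else 0)"
    for x y :: "int ^ 'd"
  have "0 \<le> v T x - w T x"
  proof (rule differential_inequality_nonneg[where c = c and v = "\<lambda>t x. v t x - w t x"
        and v' = "\<lambda>t x. v' t x - anderson V (w t) x", OF fin T _ _ _ _ _ x])
    fix t x assume t: "0 < t" "t < T" and x: "x \<in> A"
    show "((\<lambda>t. v t x - w t x) has_real_derivative v' t x - anderson V (w t) x) (at t)"
      by (intro DERIV_diff der t x)
    have "(\<Sum>y\<in>A. c x y * (v t y - w t y)) =
        (V x - 2 * real CARD('d)) * (v t x - w t x) + (\<Sum>y\<in>A \<inter> nb x. v t y - w t y)"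
      unfolding c_def using fin x
      by (simp add: distrib_right sum.distrib if_distrib[of "\<lambda>a. a * _"] sum.If_cases cong: if_cong)
    also have "(\<Sum>y\<in>A \<inter> nb x. v t y - w t y) \<le> (\<Sum>y\<in>nb x. v t y - w t y)"
      by (rule sum_mono2) (use finite_nearest_nbr bd[OF t x] in auto)
    finally show "(\<Sum>y\<in>A. c x y * (v t y - w t y)) \<le> v' t x - anderson V (w t) x"
      using ge[OF t x] by (simp add: sum_subtractf right_diff_distrib)
  qed (use cont init in \<open>auto simp: c_def intro!: continuous_intros\<close>)
  then show ?thesis by simp
qed

section \<open>Dirichlet solutions on finite sets\<close>

text \<open>
  The Dirichlet solution on a finite set \<open>A\<close> is its Taylor series in time; it vanishes identically outside \<open>A\<close>.
\<close>

fun dcoef :: "(int ^ 'd \<Rightarrow> real) \<Rightarrow> (int ^ 'd) set \<Rightarrow> nat \<Rightarrow> int ^ 'd \<Rightarrow> real" where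
  "dcoef V A 0 x = (if x \<in> A then indicator {0} x else 0)"
| "dcoef V A (Suc n) x = (if x \<in> A then anderson V (dcoef V A n) x else 0)"

definition dsol :: "(int ^ 'd \<Rightarrow> real) \<Rightarrow> (int ^ 'd) set \<Rightarrow> real \<Rightarrow> int ^ 'd \<Rightarrow> real" where
  "dsol V A t x = (\<Sum>n. dcoef V A n x / fact n * t ^ n)"

lemma dcoef_bound:
  fixes V :: "int ^ 'd \<Rightarrow> real"
  assumes "finite A"
  obtains C where "C \<ge> 0" "\<And>n x. \<bar>dcoef V A n x\<bar> \<le> C ^ n"
proof -
  \<comment> \<open>Bounds the operator in the sup norm: 2 d for the neighbours, 2 d for the
    diagonal part of the Laplacian, the rest for the potential.\<close>
  define C where "C = 4 * real CARD('d) + (\<Sum>x\<in>A. \<bar>V x\<bar>)"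
  have C: "C \<ge> 0" unfolding C_def by (intro add_nonneg_nonneg sum_nonneg) auto
  have "\<bar>dcoef V A n x\<bar> \<le> C ^ n" for n x
  proof (induction n arbitrary: x)
    case (Suc n)
    show ?case
    proof (cases "x \<in> A")
      case True
      have "\<bar>\<Sum>y\<in>nb x. dcoef V A n y\<bar> \<le> (\<Sum>y\<in>nb x. C ^ n)"
        by (rule order_trans[OF sum_abs]) (intro sum_mono Suc.IH)
      also have "\<dots> = 2 * real CARD('d) * C ^ n" by (simp add: card_nb)
      finally have 1: "\<bar>\<Sum>y\<in>nb x. dcoef V A n y\<bar> \<le> 2 * real CARD('d) * C ^ n" .
      have "\<bar>V x - 2 * real CARD('d)\<bar> \<le> \<bar>V x\<bar> + 2 * real CARD('d)" by linarith
      also have "\<bar>V x\<bar> \<le> (\<Sum>x\<in>A. \<bar>V x\<bar>)"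
        by (rule member_le_sum) (use True assms in auto)
      finally have 2: "\<bar>(V x - 2 * real CARD('d)) * dcoef V A n x\<bar>
          \<le> ((\<Sum>x\<in>A. \<bar>V x\<bar>) + 2 * real CARD('d)) * C ^ n"
        unfolding abs_mult by (intro mult_mono Suc.IH) (auto intro: add_nonneg_nonneg sum_nonneg)
      show ?thesis using 1 2 True
        by (simp add: C_def algebra_simps)
    qed (use C in auto)
  qed (auto simp: indicator_def)
  then show thesis using C that by blast
qed

lemma dcoef_summable:
  assumes "finite A" shows "summable (\<lambda>n. dcoef V A n x / fact n * t ^ n)"
proof -
  obtain C where C: "C \<ge> 0" "\<And>n x. \<bar>dcoef V A n x\<bar> \<le> C ^ n" using dcoef_bound[OF assms] by metis
  show ?thesis
  proof (rule summable_comparison_test')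
    show "summable (\<lambda>n. inverse (fact n) * (C * \<bar>t\<bar>) ^ n)"
      by (rule summable_exp)
    show "norm (dcoef V A n x / fact n * t ^ n) \<le> inverse (fact n) * (C * \<bar>t\<bar>) ^ n" for n
      using mult_right_mono[OF C(2)[of n x], of "\<bar>t\<bar> ^ n"]
      by (simp add: abs_mult power_abs power_mult_distrib field_simps)
  qed
qed

lemma dsol_outside [simp]: "x \<notin> A \<Longrightarrow> dsol V A t x = 0"
proof -
  assume "x \<notin> A"
  then have "dcoef V A n x = 0" for n by (cases n) auto
  then show ?thesis by (simp add: dsol_def)
qed

lemma dsol_0: "dsol V A 0 x = (if x \<in> A then indicator {0} x else 0)"
  unfolding dsol_def using powser_zero[of "\<lambda>n. dcoef V A n x / fact n"] by simp

lemma dsol_deriv: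
  fixes V :: "int ^ 'd \<Rightarrow> real"
  assumes A: "finite A" and x: "x \<in> A"
  shows "((\<lambda>t. dsol V A t x) has_real_derivative anderson V (dsol V A t) x) (at t)"
proof -
  have "((\<lambda>t. \<Sum>n. dcoef V A n x / fact n * t ^ n) has_real_derivative
      (\<Sum>n. diffs (\<lambda>n. dcoef V A n x / fact n) n * t ^ n)) (at t)"
    by (rule termdiffs_strong_converges_everywhere) (rule dcoef_summable[OF A])
  also have "(\<lambda>t. \<Sum>n. dcoef V A n x / fact n * t ^ n) = (\<lambda>t. dsol V A t x)"
    by (simp add: dsol_def fun_eq_iff)
  also have "(\<Sum>n. diffs (\<lambda>n. dcoef V A n x / fact n) n * t ^ n)
      = (\<Sum>n. (\<Sum>y\<in>nb x. dcoef V A n y / fact n * t ^ n) +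
            (V x - 2 * real CARD('d)) * (dcoef V A n x / fact n * t ^ n))"
  proof (rule suminf_cong)
    fix n
    have "diffs (\<lambda>n. dcoef V A n x / fact n) n = dcoef V A (Suc n) x / fact n"
      unfolding diffs_def fact_Suc by (simp add: field_simps del: dcoef.simps of_nat_Suc)
    then show "diffs (\<lambda>n. dcoef V A n x / fact n) n * t ^ n = (\<Sum>y\<in>nb x. dcoef V A n y / fact n * t ^ n) +
            (V x - 2 * real CARD('d)) * (dcoef V A n x / fact n * t ^ n)"
      using x by (simp add: add_divide_distrib distrib_right sum_divide_distrib sum_distrib_right)
  qed
  also have "\<dots> = (\<Sum>n. \<Sum>y\<in>nb x. dcoef V A n y / fact n * t ^ n) +
            (\<Sum>n. (V x - 2 * real CARD('d)) * (dcoef V A n x / fact n * t ^ n))"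
    by (intro suminf_add[symmetric] summable_sum summable_mult dcoef_summable A)
  also have "(\<Sum>n. \<Sum>y\<in>nb x. dcoef V A n y / fact n * t ^ n) = (\<Sum>y\<in>nb x. dsol V A t y)"
    unfolding dsol_def by (intro suminf_sum dcoef_summable A)
  also have "(\<Sum>n. (V x - 2 * real CARD('d)) * (dcoef V A n x / fact n * t ^ n)) =
      (V x - 2 * real CARD('d)) * dsol V A t x"
    unfolding dsol_def by (intro suminf_mult dcoef_summable A)
  finally show ?thesis .
qed

lemma dsol_continuous:
  fixes x :: "int ^ 'd"
  assumes "finite A" shows "continuous_on S (\<lambda>t. dsol V A t x)"
proof (cases "x \<in> A")
  case True
  then show ?thesis
    by (intro DERIV_continuous_on[OF has_field_derivative_at_within[OF dsol_deriv[OF assms True]]])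
qed simp

lemma dsol_nonneg:
  fixes x :: "int ^ 'd"
  assumes A: "finite A" and t: "0 \<le> t"
  shows "0 \<le> dsol V A t x"
proof (cases "x \<in> A")
  case True
  show ?thesis
    by (rule lattice_comparison[where V = V and A = A and T = t and w = "\<lambda>_ _. 0"
          and v' = "\<lambda>t. anderson V (dsol V A t)"])
       (use A t True dsol_deriv[OF A] dsol_continuous[OF A] in \<open>auto simp: dsol_0\<close>)
qed simp

text \<open>\<open>exp (l * t) * G x\<close> is a supersolution in space-time which dominates the
  point mass at time 0 and is nonnegative outside \<open>A\<close>, where the Dirichlet solution
  vanishes. Pointwise upper bounds on \<open>dsol\<close> thus reduce to the choice of a stationary
  \<open>G\<close>.\<close>

lemma dsol_le_supersolution:
  fixes V :: "int ^ 'd \<Rightarrow> real"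
  assumes A: "finite A" and t: "0 \<le> t"
    and G: "\<And>x. 0 \<le> G x" "1 \<le> G 0"
    and super: "\<And>x. x \<in> A \<Longrightarrow> anderson V G x \<le> l * G x"
  shows "dsol V A t x \<le> exp (l * t) * G x"
proof (cases "x \<in> A")
  case True
  show ?thesis
  proof (rule lattice_comparison[where V = V and A = A and T = t and v = "\<lambda>t x. exp (l * t) * G x"
     and v' = "\<lambda>t x. exp (l * t) * (l * G x)"])
    fix s x assume x: "x \<in> A"
    show "anderson V (\<lambda>y. exp (l * s) * G y) x \<le> exp (l * s) * (l * G x)"
      using mult_left_mono[OF super[OF x], of "exp (l * s)"] by (simp add: sum_distrib_left algebra_simps)
    show "((\<lambda>t. exp (l * t) * G x) has_real_derivative exp (l * s) * (l * G x)) (at s)"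
      by (rule derivative_eq_intros refl | simp)+
  qed (use A t G True in \<open>auto simp: dsol_0 indicator_def intro!: continuous_intros dsol_continuous dsol_deriv\<close>)
qed (use G in simp)

lemma dsol_mono:
  fixes V :: "int ^ 'd \<Rightarrow> real"
  assumes A: "finite A" "A' \<subseteq> A" and t: "0 \<le> t"
  shows "dsol V A' t x \<le> dsol V A t x"
proof (cases "x \<in> A'")
  case True
  have A': "finite A'" using A finite_subset by blast
  show ?thesis
    by (rule lattice_comparison[where V = V and A = A' and T = t and v' = "\<lambda>t. anderson V (dsol V A t)"])
       (use A t True A' in \<open>auto simp: dsol_0 indicator_def intro!: dsol_continuous dsol_nonneg dsol_deriv\<close>)
qed (use dsol_nonneg A t in simp)

lemma nonneg_pam_solutionD:
  fixes V :: "int ^ 'd \<Rightarrow> real"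
  assumes "nonneg_pam_solution V u"
  shows "0 \<le> t \<Longrightarrow> 0 \<le> u t z"
    and "0 < t \<Longrightarrow> ((\<lambda>s. u s z) has_real_derivative anderson V (u t) z) (at t)"
    and "u 0 z = indicator {0} z"
    and "continuous_on {0..} (\<lambda>t. u t z)"
proof -
  show 0: "u 0 z = indicator {0} z" using assms by (simp add: nonneg_pam_solution_def)
  show "0 \<le> t \<Longrightarrow> 0 \<le> u t z"
    using assms 0 by (cases "t = 0") (auto simp: nonneg_pam_solution_def)
  show d: "0 < t \<Longrightarrow> ((\<lambda>s. u s z) has_real_derivative anderson V (u t) z) (at t)" for t
    using assms unfolding nonneg_pam_solution_def discrete_laplacian_eq by (simp add: algebra_simps)
  show "continuous_on {0..} (\<lambda>t. u t z)"
    unfolding continuous_on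
  proof
    fix t :: real assume t: "t \<in> {0..}"
    show "((\<lambda>t. u t z) \<longlongrightarrow> u t z) (at t within {0..})"
    proof (cases "t = 0")
      case True
      have "((\<lambda>t. u t z) \<longlongrightarrow> u 0 z) (at_right 0)"
        using assms by (auto simp: nonneg_pam_solution_def)
      moreover have "at (0::real) within {0..} = at_right 0"
        by (auto simp: at_within_def intro!: arg_cong[of _ _ principal] arg_cong2[of _ _ _ _ inf])
      ultimately show ?thesis using True by simp
    next
      case False
      with t have "0 < t" by simp
      from DERIV_isCont[OF d[OF this]] show ?thesis
        by (simp add: isCont_def Lim_at_imp_Lim_at_within)
    qed
  qed
qed

lemma dsol_le_solution:
  fixes V :: "int ^ 'd \<Rightarrow> real"
  assumes u: "nonneg_pam_solution V u" and A: "finite A" and t: "0 \<le> t"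
  shows "dsol V A t x \<le> u t x"
proof (cases "x \<in> A")
  case True
  note D = nonneg_pam_solutionD[OF u]
  show ?thesis
  proof (rule lattice_comparison[where V = V and A = A and T = t and v' = "\<lambda>t. anderson V (u t)"])
    show "continuous_on {0..t} (\<lambda>t. u t x)" for x using D(4) by (rule continuous_on_subset) auto
    show "((\<lambda>t. u t x) has_real_derivative anderson V (u s) x) (at s)" if "0 < s" for s x by (rule D(2)[OF that])
  qed (use A t True D(1,3) in \<open>auto simp: dsol_0 intro!: dsol_continuous dsol_deriv\<close>)
qed (use nonneg_pam_solutionD[OF u] t in simp)

text \<open>The product is the weight of the shortest paths from \<open>z\<close> to
  \<open>z + x\<close>: its derivative in \<tau> is the sum of the same products over the neighbours
  \<open>dn i\<close> of \<open>x\<close> that are one step closer to 0. Since V is nonnegative,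
  discarding V and all other neighbours only lowers the growth of \<open>u\<close>, and the bound
  follows by induction on \<open>nrm x\<close>.\<close>

lemma heat_lower_bound:
  fixes V :: "int ^ 'd \<Rightarrow> real"
  assumes u: "nonneg_pam_solution V u" and V: "\<And>x. 0 \<le> V x" and s: "0 \<le> s" and \<tau>: "0 \<le> \<tau>"
  shows "u s z * exp (- 2 * real CARD('d) * \<tau>) * (\<Prod>i\<in>UNIV. \<tau> ^ nat \<bar>x $ i\<bar> / fact (nat \<bar>x $ i\<bar>))
         \<le> u (s + \<tau>) (z + x)"
  using \<tau>
proof (induction "nrm x" arbitrary: x \<tau> rule: less_induct)
  case less
  note D = nonneg_pam_solutionD[OF u]
  define d where "d = real CARD('d)"
  define p where "p = (\<lambda>x \<tau>. \<Prod>i\<in>(UNIV::'d set). \<tau> ^ nat \<bar>x $ i\<bar> / fact (nat \<bar>x $ i\<bar>) :: real)"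
  define dn where "dn i = x - axis i (sgn (x $ i))" for i
  define I where "I = {i. x $ i \<noteq> 0}"
  have nat_dn: "nat \<bar>dn i $ j\<bar> = (if i = j then nat \<bar>x $ i\<bar> - 1 else nat \<bar>x $ j\<bar>)" if "i \<in> I" for i j
    using that by (auto simp: dn_def I_def axis_nth_int sgn_if)
  have nrm_dn: "nrm (dn i) < nrm x" if "i \<in> I" for i
    unfolding nrm_def nat_dn[OF that]
    by (rule sum_strict_mono_ex1) (use that in \<open>auto simp: I_def\<close>)
  have dn_nb: "dn i \<in> nb x" if "i \<in> I" for i
  proof -
    have "sgn (x $ i) = 1 \<or> sgn (x $ i) = -1" using that by (auto simp: I_def sgn_if)
    moreover have "x - axis i (- 1) = x + axis i 1"
      by (auto simp: vec_eq_iff axis_nth_int)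
    ultimately show ?thesis unfolding nb_eq dn_def by auto
  qed
  have inj: "inj_on dn I"
  proof (rule inj_onI, rule ccontr)
    fix i j assume ij: "i \<in> I" "j \<in> I" "dn i = dn j" "i \<noteq> j"
    then have "nat \<bar>x $ i\<bar> - 1 = nat \<bar>x $ i\<bar>"
      using nat_dn[OF ij(1), of i] nat_dn[OF ij(2), of i] by simp
    moreover have "x $ i \<noteq> 0" using ij(1) by (simp add: I_def)
    ultimately show False by simp
  qed
  have dp: "((\<lambda>\<tau>. p x \<tau>) has_real_derivative (\<Sum>i\<in>I. p (dn i) \<tau>)) (at \<tau>)" for \<tau>
  proof -
    have "((\<lambda>\<tau>. p x \<tau>) has_real_derivative
        (\<Sum>i\<in>UNIV. (real (nat \<bar>x $ i\<bar>) * \<tau> ^ (nat \<bar>x $ i\<bar> - 1) / fact (nat \<bar>x $ i\<bar>)) *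
           (\<Prod>j\<in>UNIV - {i}. \<tau> ^ nat \<bar>x $ j\<bar> / fact (nat \<bar>x $ j\<bar>)))) (at \<tau>)"
      unfolding p_def by (intro has_field_derivative_prod) (auto intro!: derivative_eq_intros)
    also have "(\<Sum>i\<in>UNIV. (real (nat \<bar>x $ i\<bar>) * \<tau> ^ (nat \<bar>x $ i\<bar> - 1) / fact (nat \<bar>x $ i\<bar>)) *
           (\<Prod>j\<in>UNIV - {i}. \<tau> ^ nat \<bar>x $ j\<bar> / fact (nat \<bar>x $ j\<bar>))) = 
        (\<Sum>i\<in>I. (real (nat \<bar>x $ i\<bar>) * \<tau> ^ (nat \<bar>x $ i\<bar> - 1) / fact (nat \<bar>x $ i\<bar>)) *
           (\<Prod>j\<in>UNIV - {i}. \<tau> ^ nat \<bar>x $ j\<bar> / fact (nat \<bar>x $ j\<bar>)))"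
      by (rule sum.mono_neutral_right) (auto simp: I_def)
    also have "\<dots> = (\<Sum>i\<in>I. p (dn i) \<tau>)"
    proof (rule sum.cong)
      fix i assume i: "i \<in> I"
      then have n: "nat \<bar>x $ i\<bar> = Suc (nat \<bar>x $ i\<bar> - 1)" by (auto simp: I_def)
      have "p (dn i) \<tau> = \<tau> ^ (nat \<bar>x $ i\<bar> - 1) / fact (nat \<bar>x $ i\<bar> - 1) *
          (\<Prod>j\<in>UNIV - {i}. \<tau> ^ nat \<bar>x $ j\<bar> / fact (nat \<bar>x $ j\<bar>))"
        unfolding p_def nat_dn[OF i] by (subst prod.remove[of _ i]) auto
      moreover have "real (nat \<bar>x $ i\<bar>) * \<tau> ^ (nat \<bar>x $ i\<bar> - 1) / fact (nat \<bar>x $ i\<bar>) =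
        \<tau> ^ (nat \<bar>x $ i\<bar> - 1) / fact (nat \<bar>x $ i\<bar> - 1)"
        by (subst (1 3) n) (simp del: of_nat_Suc)
      ultimately show "real (nat \<bar>x $ i\<bar>) * \<tau> ^ (nat \<bar>x $ i\<bar> - 1) / fact (nat \<bar>x $ i\<bar>) *
           (\<Prod>j\<in>UNIV - {i}. \<tau> ^ nat \<bar>x $ j\<bar> / fact (nat \<bar>x $ j\<bar>)) = p (dn i) \<tau>" by simp
    qed simp
    finally show ?thesis .
  qed
  \<comment> \<open>The factor \<open>exp (2 * d * \<tau>)\<close> removes the diagonal part of the
    Laplacian; the claim becomes \<open>0 <= g \<tau>\<close>.\<close>
  define g where "g \<tau> = exp (2 * d * \<tau>) * u (s + \<tau>) (z + x) - u s z * p x \<tau>" for \<tau>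
  have "g 0 \<le> g \<tau>"
  proof (cases "\<tau> = 0")
    case False
    show ?thesis
    proof (rule DERIV_nonneg_imp_increasing_open[of 0 \<tau> g])
      have "continuous_on {0..\<tau>} (\<lambda>\<tau>. u (s + \<tau>) (z + x))"
        by (rule continuous_on_compose2[OF D(4)]) (use s in \<open>auto intro!: continuous_intros\<close>)
      then show "continuous_on {0..\<tau>} g"
        unfolding g_def p_def by (intro continuous_intros) auto
      fix r assume r: "0 < r" "r < \<tau>"
      let ?D = "(\<Sum>y\<in>nb (z + x). u (s + r) y) + (V (z + x) - 2 * d) * u (s + r) (z + x)"
      have "((\<lambda>\<tau>. u (s + \<tau>) (z + x)) has_real_derivative ?D * 1) (at r)"
        unfolding d_def by (rule DERIV_chain2[OF D(2)]) (use r s in \<open>auto intro!: derivative_eq_intros\<close>)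
      then have "(g has_real_derivative
          (exp (2 * d * r) * (?D + 2 * d * u (s + r) (z + x)) - u s z * (\<Sum>i\<in>I. p (dn i) r))) (at r)"
        unfolding g_def by - (rule derivative_eq_intros dp refl | simp add: algebra_simps)+
      moreover have "u s z * (\<Sum>i\<in>I. p (dn i) r) \<le> exp (2 * d * r) * (?D + 2 * d * u (s + r) (z + x))"
      proof -
        have "u s z * (\<Sum>i\<in>I. p (dn i) r) = (\<Sum>i\<in>I. u s z * p (dn i) r)"
          by (simp add: sum_distrib_left)
        also have "\<dots> \<le> (\<Sum>i\<in>I. exp (2 * d * r) * u (s + r) (z + dn i))"
        proof (rule sum_mono)
          fix i assume "i \<in> I"
          from less.hyps[OF nrm_dn[OF this], of r] r
          have "u s z * exp (- (2 * d * r)) * p (dn i) r \<le> u (s + r) (z + dn i)"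
            by (simp add: p_def d_def)
          from mult_left_mono[OF this, of "exp (2 * d * r)"]
          show "u s z * p (dn i) r \<le> exp (2 * d * r) * u (s + r) (z + dn i)"
            by (simp add: mult_ac flip: exp_add mult.assoc)
        qed
        also have "\<dots> = exp (2 * d * r) * (\<Sum>y\<in>dn ` I. u (s + r) (z + y))"
          by (simp add: sum.reindex[OF inj] sum_distrib_left)
        also have "(\<Sum>y\<in>dn ` I. u (s + r) (z + y)) \<le> (\<Sum>y\<in>nb x. u (s + r) (z + y))"
          by (rule sum_mono2) (use finite_nearest_nbr dn_nb D(1) r s in auto)
        also have "(\<Sum>y\<in>nb x. u (s + r) (z + y)) = (\<Sum>y\<in>nb (z + x). u (s + r) y)"
          by (subst add.commute[of z x], subst nb_translate, subst sum.reindex) (auto simp: inj_on_def add_ac)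
        also have "\<dots> \<le> ?D + 2 * d * u (s + r) (z + x)"
          using V[of "z + x"] D(1)[of "s + r" "z + x"] r s by (simp add: algebra_simps)
        finally show ?thesis by simp
      qed
      ultimately show "\<exists>y. (g has_real_derivative y) (at r) \<and> 0 \<le> y"
        by (intro exI conjI) auto
    qed (use less.prems in auto)
  qed simp
  moreover have "0 \<le> g 0"
  proof (cases "x = 0")
    case True
    then show ?thesis by (simp add: g_def p_def)
  next
    case False
    then obtain i where "x $ i \<noteq> 0" by (auto simp: vec_eq_iff)
    then have "p x 0 = 0" unfolding p_def by (intro prod_zero bexI[of _ i]) auto
    then show ?thesis using D(1)[of s "z + x"] s by (simp add: g_def)
  qed
  ultimately have "u s z * p x \<tau> \<le> exp (2 * d * \<tau>) * u (s + \<tau>) (z + x)" by (simp add: g_def)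
  then have "exp (- (2 * d * \<tau>)) * (u s z * p x \<tau>) \<le> exp (- (2 * d * \<tau>)) * (exp (2 * d * \<tau>) * u (s + \<tau>) (z + x))"
    by (rule mult_left_mono) simp
  also have "\<dots> = u (s + \<tau>) (z + x)"
    by (simp add: exp_minus)
  finally show ?case by (simp add: p_def d_def mult_ac)
qed

section \<open>Lower bounds, uniqueness and the far tail\<close>

text \<open>
  \<open>exp (entr m)\<close> is the number of shortest paths from the origin to \<open>m\<close> up to a factor polynomial in \<open>nrm m\<close>
  (Stirling). Since \<open>ln 0 = 0\<close>, vanishing coordinates contribute nothing.
\<close>

definition entr :: "int ^ 'd \<Rightarrow> real" where
  "entr m = real (nrm m) * ln (real (nrm m)) - (\<Sum>i\<in>UNIV. real (nat \<bar>m $ i\<bar>) * ln (real (nat \<bar>m $ i\<bar>)))"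

definition Phi :: "real \<Rightarrow> real \<Rightarrow> int ^ 'd \<Rightarrow> real" where
  "Phi t x m = t * x - real (nrm m) * ln x + entr m"

text \<open>Half of Stirling's formula. The induction step is
  \<open>ln n + 1 / (n + 1) <= ln (n + 1)\<close>; at 0 the bound reads \<open>0 <= 1\<close>
  because \<open>ln 0 = 0\<close>.\<close>

lemma ln_fact_le: "ln (fact n) \<le> real n * ln (real n) - real n + ln (real n) + 1"
proof (induction n)
  case (Suc n)
  show ?case
  proof (cases "n = 0")
    case False
    have "ln (real n) + 1 / real (Suc n) \<le> ln (real (Suc n))"
    proof -
      have "ln (real n / real (Suc n)) \<le> real n / real (Suc n) - 1"
        using False by (intro ln_le_minus_one) auto
      also have "ln (real n / real (Suc n)) = ln (real n) - ln (real (Suc n))"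
        using False by (simp add: ln_div del: of_nat_Suc)
      also have "real n / real (Suc n) - 1 = - (1 / real (Suc n))"
        by (simp add: field_simps)
      finally show ?thesis by simp
    qed
    then have "real (Suc n) * (ln (real n) + 1 / real (Suc n)) \<le> real (Suc n) * ln (real (Suc n))"
      by (intro mult_left_mono) auto
    then have "real (Suc n) * ln (real n) + 1 \<le> real (Suc n) * ln (real (Suc n))"
      by (simp add: distrib_left del: of_nat_Suc)
    moreover have "ln (fact (Suc n) :: real) = ln (real (Suc n)) + ln (fact n)"
      unfolding fact_Suc by (subst ln_mult) auto
    ultimately show ?thesis using Suc.IH by (simp add: algebra_simps)
  qed simp
qed simp

text \<open>Multinomial coefficients are at least 1.\<close>

lemma prod_fact_le_fact_sum: "finite I \<Longrightarrow> (\<Prod>i\<in>I. fact (f i) :: real) \<le> fact (\<Sum>i\<in>I. f i)"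
proof (induction I rule: finite_induct)
  case (insert i I)
  have "(fact (f i) :: nat) * fact (\<Sum>i\<in>I. f i) \<le> fact (f i + (\<Sum>i\<in>I. f i))"
    by (rule dvd_imp_le[OF fact_fact_dvd_fact]) simp
  then have "real (fact (f i) * fact (\<Sum>i\<in>I. f i)) \<le> real (fact (f i + (\<Sum>i\<in>I. f i)))"
    by (rule of_nat_mono)
  then have "(fact (f i) :: real) * fact (\<Sum>i\<in>I. f i) \<le> fact (f i + (\<Sum>i\<in>I. f i))"
    by simp
  moreover have "(fact (f i) :: real) * (\<Prod>i\<in>I. fact (f i)) \<le> fact (f i) * fact (\<Sum>i\<in>I. f i)"
    by (intro mult_left_mono insert.IH) simp
  ultimately have "(fact (f i) :: real) * (\<Prod>i\<in>I. fact (f i)) \<le> fact (f i + (\<Sum>i\<in>I. f i))"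
    by (rule order_trans[rotated])
  then show ?case using insert by simp
qed simp

text \<open>The inflow from the neighbours is nonnegative, so the mass at \<open>m\<close> grows at
  least at its own diagonal rate.\<close>

lemma solution_growth:
  fixes V :: "int ^ 'd \<Rightarrow> real"
  assumes u: "nonneg_pam_solution V u" and s: "0 \<le> s" "s \<le> t"
  shows "exp ((V m - 2 * real CARD('d)) * (t - s)) * u s m \<le> u t m"
proof -
  note D = nonneg_pam_solutionD[OF u]
  show ?thesis
  proof (rule gronwall_lower[OF s(2), where f' = "\<lambda>r. anderson V (u r) m"])
    show "continuous_on {s..t} (\<lambda>r. u r m)" using s by (intro continuous_on_subset[OF D(4)]) auto
    fix r assume "s < r" "r < t"
    then have r: "0 < r" using s by simp
    show "((\<lambda>r. u r m) has_real_derivative anderson V (u r) m) (at r)" by (rule D(2)[OF r])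
    have "0 \<le> (\<Sum>y\<in>nb m. u r y)" using r by (intro sum_nonneg D(1)) auto
    then show "(V m - 2 * real CARD('d)) * u r m \<le> anderson V (u r) m" by simp
  qed
qed

text \<open>The arrival time \<open>s = nrm m / V m\<close> maximises
  \<open>s ^ nrm m * exp (- V m * s)\<close>. With it the loss \<open>V m * s = nrm m\<close> is
  cancelled exactly by the linear term in Stirling's bound, and the \<open>k ln k\<close> terms
  combine with \<open>nrm m * ln s\<close> to the entropy and the logarithm in \<open>Phi\<close>.
  The hypothesis on \<open>t\<close> says \<open>s <= t\<close>.\<close>

lemma solution_lower_bound:
  fixes V :: "int ^ 'd \<Rightarrow> real"
  assumes u: "nonneg_pam_solution V u" and V: "\<And>x. 0 \<le> V x" and X: "0 < V m"
    and t: "real (nrm m) \<le> t * V m" 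
  shows "exp (Phi t (V m) m - 2 * real CARD('d) * t - real CARD('d) * (ln (real (nrm m)) + 1)) \<le> u t m"
proof -
  note D = nonneg_pam_solutionD[OF u]
  define X where "X = V m"
  define d where "d = real CARD('d)"
  define k where "k i = nat \<bar>m $ i\<bar>" for i
  define n where "n = nrm m"
  define s where "s = real n / X"
  have nk: "n = (\<Sum>i\<in>UNIV. k i)" by (simp add: n_def nrm_def k_def)
  have s: "0 \<le> s" "s \<le> t" using X t by (auto simp: s_def X_def n_def field_simps)
  have "exp (real n * ln s - (\<Sum>i\<in>UNIV. ln (fact (k i)))) = (\<Prod>i\<in>UNIV. s ^ k i / fact (k i))"
  proof -
    have "exp (real n * ln s - (\<Sum>i\<in>UNIV. ln (fact (k i)))) = (\<Prod>i\<in>UNIV. exp (real (k i) * ln s - ln (fact (k i))))"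
      unfolding nk by (simp add: sum_subtractf sum_distrib_right flip: exp_sum)
    also have "\<dots> = (\<Prod>i\<in>UNIV. s ^ k i / fact (k i))"
    proof (rule prod.cong)
      fix i
      show "exp (real (k i) * ln s - ln (fact (k i))) = s ^ k i / fact (k i)"
      proof (cases "k i = 0")
        case False
        then have "0 < n" unfolding nk using member_le_sum[of i UNIV k] by auto
        then have "0 < s" using X by (simp add: s_def X_def)
        then show ?thesis by (simp add: exp_diff exp_of_nat_mult)
      qed simp
    qed simp
    finally show ?thesis .
  qed
  with heat_lower_bound[OF u V, of 0 s 0 m] D(3)[of 0] s
  have 1: "exp (- 2 * d * s) * exp (real n * ln s - (\<Sum>i\<in>UNIV. ln (fact (k i)))) \<le> u s m"
    by (simp add: d_def k_def)
  have "(\<Sum>i\<in>UNIV. ln (fact (k i))) \<le> (\<Sum>i\<in>UNIV. real (k i) * ln (real (k i)) - real (k i) + (ln (real n) + 1))"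
  proof (rule sum_mono)
    fix i
    have "ln (real (k i)) \<le> ln (real n)"
    proof (cases "k i = 0")
      case True
      then show ?thesis by (cases "n = 0") auto
    next
      case False
      moreover have "k i \<le> n" unfolding nk by (rule member_le_sum) auto
      ultimately show ?thesis by simp
    qed
    then show "ln (fact (k i)) \<le> real (k i) * ln (real (k i)) - real (k i) + (ln (real n) + 1)"
      using ln_fact_le[of "k i"] by linarith
  qed
  also have "\<dots> = (\<Sum>i\<in>UNIV. real (k i) * ln (real (k i))) - real n + d * (ln (real n) + 1)"
    unfolding nk by (simp add: sum.distrib sum_subtractf d_def)
  finally have 2: "(\<Sum>i\<in>UNIV. ln (fact (k i))) \<le> (\<Sum>i\<in>UNIV. real (k i) * ln (real (k i))) - real n + d * (ln (real n) + 1)" .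
  have ns: "real n * ln s = real n * ln (real n) - real n * ln X"
    using X by (cases "n = 0") (auto simp: s_def ln_div X_def algebra_simps)
  have Xs: "X * s = real n" using X by (simp add: s_def X_def)
  have "Phi t X m - 2 * d * t - d * (ln (real n) + 1) \<le> (X - 2 * d) * (t - s) + (- 2 * d * s + (real n * ln s - (\<Sum>i\<in>UNIV. ln (fact (k i)))))"
    using 2 Xs unfolding ns Phi_def entr_def n_def[symmetric] k_def[symmetric] by (simp add: algebra_simps)
  then have "exp (Phi t X m - 2 * d * t - d * (ln (real n) + 1)) \<le> exp ((X - 2 * d) * (t - s)) * (exp (- 2 * d * s) * exp (real n * ln s - (\<Sum>i\<in>UNIV. ln (fact (k i)))))"
    by (simp flip: exp_add)
  also have "\<dots> \<le> exp ((X - 2 * d) * (t - s)) * u s m"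
    by (intro mult_left_mono 1) simp
  also have "\<dots> \<le> u t m"
    using solution_growth[OF u s, of m] by (simp add: X_def d_def)
  finally show ?thesis by (simp add: X_def d_def n_def)
qed

text \<open>
  Widder's argument: whatever mass sits at \<open>z\<close> before time \<open>T\<close> reaches the origin by time \<open>T + L\<close>. As \<open>L\<close> is
  arbitrary, this bound beats the boundary flux in every large ball and forces an arbitrary nonnegative
  solution to be the limit of the Dirichlet solutions.
\<close>

lemma solution_apriori_bound:
  fixes V :: "int ^ 'd \<Rightarrow> real"
  assumes u: "nonneg_pam_solution V u" and V: "\<And>x. 0 \<le> V x" and T: "0 \<le> T" and L: "0 < L"
  obtains C where "0 \<le> C" "\<And>s z. 0 \<le> s \<Longrightarrow> s \<le> T \<Longrightarrow> u s z \<le> C * (fact (nrm z) / L ^ nrm z)"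
proof -
  note D = nonneg_pam_solutionD[OF u]
  define d where "d = real CARD('d)"
  define C where "C = exp (2 * d * (T + L)) * u (T + L) 0"
  have "u s z \<le> C * (fact (nrm z) / L ^ nrm z)" if s: "0 \<le> s" "s \<le> T" for s z
  proof -
    \<comment> \<open>The time left until \<open>T + L\<close>; since it is at least
      \<open>L\<close>, one value of \<open>u\<close> at the origin controls all earlier masses up
      to time \<open>T\<close>.\<close>
    define \<tau> where "\<tau> = T + L - s"
    have \<tau>: "L \<le> \<tau>" "0 \<le> \<tau>" "\<tau> \<le> T + L" using s L by (auto simp: \<tau>_def)
    have "L ^ nrm z / fact (nrm z) \<le> (\<Prod>i\<in>UNIV. L ^ nat \<bar>z $ i\<bar>) / (\<Prod>i\<in>UNIV. fact (nat \<bar>z $ i\<bar>))"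
      unfolding nrm_def power_sum using L
      by (intro divide_left_mono prod_fact_le_fact_sum mult_pos_pos prod_pos prod_nonneg) auto
    also have "\<dots> = (\<Prod>i\<in>UNIV. L ^ nat \<bar>z $ i\<bar> / fact (nat \<bar>z $ i\<bar>))"
      by (simp add: prod_dividef)
    also have "\<dots> \<le> (\<Prod>i\<in>UNIV. \<tau> ^ nat \<bar>z $ i\<bar> / fact (nat \<bar>z $ i\<bar>))"
      using L \<tau> by (intro prod_mono conjI divide_right_mono power_mono) auto
    finally have p: "L ^ nrm z / fact (nrm z) \<le> (\<Prod>i\<in>UNIV. \<tau> ^ nat \<bar>z $ i\<bar> / fact (nat \<bar>z $ i\<bar>))" .
    have "u s z * exp (- 2 * d * (T + L)) * (L ^ nrm z / fact (nrm z)) \<le>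
      u s z * exp (- 2 * d * \<tau>) * (\<Prod>i\<in>UNIV. \<tau> ^ nat \<bar>z $ i\<bar> / fact (nat \<bar>z $ i\<bar>))"
      using \<tau> L s D(1)[of s z] by (intro mult_mono p) (auto simp: d_def)
    also have "\<dots> \<le> u (T + L) 0"
      using heat_lower_bound[OF u V s(1) \<tau>(2), of z "- z"] by (simp add: d_def \<tau>_def)
    finally have "exp (2 * d * (T + L)) * (u s z * exp (- 2 * d * (T + L)) * (L ^ nrm z / fact (nrm z)))
        \<le> exp (2 * d * (T + L)) * u (T + L) 0"
      by (rule mult_left_mono) simp
    also have "exp (2 * d * (T + L)) * (u s z * exp (- 2 * d * (T + L)) * (L ^ nrm z / fact (nrm z)))
        = u s z * (L ^ nrm z / fact (nrm z))"
      by (simp add: exp_minus)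
    finally show ?thesis using L
      by (simp add: C_def field_simps)
  qed
  moreover have "0 \<le> C" unfolding C_def using D(1)[of "T + L" 0] T L by simp
  ultimately show thesis using that by blast
qed

text \<open>\<open>Q\<close> is a barrier for the flux through the sphere: at least \<open>B\<close>
  on \<open>nrm y = Suc n\<close>, and falling off by a factor \<open>exp (- c)\<close> per step
  inwards. A slope \<open>c\<close> costs a growth rate \<open>2 * d * exp c\<close>, a trade-off
  which is optimised later through the choice of \<open>c\<close>.\<close>

lemma solution_le_dsol_lball:
  fixes V :: "int ^ 'd \<Rightarrow> real"
  assumes u: "nonneg_pam_solution V u" and t: "0 \<le> t"
    and M: "\<And>x. nrm x \<le> n \<Longrightarrow> V x \<le> M" and B: "0 \<le> M" "0 \<le> B" "0 \<le> c"
    and bd: "\<And>s y. 0 \<le> s \<Longrightarrow> s \<le> t \<Longrightarrow> nrm y = Suc n \<Longrightarrow> u s y \<le> B"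
    and x: "nrm x \<le> n"
  shows "u t x \<le> dsol V (lball n) t x + B * exp ((M + 2 * real CARD('d) * exp c) * t - c * (real (Suc n) - real (nrm x)))"
proof -
  note D = nonneg_pam_solutionD[OF u]
  define d where "d = real CARD('d)"
  define l where "l = M + 2 * d * exp c"
  define Q where "Q = (\<lambda>t (x :: int ^ 'd). B * exp (l * t - c * (real (Suc n) - real (nrm x))))"
  have fin: "finite (lball n :: (int ^ 'd) set)" by (rule finite_lball)
  have "u t x \<le> Q t x + dsol V (lball n) t x"
  proof (rule lattice_comparison[where V = V and A = "lball n" and T = t and v = "\<lambda>t x. Q t x + dsol V (lball n) t x"
     and v' = "\<lambda>t x. l * Q t x + anderson V (dsol V (lball n) t) x"])
    fix s :: real and x :: "int ^ 'd" assume x: "x \<in> lball n" and s: "0 < s"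
    show "((\<lambda>t. u t x) has_real_derivative anderson V (u s) x) (at s)" by (rule D(2)[OF s])
    have "((\<lambda>t. Q t x) has_real_derivative l * Q s x) (at s)"
      unfolding Q_def by (rule derivative_eq_intros refl | simp)+
    then show "((\<lambda>t. Q t x + dsol V (lball n) t x) has_real_derivative l * Q s x + anderson V (dsol V (lball n) s) x) (at s)"
      by (intro DERIV_add dsol_deriv[OF fin] x)
    have "(\<Sum>y\<in>nb x. Q s y) \<le> (\<Sum>y\<in>nb x. exp c * Q s x)"
    proof (rule sum_mono)
      fix y assume "y \<in> nb x"
      then have "real (nrm y) \<le> real (nrm x) + 1" using nrm_nb(1)[of y x] by simp
      then have "c * real (nrm y) \<le> c * (real (nrm x) + 1)" using B by (intro mult_left_mono) auto
      then have "exp (l * s - c * (real (Suc n) - real (nrm y))) \<le> exp (c + (l * s - c * (real (Suc n) - real (nrm x))))"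
        by (simp add: algebra_simps)
      from mult_left_mono[OF this B(2)] show "Q s y \<le> exp c * Q s x"
        unfolding Q_def exp_add by (simp add: algebra_simps)
    qed
    also have "\<dots> = 2 * d * exp c * Q s x" by (simp add: card_nb d_def)
    finally have 1: "(\<Sum>y\<in>nb x. Q s y) \<le> 2 * d * exp c * Q s x" .
    have Q0: "0 \<le> Q s x" using B by (simp add: Q_def)
    have "V x \<le> M" using M x by (simp add: lball_def)
    then have "(V x - 2 * d) * Q s x \<le> M * Q s x"
      using Q0 by (intro mult_right_mono) (auto simp: d_def)
    with 1 show "anderson V (\<lambda>y. Q s y + dsol V (lball n) s y) x \<le> l * Q s x + anderson V (dsol V (lball n) s) x"
      by (simp add: sum.distrib l_def d_def algebra_simps)
  next
    fix s and x y :: "int ^ 'd" assume s: "0 < s" "s < t" and xy: "x \<in> lball n" "y \<in> nb x" "y \<notin> lball n"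
    then have n: "nrm y = Suc n" using nrm_nb(1)[of y x] by (auto simp: lball_def)
    have "0 \<le> l" using B by (simp add: l_def d_def)
    then have "B * 1 \<le> Q s y" unfolding Q_def n using s B by (intro mult_left_mono) auto
    with bd[of s y] n s have "u s y \<le> Q s y" by simp
    then show "u s y \<le> Q s y + dsol V (lball n) s y"
      using dsol_nonneg[OF fin, of s V y] s by simp
  next
    fix x :: "int ^ 'd"
    show "continuous_on {0..t} (\<lambda>t. Q t x + dsol V (lball n) t x)" "continuous_on {0..t} (\<lambda>t. u t x)"
      unfolding Q_def by (auto intro!: continuous_intros dsol_continuous fin continuous_on_subset[OF D(4)])
  qed (use fin t x D B in \<open>auto simp: dsol_0 lball_def Q_def\<close>)
  then show ?thesis by (simp add: Q_def l_def d_def)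
qed

text \<open>On the new sphere the supersolution \<open>exp (l * t - 2 * nrm x)\<close> applies. Its
  value there, constant in space, is itself a supersolution inside because \<open>V <= l\<close>, so
  it bounds the increment in the whole ball. The slope 2 leaves \<open>exp (- Suc n)\<close> as soon
  as \<open>l * t <= Suc n\<close>, which is summable over the radii.\<close>

lemma dsol_lball_step:
  fixes V :: "int ^ 'd \<Rightarrow> real"
  assumes t: "0 \<le> t" and M: "\<And>x. nrm x \<le> Suc n \<Longrightarrow> V x \<le> M" and M0: "0 \<le> M"
    and x: "nrm x \<le> Suc n"
  shows "dsol V (lball (Suc n)) t x \<le> dsol V (lball n) t x + exp ((M + 2 * real CARD('d) * exp 2) * t - 2 * real (Suc n))"
proof -
  define d where "d = real CARD('d)"
  define l where "l = M + 2 * d * exp 2"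
  have l: "0 \<le> l" "M \<le> l" using M0 by (auto simp: l_def d_def)
  have fin: "finite (lball n :: (int ^ 'd) set)" for n by (rule finite_lball)
  have sphere: "dsol V (lball (Suc n)) s y \<le> exp (l * s - 2 * real (Suc n))" if "0 \<le> s" "nrm y = Suc n" for s y
  proof -
    have "dsol V (lball (Suc n)) s y \<le> exp (l * s) * exp (- 2 * real (nrm y))"
    proof (rule dsol_le_supersolution[OF fin that(1)])
      fix x :: "int ^ 'd" assume x: "x \<in> lball (Suc n)"
      have "(\<Sum>y\<in>nb x. exp (- 2 * real (nrm y))) \<le> (\<Sum>y\<in>nb x. exp 2 * exp (- 2 * real (nrm x)))"
      proof (rule sum_mono)
        fix y assume "y \<in> nb x"
        then have "real (nrm x) \<le> real (nrm y) + 1" using nrm_nb(2)[of y x] by simp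
        then show "exp (- 2 * real (nrm y)) \<le> exp 2 * exp (- 2 * real (nrm x))"
          by (simp flip: exp_add)
      qed
      also have "\<dots> = 2 * d * exp 2 * exp (- 2 * real (nrm x))" by (simp add: card_nb d_def)
      finally have 1: "(\<Sum>y\<in>nb x. exp (- 2 * real (nrm y))) \<le> 2 * d * exp 2 * exp (- 2 * real (nrm x))" .
      have "V x \<le> M" using M x by (simp add: lball_def)
      then have "(V x - 2 * d) * exp (- 2 * real (nrm x)) \<le> M * exp (- 2 * real (nrm x))"
        by (intro mult_right_mono) (auto simp: d_def)
      with 1 show "anderson V (\<lambda>x. exp (- 2 * real (nrm x))) x \<le> l * exp (- 2 * real (nrm x))"
        by (simp add: l_def d_def algebra_simps)
    qed auto
    also have "\<dots> = exp (l * s - 2 * real (Suc n))"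
      using that(2) by (simp flip: exp_add)
    finally show ?thesis .
  qed
  show ?thesis
  proof (cases "nrm x = Suc n")
    case True
    then show ?thesis using sphere[OF t True] dsol_nonneg[OF fin t, of V n x] by (simp add: l_def d_def)
  next
    case False
    then have x: "x \<in> lball n" using x by (simp add: lball_def)
    let ?f = "\<lambda>t. exp (l * t - 2 * real (Suc n))"
    have "dsol V (lball (Suc n)) t x \<le> ?f t + dsol V (lball n) t x"
    proof (rule lattice_comparison[where V = V and A = "lball n" and T = t and v = "\<lambda>t x. ?f t + dsol V (lball n) t x"
       and v' = "\<lambda>t x. l * ?f t + anderson V (dsol V (lball n) t) x"])
      fix s :: real and x :: "int ^ 'd" assume x: "x \<in> lball n"
      have "(?f has_real_derivative l * ?f s) (at s)"
        by (rule derivative_eq_intros refl | simp)+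
      then show "((\<lambda>t. ?f t + dsol V (lball n) t x) has_real_derivative l * ?f s + anderson V (dsol V (lball n) s) x) (at s)"
        by (intro DERIV_add dsol_deriv[OF fin] x)
      show "((\<lambda>t. dsol V (lball (Suc n)) t x) has_real_derivative anderson V (dsol V (lball (Suc n)) s) x) (at s)"
        using x by (intro dsol_deriv fin) (simp add: lball_def)
      have "V x \<le> l" using M[of x] x l by (simp add: lball_def)
      then have "V x * ?f s \<le> l * ?f s" by (intro mult_right_mono) auto
      then show "anderson V (\<lambda>y. ?f s + dsol V (lball n) s y) x \<le> l * ?f s + anderson V (dsol V (lball n) s) x"
        by (simp add: sum.distrib card_nb algebra_simps)
    next
      fix s and x y :: "int ^ 'd" assume s: "0 < s" "s < t" and xy: "x \<in> lball n" "y \<in> nb x" "y \<notin> lball n"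
      then have n: "nrm y = Suc n" using nrm_nb(1)[of y x] by (auto simp: lball_def)
      show "dsol V (lball (Suc n)) s y \<le> ?f s + dsol V (lball n) s y"
        using sphere[of s y] n s dsol_nonneg[OF fin, of s V n y] by simp
    qed (use fin t x in \<open>auto simp: dsol_0 lball_def intro!: continuous_intros dsol_continuous\<close>)
    then show ?thesis by (simp add: l_def d_def)
  qed
qed

section \<open>Upper bound at the highest site of a region\<close>

text \<open>
  The supersolution is \<open>G = E + (2 / b) * (\<Sum>s\<in>S. E s * F (\<cdot> - s))\<close>. The exponential \<open>E\<close>, tilted towards \<open>m\<close>,
  produces the entropy term in place of a count of paths. The terms of the sum repair \<open>G\<close> at the sparse high
  sites \<open>S\<close>: \<open>F\<close> is a minimum of two supersolutions, of which the isotropic one makes returns to a high site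
  negligible and the other one makes the interaction between distinct high sites negligible.
\<close>

lemma dsol_max_site_bound:
  fixes V :: "int ^ 'd \<Rightarrow> real"
  defines "d \<equiv> real CARD('d)"
  assumes A: "finite A" and t: "0 \<le> t" and m: "m \<in> A" and max: "\<And>x. x \<in> A \<Longrightarrow> V x \<le> V m"
    and \<rho>: "\<rho> < V m" and b: "b = 1 / (V m - \<rho>)" and S: "S = {x \<in> A. \<rho> < V x}"
    and sep: "\<And>x y. x \<in> S \<Longrightarrow> y \<in> S \<Longrightarrow> x \<noteq> y \<Longrightarrow> K \<le> real (nrm (x - y))"
    and \<eta>: "0 < \<eta>" "\<eta> \<le> 1" "20 * d * b \<le> \<eta>" "16 * d\<^sup>2 * b \<le> 1"
    and K: "real (card S) * exp (- \<eta> * K) \<le> b / 4"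
  shows "dsol V A t m \<le> exp ((V m + 1) * t + entr m + real (nrm m) * (2 * \<eta> - ln (V m - \<rho>))) * (1 + 2 * (V m - \<rho>) * real (card S))"
proof -
  \<comment> \<open>\<open>b\<close> times the number of neighbours, so that
    \<open>\<beta> ^ nrm z\<close> dominates \<open>b\<close> times the sum of its values at the
    neighbours of any \<open>z\<close> other than 0.\<close>
  define \<beta> where "\<beta> = 2 * d * b"
  define b' where "b' = b * exp (2 * \<eta>)"
  define k where "k i = nat \<bar>m $ i\<bar>" for i
  define n where "n = nrm m"
  \<comment> \<open>Minimising \<open>E m\<close> under the constraint that the sum of
    \<open>exp (\<theta> i)\<close> is at most \<open>1 / b'\<close> makes
    \<open>exp (\<theta> i)\<close> proportional to \<open>k i\<close> (Lagrange condition);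
    inserting this into \<open>E m\<close> produces \<open>entr m\<close>. The cut at 0 keeps
    \<open>exp (- \<theta> i) <= 1\<close>. The factor \<open>exp (2 * \<eta>)\<close> in
    \<open>b'\<close> is slack: one half pays for the steps in the other directions, the other for
    the decay in \<open>E'\<close>.\<close>
  define \<theta> where "\<theta> i = (if k i = 0 then 0 else max 0 (ln (real (k i) / (real n * b'))))" for i
  define c where "c i = \<theta> i * of_int (sgn (m $ i))" for i
  define E where "E x = exp (- (\<Sum>i\<in>UNIV. c i * of_int (x $ i)))" for x :: "int ^ 'd"
  define E' where "E' x = E x * exp (- \<eta> * real (nrm x))" for x
  define F where "F x = min (\<beta> ^ nrm x) (E' x)" for x
  define G where "G x = E x + 2 / b * (\<Sum>s\<in>S. E s * F (x - s))" for x
  have d: "1 \<le> d" by (simp add: d_def Suc_le_eq)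
  have b0: "0 < b" using \<rho> b by simp
  have b'0: "0 < b'" using b0 by (simp add: b'_def)
  have \<beta>: "0 < \<beta>" "\<beta> \<le> 1" using \<eta> d b0 by (auto simp: \<beta>_def)
  have finS: "finite S" using A S by auto
  have nk: "n = (\<Sum>i\<in>UNIV. k i)" by (simp add: n_def nrm_def k_def)
  have kn: "k i \<le> n" for i unfolding nk by (rule member_le_sum) auto
  have E_pos: "0 < E x" for x by (simp add: E_def)
  have E_add: "E (x + y) = E x * E y" for x y
    by (simp add: E_def sum.distrib distrib_left flip: exp_add)
  have E_axis: "E (axis i 1) = exp (- c i)" "E (- axis i 1) = exp (c i)" for i
  proof -
    have "(\<Sum>j\<in>UNIV. c j * real_of_int ((axis i 1 :: int ^ 'd) $ j)) = (\<Sum>j\<in>UNIV. if i = j then c j else 0)"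
      by (intro sum.cong) (auto simp: axis_nth_int)
    then show "E (axis i 1) = exp (- c i)" "E (- axis i 1) = exp (c i)"
      by (simp_all add: E_def sum_negf)
  qed
  have cosh: "exp (- c i) + exp (c i) \<le> 2 + real (k i) / (real n * b')" for i
  proof (cases "k i = 0")
    case True
    then show ?thesis by (simp add: c_def \<theta>_def)
  next
    case False
    then have n0: "0 < n" using kn[of i] by simp
    have \<theta>0: "0 \<le> \<theta> i" by (simp add: \<theta>_def)
    have "c i = \<theta> i \<or> c i = - \<theta> i" using False by (auto simp: c_def k_def sgn_if)
    then have "exp (- c i) + exp (c i) = exp (- \<theta> i) + exp (\<theta> i)" by auto
    also have "exp (- \<theta> i) \<le> 1" using \<theta>0 by simp
    also have "exp (\<theta> i) \<le> 1 + real (k i) / (real n * b')"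
      using False n0 b'0 by (auto simp: \<theta>_def max_def)
    finally show ?thesis by simp
  qed
  have "b * (\<Sum>i\<in>UNIV. exp (- c i) + exp (c i)) \<le> b * (\<Sum>i\<in>UNIV. 2 + real (k i) / (real n * b'))"
    using b0 by (intro mult_left_mono sum_mono cosh) auto
  also have "\<dots> = b * (2 * d + real n / (real n * b'))"
    by (simp add: sum.distrib d_def nk flip: sum_divide_distrib)
  also have "\<dots> \<le> b * (2 * d + 1 / b')"
    using b0 b'0 by (intro mult_left_mono add_left_mono) (auto simp: field_simps)
  also have "\<dots> = 2 * d * b + exp (- 2 * \<eta>)"
    using b0 by (simp add: b'_def exp_minus field_simps)
  \<comment> \<open>The gap between \<open>exp (- 2 * \<eta>)\<close> and
    \<open>exp (- \<eta>)\<close> is at least \<open>exp (- 2 * \<eta>) * \<eta>\<close>, hence at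
    least \<open>\<eta> / 9\<close>; it absorbs \<open>2 * d * b\<close> by the hypothesis
    \<open>20 * d * b <= \<eta>\<close>.\<close>
  also have "\<dots> \<le> exp (- \<eta>)"
  proof -
    have "1 + \<eta> \<le> exp \<eta>" by (rule exp_ge_add_one_self)
    then have "exp (- 2 * \<eta>) * (1 + \<eta>) \<le> exp (- 2 * \<eta>) * exp \<eta>" by (rule mult_left_mono) simp
    also have "\<dots> = exp (- \<eta>)" by (simp flip: exp_add)
    finally have 1: "exp (- 2 * \<eta>) + exp (- 2 * \<eta>) * \<eta> \<le> exp (- \<eta>)" by (simp add: algebra_simps)
    have "exp (2 * \<eta>) \<le> exp 1 * exp (1::real)" using \<eta> by (simp flip: exp_add)
    also have "\<dots> \<le> 3 * 3" by (intro mult_mono exp_le) auto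
    finally have "1 \<le> 9 * exp (- 2 * \<eta>)" by (simp add: exp_minus field_simps)
    then have "2 * d * b * 1 \<le> 2 * d * b * (9 * exp (- 2 * \<eta>))" using d b0 by (intro mult_left_mono) auto
    also have "\<dots> = exp (- 2 * \<eta>) * (18 * d * b)" by simp
    also have "\<dots> \<le> exp (- 2 * \<eta>) * \<eta>"
      using \<eta>(3) d b0 by (intro mult_left_mono) (auto intro: order_trans[OF _ \<eta>(3)])
    finally show ?thesis using 1 by simp
  qed
  finally have step: "b * (\<Sum>i\<in>UNIV. exp (- c i) + exp (c i)) \<le> exp (- \<eta>)" .
  have sumE: "(\<Sum>y\<in>nb x. E y) = E x * (\<Sum>i\<in>UNIV. exp (- c i) + exp (c i))" for x
    unfolding sum_nb diff_conv_add_uminus E_add E_axis by (simp add: sum_distrib_left distrib_left)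
  have E_super': "b * (\<Sum>y\<in>nb x. E y) \<le> exp (- \<eta>) * E x" for x
    using mult_left_mono[OF step, of "E x"] E_pos[of x] unfolding sumE by (simp add: mult_ac)
  have E_super: "b * (\<Sum>y\<in>nb x. E y) \<le> E x" for x
  proof -
    have "exp (- \<eta>) * E x \<le> 1 * E x" using \<eta> E_pos[of x] by (intro mult_right_mono) auto
    with E_super'[of x] show ?thesis by simp
  qed
  have F_super: "b * (\<Sum>y\<in>nb z. F y) \<le> F z" if "z \<noteq> 0" for z
  proof -
    have "nrm z \<noteq> 0" using that by simp
    then obtain j where j: "nrm z = Suc j" using not0_implies_Suc by blast
    have "b * (\<Sum>y\<in>nb z. F y) \<le> b * (\<Sum>y\<in>nb z. \<beta> ^ j)"
    proof (intro mult_left_mono sum_mono)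
      fix y assume "y \<in> nb z"
      then have "j \<le> nrm y" using nrm_nb(2)[of y z] j by simp
      then have "\<beta> ^ nrm y \<le> \<beta> ^ j" using \<beta> by (intro power_decreasing) auto
      then show "F y \<le> \<beta> ^ j" by (simp add: F_def)
    qed (use b0 in auto)
    also have "\<dots> = \<beta> ^ nrm z" by (simp add: card_nb j \<beta>_def d_def)
    finally have 1: "b * (\<Sum>y\<in>nb z. F y) \<le> \<beta> ^ nrm z" .
    have "b * (\<Sum>y\<in>nb z. F y) \<le> b * (\<Sum>y\<in>nb z. exp \<eta> * exp (- \<eta> * real (nrm z)) * E y)"
    proof (intro mult_left_mono sum_mono)
      fix y assume "y \<in> nb z"
      then have "\<eta> * real (nrm z) \<le> \<eta> * (real (nrm y) + 1)" using nrm_nb(2)[of y z] \<eta> 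
        by (intro mult_left_mono) auto
      then have "exp (- \<eta> * real (nrm y)) \<le> exp \<eta> * exp (- \<eta> * real (nrm z))"
        by (simp add: algebra_simps flip: exp_add)
      from mult_right_mono[OF this, of "E y"] E_pos[of y]
      have "E' y \<le> exp \<eta> * exp (- \<eta> * real (nrm z)) * E y" by (simp add: E'_def mult_ac)
      then show "F y \<le> exp \<eta> * exp (- \<eta> * real (nrm z)) * E y" by (simp add: F_def)
    qed (use b0 in auto)
    also have "\<dots> = exp \<eta> * exp (- \<eta> * real (nrm z)) * (b * (\<Sum>y\<in>nb z. E y))"
      by (simp add: sum_distrib_left mult_ac)
    also have "\<dots> \<le> exp \<eta> * exp (- \<eta> * real (nrm z)) * (exp (- \<eta>) * E z)"
      by (intro mult_left_mono E_super') auto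
    also have "\<dots> = E' z" by (simp add: E'_def exp_minus)
    finally show ?thesis using 1 by (simp add: F_def)
  qed
  have F0: "F 0 = 1" by (simp add: F_def E'_def E_def)
  have F_nonneg: "0 \<le> F z" for z using \<beta> E_pos[of z] by (simp add: F_def E'_def less_imp_le)
  have F_ret: "b * (\<Sum>y\<in>nb 0. F y) \<le> \<beta>\<^sup>2"
  proof -
    have "b * (\<Sum>y\<in>nb 0. F y) \<le> b * (\<Sum>y\<in>nb (0 :: int ^ 'd). \<beta>)"
      using b0 by (intro mult_left_mono sum_mono) (auto simp: F_def nearest_nbr_nrm)
    also have "\<dots> = \<beta>\<^sup>2" by (simp add: card_nb \<beta>_def d_def power2_eq_square)
    finally show ?thesis .
  qed
  have shift: "(\<Sum>y\<in>nb x. F (y - s)) = (\<Sum>y\<in>nb (x - s). F y)" for x s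
    unfolding sum_nb by (intro sum.cong arg_cong2[of _ _ _ _ "(+)"] arg_cong[of _ _ F]) auto
  have sumG: "b * (\<Sum>y\<in>nb x. G y) = b * (\<Sum>y\<in>nb x. E y) + 2 / b * (\<Sum>s\<in>S. E s * (b * (\<Sum>y\<in>nb (x - s). F y)))" for x
    unfolding G_def sum.distrib shift[symmetric]
    by (simp add: sum_distrib_left distrib_left mult_ac sum.swap[of _ S])
  have ES: "E s * E (x - s) = E x" for x s
    using E_add[of s "x - s"] by simp
  have bound: "dsol V A t m \<le> exp ((V m + 1) * t) * G m"
  proof (rule dsol_le_supersolution[OF A t])
    show G0: "0 \<le> G x" for x
      unfolding G_def using b0 E_pos F_nonneg
      by (intro add_nonneg_nonneg mult_nonneg_nonneg sum_nonneg) (auto intro: less_imp_le)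
    show "1 \<le> G 0"
    proof -
      have "0 \<le> 2 / b * (\<Sum>s\<in>S. E s * F (0 - s))"
        using b0 E_pos F_nonneg by (intro mult_nonneg_nonneg sum_nonneg) (auto intro: less_imp_le)
      then show ?thesis by (simp add: G_def E_def)
    qed
    fix x assume x: "x \<in> A"
    have "(\<Sum>y\<in>nb x. G y) \<le> (V m + 1 + 2 * d - V x) * G x"
    proof (cases "x \<in> S")
      \<comment> \<open>Here \<open>V x <= \<rho>\<close>, so the sum over neighbours may be as
        large as \<open>(V m - \<rho>) * G x = G x / b\<close>, and every summand of
        \<open>G\<close> satisfies this.\<close>
      case False
      have "b * (\<Sum>y\<in>nb x. G y) \<le> G x"
        unfolding sumG unfolding G_def using b0 E_pos False
        by (intro add_mono mult_left_mono sum_mono E_super F_super) (auto intro: less_imp_le)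
      then have "(\<Sum>y\<in>nb x. G y) \<le> (V m - \<rho>) * G x" using b \<rho> by (simp add: field_simps)
      also have "\<dots> \<le> (V m + 1 + 2 * d - V x) * G x"
        using False x S d by (intro mult_right_mono G0) auto
      finally show ?thesis .
    next
      \<comment> \<open>Here \<open>V x\<close> may equal \<open>V m\<close>, and only a bounded
        multiple of \<open>G x\<close> is allowed. The spike \<open>2 / b * E x\<close> contained in
        \<open>G x\<close> pays: returns to \<open>x\<close> contribute
        \<open>8 * d\<^sup>2 * b * E x\<close> and the other high sites \<open>E x / 2\<close>,
        together at most \<open>E x\<close>, to \<open>b\<close> times the sum.\<close>
      case True
      have "(\<Sum>s\<in>S - {x}. E s * (b * (\<Sum>y\<in>nb (x - s). F y))) \<le> (\<Sum>s\<in>S - {x}. E x * exp (- \<eta> * K))"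
      proof (rule sum_mono)
        fix s assume s: "s \<in> S - {x}"
        then have "\<eta> * K \<le> \<eta> * real (nrm (x - s))" using sep[OF True, of s] \<eta> by (intro mult_left_mono) auto
        then have "E s * E (x - s) * exp (- \<eta> * real (nrm (x - s))) \<le> E x * exp (- \<eta> * K)"
          unfolding ES using E_pos[of x] by simp
        moreover have "b * (\<Sum>y\<in>nb (x - s). F y) \<le> E' (x - s)"
          using F_super[of "x - s"] s by (auto simp: F_def)
        from mult_left_mono[OF this, of "E s"] E_pos[of s]
        have "E s * (b * (\<Sum>y\<in>nb (x - s). F y)) \<le> E s * E (x - s) * exp (- \<eta> * real (nrm (x - s)))"
          by (simp add: E'_def mult_ac)
        ultimately show "E s * (b * (\<Sum>y\<in>nb (x - s). F y)) \<le> E x * exp (- \<eta> * K)" by linarith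
      qed
      also have "\<dots> = real (card (S - {x})) * exp (- \<eta> * K) * E x" by simp
      also have "\<dots> \<le> real (card S) * exp (- \<eta> * K) * E x"
        using E_pos[of x] finS by (intro mult_right_mono) (auto intro: card_mono less_imp_le)
      also have "\<dots> \<le> b / 4 * E x"
        using E_pos[of x] by (intro mult_right_mono K) (auto intro: less_imp_le)
      finally have 1: "(\<Sum>s\<in>S - {x}. E s * (b * (\<Sum>y\<in>nb (x - s). F y))) \<le> b / 4 * E x" .
      have "(\<Sum>s\<in>S. E s * (b * (\<Sum>y\<in>nb (x - s). F y))) =
          E x * (b * (\<Sum>y\<in>nb 0. F y)) + (\<Sum>s\<in>S - {x}. E s * (b * (\<Sum>y\<in>nb (x - s). F y)))"
        using sum.remove[OF finS True, of "\<lambda>s. E s * (b * (\<Sum>y\<in>nb (x - s). F y))"] by simp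
      also have "\<dots> \<le> E x * \<beta>\<^sup>2 + b / 4 * E x"
        using E_pos[of x] by (intro add_mono 1 mult_left_mono F_ret) (auto intro: less_imp_le)
      finally have "2 / b * (\<Sum>s\<in>S. E s * (b * (\<Sum>y\<in>nb (x - s). F y))) \<le> 2 / b * (E x * \<beta>\<^sup>2 + b / 4 * E x)"
        using b0 by (intro mult_left_mono) auto
      also have "\<dots> = (8 * d\<^sup>2 * b + 1 / 2) * E x"
        using b0 by (simp add: \<beta>_def power2_eq_square field_simps)
      also have "\<dots> \<le> 1 * E x" using \<eta>(4) E_pos[of x] by (intro mult_right_mono) auto
      finally have "b * (\<Sum>y\<in>nb x. G y) \<le> 2 * E x"
        unfolding sumG using E_super[of x] by simp
      then have "(\<Sum>y\<in>nb x. G y) \<le> 2 / b * E x" using b0 by (simp add: field_simps)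
      also have "\<dots> \<le> G x"
      proof -
        have "E x * F (x - x) \<le> (\<Sum>s\<in>S. E s * F (x - s))"
          by (rule member_le_sum[OF True]) (use finS E_pos F_nonneg in \<open>auto intro!: mult_nonneg_nonneg intro: less_imp_le\<close>)
        then have "2 / b * E x \<le> 2 / b * (\<Sum>s\<in>S. E s * F (x - s))"
          using b0 F0 by (intro mult_left_mono) auto
        then show ?thesis unfolding G_def using E_pos[of x] by simp
      qed
      also have "\<dots> \<le> (V m + 1 + 2 * d - V x) * G x"
      proof -
        have "1 \<le> V m + 1 + 2 * d - V x" using max[OF x] d by simp
        from mult_right_mono[OF this G0[of x]] show ?thesis by simp
      qed
      finally show ?thesis .
    qed
    then show "anderson V G x \<le> (V m + 1) * G x"
      by (simp add: d_def algebra_simps)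
  qed
  have "(\<Sum>s\<in>S. E s * F (m - s)) \<le> (\<Sum>s\<in>S. E m)"
  proof (rule sum_mono)
    fix s
    have "F (m - s) \<le> E (m - s) * exp (- \<eta> * real (nrm (m - s)))" by (simp add: F_def E'_def)
    also have "\<dots> \<le> E (m - s) * 1" using \<eta> E_pos by (intro mult_left_mono) (auto intro: less_imp_le)
    finally have "E s * F (m - s) \<le> E s * E (m - s)" using E_pos[of s] by (intro mult_left_mono) auto
    then show "E s * F (m - s) \<le> E m" unfolding ES .
  qed
  then have "2 / b * (\<Sum>s\<in>S. E s * F (m - s)) \<le> 2 / b * (\<Sum>s\<in>S. E m)"
    using b0 by (intro mult_left_mono) auto
  then have G_le: "G m \<le> E m * (1 + 2 * (V m - \<rho>) * real (card S))"
    using b by (simp add: G_def algebra_simps)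
  have "E m \<le> exp (entr m + real n * ln b')"
  proof -
    have "c i * of_int (m $ i) \<ge> real (k i) * ln (real (k i)) - real (k i) * (ln (real n) + ln b')" for i
    proof (cases "k i = 0")
      case True
      then show ?thesis by (simp add: c_def \<theta>_def)
    next
      case False
      then have n0: "0 < n" using kn[of i] by simp
      have "real_of_int (sgn (m $ i)) * real_of_int (m $ i) = real (k i)"
        by (simp add: k_def sgn_if)
      then have "c i * of_int (m $ i) = \<theta> i * real (k i)" by (simp add: c_def mult.assoc)
      moreover have "ln (real (k i)) - (ln (real n) + ln b') \<le> \<theta> i"
        using False n0 b'0 by (simp add: \<theta>_def ln_div ln_mult)
      then have "(ln (real (k i)) - (ln (real n) + ln b')) * real (k i) \<le> \<theta> i * real (k i)"
        by (rule mult_right_mono) simp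
      ultimately show ?thesis by (simp add: algebra_simps)
    qed
    then have "(\<Sum>i\<in>UNIV. c i * of_int (m $ i)) \<ge> (\<Sum>i\<in>UNIV. real (k i) * ln (real (k i)) - real (k i) * (ln (real n) + ln b'))"
      by (intro sum_mono) auto
    also have "(\<Sum>i\<in>UNIV. real (k i) * ln (real (k i)) - real (k i) * (ln (real n) + ln b')) = - (entr m + real n * ln b')"
    proof -
      have "(\<Sum>i\<in>UNIV. real (k i) * (ln (real n) + ln b')) = real n * (ln (real n) + ln b')"
        by (simp add: nk flip: sum_distrib_right)
      then show ?thesis
        unfolding entr_def n_def[symmetric] k_def[symmetric] by (simp add: sum_subtractf algebra_simps)
    qed
    finally show ?thesis by (simp add: E_def)
  qed
  also have "ln b' = 2 * \<eta> - ln (V m - \<rho>)"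
    using b b0 \<rho> by (simp add: b'_def ln_mult ln_div)
  finally have "E m * (1 + 2 * (V m - \<rho>) * real (card S)) \<le> exp (entr m + real n * (2 * \<eta> - ln (V m - \<rho>))) * (1 + 2 * (V m - \<rho>) * real (card S))"
    using \<rho> by (intro mult_right_mono) auto
  then have "exp ((V m + 1) * t) * G m \<le> exp ((V m + 1) * t) * (exp (entr m + real n * (2 * \<eta> - ln (V m - \<rho>))) * (1 + 2 * (V m - \<rho>) * real (card S)))"
    by (intro mult_left_mono order_trans[OF G_le]) auto
  also have "\<dots> = exp ((V m + 1) * t + entr m + real (nrm m) * (2 * \<eta> - ln (V m - \<rho>))) * (1 + 2 * (V m - \<rho>) * real (card S))"
    by (simp add: exp_add n_def)
  finally show ?thesis using bound by (rule order_trans[rotated])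
qed

section \<open>Removing the sites in decreasing order of the potential\<close>

text \<open>Double counting: each site is a neighbour of exactly 2 d others.\<close>

lemma sum_nb_le:
  fixes w :: "int ^ 'd \<Rightarrow> real"
  assumes A: "finite A" "A' \<subseteq> A" and w: "\<And>x. 0 \<le> w x" "\<And>x. x \<notin> A \<Longrightarrow> w x = 0"
  shows "(\<Sum>x\<in>A'. \<Sum>y\<in>nb x. w y) \<le> 2 * real CARD('d) * (\<Sum>x\<in>A. w x)"
proof -
  have "(\<Sum>x\<in>A'. \<Sum>y\<in>nb x. w y) = (\<Sum>x\<in>A'. \<Sum>y\<in>{y\<in>A. y \<in> nb x}. w y)"
    by (intro sum.cong refl sum.mono_neutral_right finite_nearest_nbr) (use w in auto)
  also have "\<dots> = (\<Sum>y\<in>A. \<Sum>x\<in>{x\<in>A'. y \<in> nb x}. w y)"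
    by (rule sum.swap_restrict) (use A finite_subset in auto)
  also have "\<dots> \<le> (\<Sum>y\<in>A. \<Sum>x\<in>nb y. w y)"
    by (intro sum_mono sum_mono2 finite_nearest_nbr) (use w in \<open>auto simp: nearest_nbr_sym\<close>)
  also have "\<dots> = 2 * real CARD('d) * (\<Sum>x\<in>A. w x)" by (simp add: card_nb sum_distrib_left)
  finally show ?thesis .
qed

text \<open>Summed over \<open>A\<close>, the Laplacian can only lose mass through the boundary, so
  the total mass grows at most at the maximal rate of the potential.\<close>

lemma dsol_mass_le:
  fixes V :: "int ^ 'd \<Rightarrow> real"
  assumes A: "finite A" and t: "0 \<le> t" and V: "\<And>x. x \<in> A \<Longrightarrow> V x \<le> h"
  shows "(\<Sum>x\<in>A. dsol V A t x) \<le> exp (h * t)"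
proof -
  define W where "W t = (\<Sum>x\<in>A. dsol V A t x)" for t
  have "exp (h * (t - 0)) * - W 0 \<le> - W t"
  proof (rule gronwall_lower[OF t, where f = "\<lambda>t. - W t" and f' = "\<lambda>t. - (\<Sum>x\<in>A. anderson V (dsol V A t) x)"])
    show "continuous_on {0..t} (\<lambda>t. - W t)"
      unfolding W_def by (intro continuous_intros dsol_continuous A)
    fix s assume s: "0 < s" "s < t"
    show "((\<lambda>t. - W t) has_real_derivative - (\<Sum>x\<in>A. anderson V (dsol V A s) x)) (at s)"
      unfolding W_def by (intro DERIV_minus DERIV_sum dsol_deriv A)
    have nn: "0 \<le> dsol V A s x" for x using dsol_nonneg[OF A, of s] s by simp
    have "(\<Sum>x\<in>A. V x * dsol V A s x) \<le> (\<Sum>x\<in>A. h * dsol V A s x)"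
      by (intro sum_mono mult_right_mono V nn)
    moreover have "(\<Sum>x\<in>A. \<Sum>y\<in>nb x. dsol V A s y) \<le> 2 * real CARD('d) * W s"
      unfolding W_def by (rule sum_nb_le) (use A nn in auto)
    ultimately show "h * - W s \<le> - (\<Sum>x\<in>A. anderson V (dsol V A s) x)"
      by (simp add: W_def sum.distrib sum_subtractf left_diff_distrib sum_distrib_left mult.assoc)
  qed
  then have "W t \<le> exp (h * t) * W 0" by simp
  also have "W 0 \<le> 1"
    unfolding W_def dsol_0 using A card_mono[of "{0}" "A \<inter> {0}"] by (simp add: indicator_def sum.If_cases)
  finally show ?thesis by (simp add: W_def)
qed

text \<open>
  The difference is the contribution of the paths that visit \<open>m\<close>. After the last visit to \<open>m\<close> they grow at rate at
  most \<open>V m - g\<close>, so the mass away from \<open>m\<close> is slaved to the mass at \<open>m\<close>.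
\<close>

lemma dsol_remove_max_site:
  fixes V :: "int ^ 'd \<Rightarrow> real"
  defines "d \<equiv> real CARD('d)"
  assumes A: "finite A" and t: "0 \<le> t" and m: "m \<in> A" and gap: "\<And>x. x \<in> A \<Longrightarrow> x \<noteq> m \<Longrightarrow> V x \<le> V m - g"
    and g: "2 * d < g"
  shows "(\<Sum>x\<in>A - {m}. dsol V A t x - dsol V (A - {m}) t x) \<le> 2 * d / (g - 2 * d) * dsol V A t m"
proof -
  define A' where "A' = A - {m}"
  define C where "C = 2 * d / (g - 2 * d)"
  define w where "w t x = dsol V A t x - dsol V A' t x" for t x
  \<comment> \<open>The claim is \<open>0 <= h t\<close>. The constant satisfies
    \<open>C * (g - 2 * d) = 2 * d\<close>: the surplus of the growth rate of
    \<open>C * dsol V A t m\<close> over \<open>V m - g\<close> equals the rate \<open>2 * d\<close>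
    at which \<open>m\<close> feeds its surroundings.\<close>
  define h where "h t = C * dsol V A t m - (\<Sum>x\<in>A'. w t x)" for t
  define X where "X = V m"
  have A': "finite A'" "A' \<subseteq> A" using A by (auto simp: A'_def)
  have C0: "0 \<le> C" "C * (g - 2 * d) = 2 * d" using g by (auto simp: C_def d_def)
  define Dw where "Dw s = (\<Sum>x\<in>A'. (\<Sum>y\<in>nb x. w s y) + (V x - 2 * d) * w s x)" for s
  define Df where "Df s = (\<Sum>y\<in>nb m. dsol V A s y) + (X - 2 * d) * dsol V A s m" for s
  have "exp ((X - g) * (t - 0)) * h 0 \<le> h t"
  proof (rule gronwall_lower[OF t, where f' = "\<lambda>s. C * Df s - Dw s"])
    show "continuous_on {0..t} h"
      unfolding h_def w_def by (intro continuous_intros dsol_continuous A A')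
    fix s assume s: "0 < s" "s < t"
    have w0: "0 \<le> w s x" for x unfolding w_def using dsol_mono[OF A A'(2), of s] s by simp
    have f0: "0 \<le> dsol V A s x" for x using dsol_nonneg[OF A, of s] s by simp
    have 1: "((\<lambda>t. dsol V A t m) has_real_derivative Df s) (at s)"
      unfolding Df_def X_def d_def by (rule dsol_deriv[OF A m])
    have "((\<lambda>t. w t x) has_real_derivative (\<Sum>y\<in>nb x. w s y) + (V x - 2 * d) * w s x) (at s)" if "x \<in> A'" for x
    proof -
      have "x \<in> A" using that A' by auto
      from DERIV_diff[OF dsol_deriv[OF A this] dsol_deriv[OF A'(1) that]]
      show ?thesis unfolding w_def d_def by (rule DERIV_cong) (simp add: sum_subtractf algebra_simps)
    qed
    then have 2: "((\<lambda>t. \<Sum>x\<in>A'. w t x) has_real_derivative Dw s) (at s)"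
      unfolding Dw_def by (intro DERIV_sum)
    show "(h has_real_derivative C * Df s - Dw s) (at s)"
      unfolding h_def by (rule derivative_eq_intros 1 2 refl | simp)+
    have wm: "w s m = dsol V A s m" by (simp add: w_def A'_def)
    have "(\<Sum>x\<in>A'. \<Sum>y\<in>nb x. w s y) \<le> 2 * d * (\<Sum>x\<in>A. w s x)"
      unfolding d_def by (rule sum_nb_le) (use A A' w0 in \<open>auto simp: w_def A'_def\<close>)
    also have "(\<Sum>x\<in>A. w s x) = dsol V A s m + (\<Sum>x\<in>A'. w s x)"
      unfolding A'_def using sum.remove[OF A m] wm by metis
    finally have a: "(\<Sum>x\<in>A'. \<Sum>y\<in>nb x. w s y) \<le> 2 * d * (dsol V A s m + (\<Sum>x\<in>A'. w s x))" .
    have "(\<Sum>x\<in>A'. (V x - 2 * d) * w s x) \<le> (\<Sum>x\<in>A'. (X - g - 2 * d) * w s x)"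
      using gap by (intro sum_mono mult_right_mono w0) (auto simp: A'_def X_def)
    also have "\<dots> = (X - g - 2 * d) * (\<Sum>x\<in>A'. w s x)" by (simp add: sum_distrib_left)
    finally have b: "(\<Sum>x\<in>A'. (V x - 2 * d) * w s x) \<le> (X - g - 2 * d) * (\<Sum>x\<in>A'. w s x)" .
    have "0 \<le> (\<Sum>y\<in>nb m. dsol V A s y)" by (intro sum_nonneg f0)
    then have "(X - 2 * d) * dsol V A s m \<le> Df s" by (simp add: Df_def)
    then have c: "C * ((X - 2 * d) * dsol V A s m) \<le> C * Df s" using C0 by (intro mult_left_mono) auto
    have "Dw s = (\<Sum>x\<in>A'. \<Sum>y\<in>nb x. w s y) + (\<Sum>x\<in>A'. (V x - 2 * d) * w s x)"
      unfolding Dw_def by (rule sum.distrib)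
    also have "\<dots> \<le> 2 * d * (dsol V A s m + (\<Sum>x\<in>A'. w s x)) + (X - g - 2 * d) * (\<Sum>x\<in>A'. w s x)"
      by (rule add_mono[OF a b])
    finally have "Dw s \<le> 2 * d * dsol V A s m + (X - g) * (\<Sum>x\<in>A'. w s x)" by (simp add: algebra_simps)
    moreover have "C * ((X - 2 * d) * dsol V A s m) - (X - g) * (C * dsol V A s m) = (C * (g - 2 * d)) * dsol V A s m"
      by (simp add: algebra_simps)
    ultimately show "(X - g) * h s \<le> C * Df s - Dw s"
      using c unfolding h_def C0(2) by (simp add: right_diff_distrib)
  qed
  moreover have "0 \<le> h 0"
    unfolding h_def w_def using C0 A' by (auto simp: dsol_0 A'_def indicator_def intro!: sum_nonpos)
  then have "0 \<le> exp ((X - g) * (t - 0)) * h 0" by simp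
  ultimately have "0 \<le> h t" by linarith
  then show ?thesis by (simp add: h_def w_def A'_def C_def)
qed

text \<open>Induction by removing the highest site \<open>m\<close> of the current set. The solution
  splits into the part that visits \<open>m\<close>, bounded by \<open>F m\<close> at
  \<open>m\<close> and by a small multiple of \<open>F m\<close> elsewhere, and the Dirichlet
  solution on the rest. Once no site reaches \<open>h\<close>, the remaining mass is at most
  \<open>exp (h * t)\<close>. Hence \<open>F\<close> has to be valid on every subset in which
  \<open>m\<close> is highest, while \<open>P\<close> exempts sites whose own mass is not to be
  counted.\<close>

lemma dsol_mass_decomposition:
  fixes V F :: "int ^ 'd \<Rightarrow> real"
  defines "d \<equiv> real CARD('d)"
  assumes A: "finite A" and t: "0 \<le> t" and g: "2 * d < g"
    and gap: "\<And>x y. x \<in> A \<Longrightarrow> y \<in> A \<Longrightarrow> x \<noteq> y \<Longrightarrow> h \<le> V x \<Longrightarrow> V y \<le> V x \<Longrightarrow> V y \<le> V x - g"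
    and F: "\<And>B m. B \<subseteq> A \<Longrightarrow> m \<in> B \<Longrightarrow> h \<le> V m \<Longrightarrow> (\<And>x. x \<in> B \<Longrightarrow> V x \<le> V m) \<Longrightarrow> dsol V B t m \<le> F m"
  shows "(\<Sum>x\<in>A - P. dsol V A t x) \<le>
    (\<Sum>m\<in>{m\<in>A. h \<le> V m}. (2 * d / (g - 2 * d) + (if m \<in> P then 0 else 1)) * F m) + exp (h * t)"
  using A gap F
proof (induction A rule: finite_psubset_induct)
  case (psubset A)
  define C where "C = 2 * d / (g - 2 * d)"
  have C0: "0 \<le> C" using g by (simp add: C_def d_def)
  have nn: "0 \<le> dsol V A t x" for x by (rule dsol_nonneg[OF psubset.hyps t])
  show ?case
  proof (cases "{m\<in>A. h \<le> V m} = {}")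
    case True
    then have "(\<Sum>x\<in>A. dsol V A t x) \<le> exp (h * t)"
      by (intro dsol_mass_le psubset.hyps t) force
    moreover have "(\<Sum>x\<in>A - P. dsol V A t x) \<le> (\<Sum>x\<in>A. dsol V A t x)"
      by (intro sum_mono2 psubset.hyps nn) auto
    ultimately show ?thesis unfolding True by simp
  next
    case False
    have "A \<noteq> {}" using False by auto
    then have "Max (V ` A) \<in> V ` A" using psubset.hyps by (intro Max_in) auto
    then obtain m where m: "m \<in> A" and Vm: "Max (V ` A) = V m" by (rule imageE)
    have m_max: "V x \<le> V m" if "x \<in> A" for x
      unfolding Vm[symmetric] using psubset.hyps that by (intro Max_ge) auto
    note m = m m_max
    have hm: "h \<le> V m" using False m by force
    define A' where "A' = A - {m}"
    have A': "A' \<subset> A" using m by (auto simp: A'_def)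
    have IH: "(\<Sum>x\<in>A' - P. dsol V A' t x) \<le> (\<Sum>m\<in>{m\<in>A'. h \<le> V m}. (C + (if m \<in> P then 0 else 1)) * F m) + exp (h * t)"
      unfolding C_def using A' by (intro psubset.IH A' psubset.prems) auto
    have Fm: "dsol V A t m \<le> F m" by (intro psubset.prems(2)) (use m hm in auto)
    have "(\<Sum>x\<in>A'. dsol V A t x - dsol V A' t x) \<le> C * dsol V A t m"
      unfolding A'_def C_def d_def
      by (rule dsol_remove_max_site[OF psubset.hyps t m(1)])
         (use psubset.prems(1)[OF m(1)] m hm g d_def in auto)
    also have "\<dots> \<le> C * F m" by (intro mult_left_mono Fm C0)
    finally have 1: "(\<Sum>x\<in>A'. dsol V A t x - dsol V A' t x) \<le> C * F m" .
    have "(\<Sum>x\<in>A' - P. dsol V A t x - dsol V A' t x) \<le> (\<Sum>x\<in>A'. dsol V A t x - dsol V A' t x)"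
    proof (intro sum_mono2)
      show "finite A'" using psubset.hyps by (simp add: A'_def)
    qed (use dsol_mono[OF psubset.hyps _ t, of A'] A' in auto)
    with 1 have 2: "(\<Sum>x\<in>A' - P. dsol V A t x) \<le> C * F m + (\<Sum>x\<in>A' - P. dsol V A' t x)"
      by (simp add: sum_subtractf)
    have "(\<Sum>x\<in>A - P. dsol V A t x) = (if m \<in> P then 0 else dsol V A t m) + (\<Sum>x\<in>A' - P. dsol V A t x)"
    proof (cases "m \<in> P")
      case True
      then have "A - P = A' - P" by (auto simp: A'_def)
      then show ?thesis using True by simp
    next
      case False
      have "A' - P = A - P - {m}" by (auto simp: A'_def)
      then show ?thesis using False sum.remove[of "A - P" m "dsol V A t"] m psubset.hyps by simp
    qed
    also have "\<dots> \<le> (C + (if m \<in> P then 0 else 1)) * F m + (\<Sum>x\<in>A' - P. dsol V A' t x)"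
      using 2 Fm by (auto simp: algebra_simps)
    also have "\<dots> \<le> (C + (if m \<in> P then 0 else 1)) * F m + (\<Sum>m\<in>{m\<in>A'. h \<le> V m}. (C + (if m \<in> P then 0 else 1)) * F m) + exp (h * t)"
      using IH by simp
    also have "(C + (if m \<in> P then 0 else 1)) * F m + (\<Sum>m\<in>{m\<in>A'. h \<le> V m}. (C + (if m \<in> P then 0 else 1)) * F m)
       = (\<Sum>m\<in>{m\<in>A. h \<le> V m}. (C + (if m \<in> P then 0 else 1)) * F m)"
    proof -
      have "{m\<in>A'. h \<le> V m} = {m\<in>A. h \<le> V m} - {m}" by (auto simp: A'_def)
      then show ?thesis
        using sum.remove[of "{m\<in>A. h \<le> V m}" m "\<lambda>m. (C + (if m \<in> P then 0 else 1)) * F m"] m hm psubset.hyps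
        by (simp del: if_split_asm split del: if_split)
    qed
    finally show ?thesis by (simp add: C_def)
  qed
qed

section \<open>Comparison of the total mass with two sites\<close>

text \<open>With slope \<open>c = ln (N / b)\<close> the barrier decays like
  \<open>(b / N) ^ N\<close>, which cancels the factorial of the a priori bound, and the slope costs
  exactly \<open>exp N\<close> because \<open>2 * d * T * exp c = N\<close>. The potential
  contributes only \<open>exp (C * (1 + n) powr \<gamma> * T)\<close>, of lower order as \<gamma> <
  1.\<close>

lemma solution_le_dsol_eventually:
  fixes V :: "int ^ 'd \<Rightarrow> real"
  assumes u: "nonneg_pam_solution V u" and V: "\<And>x. 0 \<le> V x"
    and growth: "\<And>x. V x \<le> C * (1 + real (nrm x)) powr \<gamma>" and \<gamma>: "0 \<le> \<gamma>" "\<gamma> < 1" and C: "0 \<le> C"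
    and t: "0 \<le> t" and \<epsilon>: "0 < \<epsilon>"
  shows "\<forall>\<^sub>F n in sequentially. u t x \<le> dsol V (lball n) t x + \<epsilon>"
proof -
  define d where "d = real CARD('d)"
  define T where "T = max t 1"
  define b where "b = 2 * d * T"
  \<comment> \<open>The a priori bound is available for every \<open>L\<close>; the factor
    \<open>exp 3\<close> turns into \<open>exp (- 3 * N)\<close>, so that
    \<open>exp (- 2 * N)\<close> remains after the cost \<open>exp N\<close> of the slope.\<close>
  define L where "L = b * exp 3"
  have d: "1 \<le> d" by (simp add: d_def Suc_le_eq)
  have T: "0 < T" "t \<le> T" by (auto simp: T_def)
  have b: "0 < b" using d T by (simp add: b_def)
  have L: "0 < L" using b by (simp add: L_def)
  obtain C0 where C0: "0 \<le> C0" "\<And>s z. 0 \<le> s \<Longrightarrow> s \<le> t \<Longrightarrow> u s z \<le> C0 * (fact (nrm z) / L ^ nrm z)"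
    using solution_apriori_bound[OF u V t L] by blast
  have "((\<lambda>n. C0 * exp (- 2 * real (Suc n) + C * (1 + real n) powr \<gamma> * T + real (nrm x) * ln (real (Suc n) / b))) \<longlongrightarrow> 0) sequentially"
    using \<gamma> b by real_asymp
  then have "\<forall>\<^sub>F n in sequentially. C0 * exp (- 2 * real (Suc n) + C * (1 + real n) powr \<gamma> * T + real (nrm x) * ln (real (Suc n) / b)) < \<epsilon>"
    using \<epsilon> by (rule order_tendstoD)
  moreover have "\<forall>\<^sub>F n in sequentially. b \<le> real n" by real_asymp
  moreover have "\<forall>\<^sub>F n in sequentially. nrm x \<le> n" by (rule eventually_ge_at_top)
  ultimately show ?thesis
  proof eventually_elim
    case (elim n)
    define N where "N = real (Suc n)"
    define M where "M = C * (1 + real n) powr \<gamma>"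
    define c where "c = ln (N / b)"
    have N: "b \<le> N" "0 < N" using elim by (auto simp: N_def)
    have c: "0 \<le> c" using N b by (simp add: c_def)
    have M0: "0 \<le> M" using C by (simp add: M_def)
    have "u t x \<le> dsol V (lball n) t x + (C0 * (fact (Suc n) / L ^ Suc n)) *
        exp ((M + 2 * real CARD('d) * exp c) * t - c * (real (Suc n) - real (nrm x)))"
    proof (rule solution_le_dsol_lball[OF u t _ M0 _ c _ elim(3)])
      fix y :: "int ^ 'd" assume y: "nrm y \<le> n"
      show "V y \<le> M" unfolding M_def
        by (rule order_trans[OF growth]) (use C y \<gamma> in \<open>intro mult_left_mono powr_mono2, auto\<close>)
    next
      fix s and y :: "int ^ 'd" assume "0 \<le> s" "s \<le> t" "nrm y = Suc n"
      then show "u s y \<le> C0 * (fact (Suc n) / L ^ Suc n)" using C0(2)[of s y] by (simp del: fact_Suc power_Suc)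
    qed (use C0 L in auto)
    also have "(C0 * (fact (Suc n) / L ^ Suc n)) * exp ((M + 2 * real CARD('d) * exp c) * t - c * (real (Suc n) - real (nrm x)))
      \<le> (C0 * exp (N * ln N - N * ln L)) * exp (M * T + N - c * (N - real (nrm x)))"
    proof (intro mult_mono mult_left_mono)
      have "fact (Suc n) \<le> N ^ Suc n" unfolding N_def using fact_le_power[of "Suc n", where 'a = real]
        by (simp del: fact_Suc power_Suc of_nat_Suc)
      then have "fact (Suc n) / L ^ Suc n \<le> N ^ Suc n / L ^ Suc n" using L by (intro divide_right_mono) auto
      also have "N ^ Suc n / L ^ Suc n = exp (N * ln N - N * ln L)"
        unfolding N_def using L by (simp add: exp_diff exp_of_nat_mult del: power_Suc of_nat_Suc)
      finally show "fact (Suc n) / L ^ Suc n \<le> exp (N * ln N - N * ln L)" .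
      have "(M + 2 * d * exp c) * t \<le> (M + 2 * d * exp c) * T"
        using T M0 d by (intro mult_left_mono) auto
      also have "2 * d * exp c * T = N" using N b d T by (simp add: c_def b_def)
      then have "(M + 2 * d * exp c) * T = M * T + N" by (simp add: distrib_right)
      finally show "exp ((M + 2 * real CARD('d) * exp c) * t - c * (real (Suc n) - real (nrm x))) \<le> exp (M * T + N - c * (N - real (nrm x)))"
        by (simp add: N_def d_def)
    qed (use C0 L in auto)
    also have "\<dots> = C0 * exp ((N * ln N - N * ln L) + (M * T + N - c * (N - real (nrm x))))"
      by (simp only: exp_add mult.assoc)
    also have "(N * ln N - N * ln L) + (M * T + N - c * (N - real (nrm x))) = - 2 * N + M * T + real (nrm x) * c"
      using b N by (simp add: L_def c_def ln_mult ln_div algebra_simps)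
    finally have "u t x \<le> dsol V (lball n) t x + C0 * exp (- 2 * N + M * T + real (nrm x) * c)" by simp
    with elim(1) show ?case by (simp add: N_def M_def c_def)
  qed
qed

text \<open>The subtracted last term makes the induction close, through
  \<open>2 * exp (- 1) <= 1\<close>.\<close>

lemma sum_exp_atLeastAtMost_le:
  assumes "k \<le> n" shows "(\<Sum>j=k..n. exp (- real j)) \<le> 2 * exp (- real k) - exp (- real n)"
  using assms
proof (induction n rule: dec_induct)
  case (step n)
  have "exp (- 1) \<le> (1 / 2 :: real)" using exp_ge_add_one_self[of 1] by (simp add: exp_minus field_simps)
  then have "exp (- real n) * exp (- 1) \<le> exp (- real n) * (1 / 2 :: real)" by (rule mult_left_mono) simp
  then have "2 * exp (- real (Suc n)) \<le> exp (- real n)" by (simp add: algebra_simps flip: exp_add)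
  with step show ?case by simp
qed simp

text \<open>Telescoping over the radii beyond \<open>R\<close>, followed by the limit in the radius.
  Balls that do not contain \<open>x\<close> contribute nothing, since their Dirichlet solution
  vanishes at \<open>x\<close>; this gives the maximum with \<open>nrm x\<close> and makes the error
  summable over the lattice.\<close>

lemma solution_tail_bound:
  fixes V :: "int ^ 'd \<Rightarrow> real"
  assumes u: "nonneg_pam_solution V u" and V: "\<And>x. 0 \<le> V x"
    and growth: "\<And>x. V x \<le> C * (1 + real (nrm x)) powr \<gamma>" and \<gamma>: "0 \<le> \<gamma>" "\<gamma> < 1" and C: "0 \<le> C"
    and t: "0 \<le> t"
    and R: "\<And>n. R < n \<Longrightarrow> (C * (1 + real n) powr \<gamma> + 2 * real CARD('d) * exp 2) * t \<le> real n"
  shows "u t x \<le> dsol V (lball R) t x + 2 * exp (- real (max (Suc R) (nrm x)))"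
proof -
  define k where "k = max (Suc R) (nrm x)"
  have *: "dsol V (lball n) t x \<le> dsol V (lball R) t x + (\<Sum>j=k..n. exp (- real j))" if "R \<le> n" for n
    using that
  proof (induction n rule: dec_induct)
    case base
    then show ?case by (simp add: k_def)
  next
    case (step n)
    show ?case
    proof (cases "nrm x \<le> Suc n")
      case True
      then have k: "k \<le> Suc n" using step by (simp add: k_def)
      define M where "M = C * (1 + real (Suc n)) powr \<gamma>"
      have "dsol V (lball (Suc n)) t x \<le> dsol V (lball n) t x + exp ((M + 2 * real CARD('d) * exp 2) * t - 2 * real (Suc n))"
      proof (rule dsol_lball_step[OF t _ _ True])
        fix y :: "int ^ 'd" assume y: "nrm y \<le> Suc n"
        show "V y \<le> M" unfolding M_def
          by (rule order_trans[OF growth]) (use C y \<gamma> in \<open>intro mult_left_mono powr_mono2, auto\<close>)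
      qed (use C in \<open>auto simp: M_def\<close>)
      also have "exp ((M + 2 * real CARD('d) * exp 2) * t - 2 * real (Suc n)) \<le> exp (- real (Suc n))"
        using R[of "Suc n"] step(1) by (simp add: M_def)
      finally show ?thesis using step.IH k by simp
    next
      case False
      then have "dsol V (lball (Suc n)) t x = 0" by (simp add: lball_def)
      then show ?thesis using dsol_nonneg[OF finite_lball t, of V R x] by (simp add: sum_nonneg)
    qed
  qed
  show ?thesis
  proof (rule field_le_epsilon)
    fix e :: real assume "0 < e"
    from solution_le_dsol_eventually[OF u V growth \<gamma> C t this, of x] eventually_ge_at_top[of k]
    have "\<forall>\<^sub>F n in sequentially. u t x \<le> dsol V (lball R) t x + 2 * exp (- real (max (Suc R) (nrm x))) + e"
    proof eventually_elim
      case (elim n)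
      have "R \<le> n" using elim(2) by (simp add: k_def)
      have "0 < exp (- real n)" by simp
      with *[OF \<open>R \<le> n\<close>] sum_exp_atLeastAtMost_le[OF elim(2)] elim(1) show ?case
        unfolding k_def[symmetric] by linarith
    qed
    then show "u t x \<le> dsol V (lball R) t x + 2 * exp (- real (max (Suc R) (nrm x))) + e"
      by (simp add: eventually_const_iff)
  qed
qed

text \<open>Over a cube the sum is a product of one-dimensional geometric sums, bounded uniformly in
  the side length.\<close>

lemma sum_exp_nrm_bounded:
  obtains K where "0 \<le> K" "\<And>F :: (int ^ 'd) set. finite F \<Longrightarrow> (\<Sum>x\<in>F. exp (- real (nrm x) / 2)) \<le> K"
proof -
  define a :: real where "a = exp (- 1 / 2)"
  have a: "0 < a" "a < 1" by (auto simp: a_def)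
  have one: "(\<Sum>k\<in>{- int n..int n}. a ^ nat \<bar>k\<bar>) \<le> 2 / (1 - a)" for n
  proof -
    have "(\<Sum>k\<in>{- int n..int n}. a ^ nat \<bar>k\<bar>) \<le> 2 * (\<Sum>j<Suc n. a ^ j)"
    proof (induction n)
      case (Suc n)
      have "{- int (Suc n)..int (Suc n)} = insert (int (Suc n)) (insert (- int (Suc n)) {- int n..int n})"
        by auto
      then have "(\<Sum>k\<in>{- int (Suc n)..int (Suc n)}. a ^ nat \<bar>k\<bar>) = 2 * a ^ Suc n + (\<Sum>k\<in>{- int n..int n}. a ^ nat \<bar>k\<bar>)"
        by (simp add: nat_add_distrib)
      with Suc show ?case by simp
    qed simp
    also have "(\<Sum>j<Suc n. a ^ j) \<le> 1 / (1 - a)"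
      using a by (simp add: sum_gp_strict divide_right_mono del: sum.lessThan_Suc power_Suc)
    finally show ?thesis by simp
  qed
  have cube: "(\<Sum>x\<in>cube n. exp (- real (nrm (x :: int ^ 'd)) / 2)) \<le> (2 / (1 - a)) ^ CARD('d)" for n
  proof -
    have "exp (- real (nrm x) / 2) = (\<Prod>i\<in>UNIV. a ^ nat \<bar>x $ i\<bar>)" for x :: "int ^ 'd"
      unfolding a_def by (simp add: nrm_def exp_of_nat_mult[symmetric] sum_negf sum_divide_distrib flip: exp_sum)
    then have "(\<Sum>x\<in>cube n. exp (- real (nrm (x :: int ^ 'd)) / 2)) = (\<Sum>x\<in>cube n. \<Prod>i\<in>UNIV. a ^ nat \<bar>(x :: int ^ 'd) $ i\<bar>)"
      by simp
    also have "\<dots> = (\<Sum>g\<in>PiE (UNIV :: 'd set) (\<lambda>_. {- int n..int n}). \<Prod>i\<in>UNIV. a ^ nat \<bar>g i\<bar>)"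
      unfolding cube_eq by (subst sum.reindex) (auto simp: inj_on_def vec_lambda_inject)
    also have "\<dots> = (\<Prod>i\<in>(UNIV :: 'd set). \<Sum>k\<in>{- int n..int n}. a ^ nat \<bar>k\<bar>)"
      by (rule prod_sum_PiE[symmetric]) auto
    also have "\<dots> \<le> (2 / (1 - a)) ^ CARD('d)"
      using a one[of n] by (auto intro!: power_mono sum_nonneg)
    finally show ?thesis .
  qed
  have "(\<Sum>x\<in>F. exp (- real (nrm x) / 2)) \<le> (2 / (1 - a)) ^ CARD('d)" if F: "finite F" for F :: "(int ^ 'd) set"
  proof -
    define n where "n = Max (insert 0 (nrm ` F))"
    have "nrm x \<le> n" if "x \<in> F" for x unfolding n_def using F that by (intro Max_ge) auto
    then have "F \<subseteq> lball n" by (auto simp: lball_def)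
    then have Fc: "F \<subseteq> cube n" using lball_subset_cube by blast
    have "(\<Sum>x\<in>F. exp (- real (nrm x) / 2)) \<le> (\<Sum>x\<in>cube n. exp (- real (nrm (x :: int ^ 'd)) / 2))"
      by (intro sum_mono2 finite_cube Fc) auto
    with cube[of n] show ?thesis by linarith
  qed
  moreover have "0 \<le> (2 / (1 - a)) ^ CARD('d)" using a by simp
  ultimately show thesis using that by blast
qed

lemma total_mass_bounds:
  fixes V :: "int ^ 'd \<Rightarrow> real"
  assumes u: "nonneg_pam_solution V u" and t: "0 \<le> t" and P: "finite P"
    and tail: "\<And>x. u t x \<le> dsol V (lball R) t x + 2 * exp (- real (max (Suc R) (nrm x)))"
    and K: "\<And>F :: (int ^ 'd) set. finite F \<Longrightarrow> (\<Sum>x\<in>F. exp (- real (nrm x) / 2)) \<le> K"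
  shows "(\<Sum>x\<in>P. u t x) \<le> total_mass u t"
    and "total_mass u t \<le> (\<Sum>x\<in>P. u t x) + (\<Sum>x\<in>lball R - P. dsol V (lball R) t x) + 2 * K"
proof -
  note D = nonneg_pam_solutionD[OF u]
  have dn: "0 \<le> dsol V (lball R) t x" for x by (rule dsol_nonneg[OF finite_lball t])
  let ?B = "(\<Sum>x\<in>P. u t x) + (\<Sum>x\<in>lball R - P. dsol V (lball R) t x) + 2 * K"
  have B: "(\<Sum>x\<in>F. u t x) \<le> ?B" if F: "finite F" for F
  proof -
    have "(\<Sum>x\<in>F. u t x) = (\<Sum>x\<in>F \<inter> P. u t x) + (\<Sum>x\<in>F - P. u t x)"
      using F by (simp add: sum.Int_Diff)
    also have "(\<Sum>x\<in>F \<inter> P. u t x) \<le> (\<Sum>x\<in>P. u t x)"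
      by (intro sum_mono2) (use P D(1) t in auto)
    also have "(\<Sum>x\<in>F - P. u t x) \<le> (\<Sum>x\<in>F - P. dsol V (lball R) t x + 2 * exp (- real (nrm x) / 2))"
    proof (rule sum_mono)
      fix x :: "int ^ 'd"
      have "real (nrm x) \<le> real (max (Suc R) (nrm x))" by (intro of_nat_mono) simp
      then have "- real (max (Suc R) (nrm x)) \<le> - real (nrm x) / 2" by linarith
      then have "exp (- real (max (Suc R) (nrm x))) \<le> exp (- real (nrm x) / 2)" by (rule iffD2[OF exp_le_cancel_iff])
      with tail[of x] show "u t x \<le> dsol V (lball R) t x + 2 * exp (- real (nrm x) / 2)" by linarith
    qed
    also have "\<dots> = (\<Sum>x\<in>F - P. dsol V (lball R) t x) + 2 * (\<Sum>x\<in>F - P. exp (- real (nrm x) / 2))"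
      by (simp add: sum.distrib sum_distrib_left)
    also have "(\<Sum>x\<in>F - P. exp (- real (nrm x) / 2)) \<le> K" by (rule K) (use F in auto)
    also have "(\<Sum>x\<in>F - P. dsol V (lball R) t x) = (\<Sum>x\<in>(F - P) \<inter> lball R. dsol V (lball R) t x)"
    proof (rule sum.mono_neutral_right)
      show "\<forall>x\<in>(F - P) - (F - P) \<inter> lball R. dsol V (lball R) t x = 0"
        by (intro ballI dsol_outside) auto
    qed (use F in auto)
    also have "\<dots> \<le> (\<Sum>x\<in>lball R - P. dsol V (lball R) t x)"
      by (intro sum_mono2 finite_Diff finite_lball dn) auto
    finally show ?thesis by simp
  qed
  \<comment> \<open>\<open>total_mass\<close> is an \<open>infsum\<close>, which takes the value 0
    when the family is not summable; summability therefore has to come from the uniform bound on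
    finite partial sums before anything can be said about it.\<close>
  have summ: "(\<lambda>x. u t x) summable_on UNIV"
    by (rule nonneg_bounded_partial_sums_imp_summable_on[where C = ?B])
       (use D(1) t B in \<open>auto simp: eventually_finite_subsets_at_top intro!: exI[of _ "{}"]\<close>)
  show "(\<Sum>x\<in>P. u t x) \<le> total_mass u t"
    unfolding total_mass_def by (rule finite_sum_le_infsum[OF summ P]) (use D(1) t in auto)
  show "total_mass u t \<le> ?B"
    unfolding total_mass_def by (rule infsum_le_finite_sums[OF summ]) (use B in auto)
qed

text \<open>For nonzero \<open>m\<close>, \<open>entr m / nrm m\<close> is the Shannon entropy of
  the weights \<open>k i / n\<close> on the d coordinates, so it lies between 0 and
  \<open>ln d\<close>.\<close>

lemma entr_bounds:
  fixes m :: "int ^ 'd"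
  shows "0 \<le> entr m" "entr m \<le> real (nrm m) * ln (real CARD('d))"
proof -
  define k where "k i = nat \<bar>m $ i\<bar>" for i
  define n where "n = nrm m"
  define d where "d = real CARD('d)"
  have d: "1 \<le> d" by (simp add: d_def Suc_le_eq)
  have nk: "n = (\<Sum>i\<in>UNIV. k i)" by (simp add: n_def nrm_def k_def)
  have kn: "k i \<le> n" for i unfolding nk by (rule member_le_sum) auto
  have "(\<Sum>i\<in>UNIV. real (k i) * ln (real (k i))) \<le> (\<Sum>i\<in>UNIV. real (k i) * ln (real n))"
  proof (rule sum_mono)
    fix i show "real (k i) * ln (real (k i)) \<le> real (k i) * ln (real n)"
      using kn[of i] by (cases "k i = 0") (auto intro!: mult_left_mono)
  qed
  then show "0 \<le> entr m" unfolding entr_def n_def[symmetric] k_def[symmetric]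
    by (simp add: nk flip: sum_distrib_right)
  have "(\<Sum>i\<in>UNIV. real (k i) * (ln (real n) - ln d) - real (k i) * ln (real (k i))) \<le> (\<Sum>i\<in>(UNIV :: 'd set). real n / d - real (k i))"
  proof (rule sum_mono)
    fix i show "real (k i) * (ln (real n) - ln d) - real (k i) * ln (real (k i)) \<le> real n / d - real (k i)"
    proof (cases "k i = 0")
      case False
      then have n: "0 < n" using kn[of i] by simp
      have "ln (real n / (d * real (k i))) \<le> real n / (d * real (k i)) - 1"
        using False n d by (intro ln_le_minus_one) auto
      then have "real (k i) * ln (real n / (d * real (k i))) \<le> real (k i) * (real n / (d * real (k i)) - 1)"
        by (intro mult_left_mono) auto
      then show ?thesis using False n d by (simp add: ln_div ln_mult algebra_simps)
    qed (use d in auto)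
  qed
  also have "\<dots> = 0" using d by (simp add: sum_subtractf d_def nk)
  finally have "real n * (ln (real n) - ln d) \<le> (\<Sum>i\<in>UNIV. real (k i) * ln (real (k i)))"
    by (simp add: sum_subtractf nk flip: sum_distrib_right)
  then show "entr m \<le> real (nrm m) * ln (real CARD('d))"
    unfolding entr_def n_def[symmetric] k_def[symmetric] d_def[symmetric] by (simp add: algebra_simps)
qed

text \<open>Bounds the loss from \<open>ln (V m - \<rho>)\<close> in place of
  \<open>ln (V m)\<close>.\<close>

lemma ln_diff_ge_ratio:
  fixes x \<rho> :: real
  assumes "0 \<le> \<rho>" "2 * \<rho> \<le> x" "0 < x"
  shows "ln x - 2 * \<rho> / x \<le> ln (x - \<rho>)"
proof (cases "\<rho> = 0")
  case False
  have p: "0 < x - \<rho>" using assms False by auto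
  have "ln (x / (x - \<rho>)) \<le> x / (x - \<rho>) - 1" using p assms by (intro ln_le_minus_one) auto
  also have "\<dots> = \<rho> / (x - \<rho>)" using p by (simp add: field_simps)
  also have "\<dots> \<le> \<rho> / (x / 2)" using assms p by (intro divide_left_mono) auto
  finally show ?thesis using p assms by (simp add: ln_div)
qed simp

text \<open>The deterministic half of the argument at one time. Removing the sites of the ball with
  \<open>P = {Z1, Z2}\<close> leaves four errors relative to the mass at these two: what is slaved
  to them (\<open>c\<close>), the other high sites, the sites below \<open>h\<close>, and everything
  due to the outside of the ball (\<open>K0\<close>). Here \<open>e1\<close> is the loss in the
  upper bound and \<open>e2\<close> the loss in the lower bound for \<open>ln u\<close>, so
  \<open>D\<close> has to beat \<open>e1 + e2\<close>.\<close>

lemma two_site_ratio_bounds: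
  fixes V :: "int ^ 'd \<Rightarrow> real" and Z1 Z2 :: "int ^ 'd" and R :: nat and t g h \<eta> \<rho> :: real
  defines "d \<equiv> real CARD('d)"
  defines "N \<equiv> real (card (lball R :: (int ^ 'd) set))"
  assumes u: "nonneg_pam_solution V u" and V: "\<And>x. 0 \<le> V x" and t: "0 < t"
    and growth: "\<And>x. V x \<le> C0 * (1 + real (nrm x)) powr \<gamma>" and \<gamma>: "0 \<le> \<gamma>" "\<gamma> < 1" and C0: "0 \<le> C0"
    and R: "\<And>n. R < n \<Longrightarrow> (C0 * (1 + real n) powr \<gamma> + 2 * real CARD('d) * exp 2) * t \<le> real n"
    and K0: "\<And>F :: (int ^ 'd) set. finite F \<Longrightarrow> (\<Sum>x\<in>F. exp (- real (nrm x) / 2)) \<le> K0"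
    and X: "\<And>x. nrm x \<le> R \<Longrightarrow> V x \<le> X"
    and h: "exp 2 * d \<le> h" "2 * \<rho> \<le> h" "0 \<le> \<rho>"
    and \<eta>: "0 < \<eta>" "\<eta> \<le> 1" "40 * d \<le> h * \<eta>" "32 * d\<^sup>2 \<le> h"
    and K: "4 * X * N * exp (- \<eta> * K) \<le> 1"
    and sep: "\<And>x y. nrm x \<le> R \<Longrightarrow> nrm y \<le> R \<Longrightarrow> x \<noteq> y \<Longrightarrow> \<rho> < V x \<Longrightarrow> \<rho> < V y \<Longrightarrow> K \<le> real (nrm (x - y))"
    and g: "2 * d < g"
    and gap: "\<And>x y. nrm x \<le> R \<Longrightarrow> nrm y \<le> R \<Longrightarrow> x \<noteq> y \<Longrightarrow> h \<le> V x \<Longrightarrow> V y \<le> V x \<Longrightarrow> V y \<le> V x - g"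
    and Z: "Z1 \<noteq> Z2" and Z1: "nrm Z1 \<le> R" "h \<le> V Z1" "2 * real (nrm Z1) \<le> t * V Z1"
    and D: "D \<le> Phi t (V Z1) Z1"
    and others: "\<And>m. nrm m \<le> R \<Longrightarrow> h \<le> V m \<Longrightarrow> 2 * real (nrm m) \<le> t * V m \<Longrightarrow> m \<noteq> Z1 \<Longrightarrow> m \<noteq> Z2 \<Longrightarrow>
                   Phi t (V m) m \<le> Phi t (V Z1) Z1 - D"
    and P0: "P0 \<le> Phi t (V Z1) Z1"
  defines "c \<equiv> 2 * d / (g - 2 * d)"
  defines "e1 \<equiv> t + real R * (2 * \<eta> + 2 * \<rho> / h)"
  defines "e2 \<equiv> 2 * d * t + d * (ln (real (Suc R)) + 1)"
  shows "0 < u t Z1 + u t Z2" 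
    "u t Z1 + u t Z2 \<le> total_mass u t"
    "total_mass u t \<le> (u t Z1 + u t Z2) * (1 + c + (1 + c) * N * (1 + 2 * X * N) * exp (e1 + e2 - D)
        + exp (h * t + e2 - P0) + 2 * K0 * exp (e2 - P0))"
proof -
  note sol = nonneg_pam_solutionD[OF u]
  define Y where "Y = Phi t (V Z1) Z1"
  have t0: "0 \<le> t" using t by simp
  have d: "1 \<le> d" by (simp add: d_def Suc_le_eq)
  have h0: "0 < h" using h d by (meson exp_gt_zero less_le_trans mult_pos_pos zero_less_one)
  have hX: "h \<le> X" using X[OF Z1(1)] Z1(2) by simp
  have N0: "0 \<le> N" by (simp add: N_def)
  have c0: "0 \<le> c" using g d by (simp add: c_def)
  have fin: "finite (lball R :: (int ^ 'd) set)" by (rule finite_lball)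
  have K00: "0 \<le> K0" using K0[of "{}"] by simp
  have lower: "exp (Y - e2) \<le> u t Z1"
  proof -
    have "real (nrm Z1) \<le> t * V Z1" using Z1(3) by simp
    from solution_lower_bound[OF u V _ this] h0 Z1
    have "exp (Y - 2 * d * t - d * (ln (real (nrm Z1)) + 1)) \<le> u t Z1" by (simp add: Y_def d_def)
    moreover have "ln (real (nrm Z1)) \<le> ln (real (Suc R))"
    proof (cases "nrm Z1 = 0")
      case False
      then have "0 < nrm Z1" by (simp only: neq0_conv)
      then show ?thesis using Z1(1) by (intro ln_mono) auto
    qed simp
    then have "d * (ln (real (nrm Z1)) + 1) \<le> d * (ln (real (Suc R)) + 1)" using d by (intro mult_left_mono) auto
    then have "exp (Y - e2) \<le> exp (Y - 2 * d * t - d * (ln (real (nrm Z1)) + 1))" by (simp add: e2_def)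
    ultimately show ?thesis by linarith
  qed
  have u2: "0 \<le> u t Z2" using sol(1) t0 by simp
  have lower': "exp (Y - e2) \<le> u t Z1 + u t Z2" using lower u2 by simp
  show pos: "0 < u t Z1 + u t Z2" using lower' exp_gt_zero[of "Y - e2"] by linarith
  have tail: "u t x \<le> dsol V (lball R) t x + 2 * exp (- real (max (Suc R) (nrm x)))" for x
    by (rule solution_tail_bound[OF u V growth \<gamma> C0 t0 R])
  have "finite {Z1, Z2}" by simp
  note mass = total_mass_bounds[OF u t0 this tail K0]
  show "u t Z1 + u t Z2 \<le> total_mass u t" using mass(1) Z by simp
  \<comment> \<open>At the two sites the solution itself serves as the bound, so the mass slaved to
    them is measured directly against the numerator of the ratio.\<close>
  define F where "F m = (if m \<in> {Z1, Z2} then u t m else exp (Y - D + e1) * (1 + 2 * X * N))" for m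
  have Fbound: "dsol V B t m \<le> F m" if B: "B \<subseteq> lball R" "m \<in> B" "h \<le> V m" "\<And>x. x \<in> B \<Longrightarrow> V x \<le> V m" for B m
  proof (cases "m \<in> {Z1, Z2}")
    case True
    then show ?thesis using dsol_le_solution[OF u finite_subset[OF B(1) fin] t0] by (auto simp: F_def)
  next
    case False
    define S where "S = {x \<in> B. \<rho> < V x}"
    define x where "x = V m"
    have mR: "nrm m \<le> R" using B by (auto simp: lball_def)
    have x: "h \<le> x" "x \<le> X" "0 < x" using B X[OF mR] h0 by (auto simp: x_def)
    have x\<rho>: "x / 2 \<le> x - \<rho>" "0 < x - \<rho>" "x - \<rho> \<le> X" using x h by auto
    have cardS: "real (card S) \<le> N"
      unfolding N_def S_def using B fin by (intro of_nat_mono card_mono) auto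
    have b: "1 / (x - \<rho>) \<le> 2 / h"
      using frac_le[of 1 1 "h / 2" "x - \<rho>"] x\<rho> x h0 by simp
    have "dsol V B t m \<le> exp ((x + 1) * t + entr m + real (nrm m) * (2 * \<eta> - ln (x - \<rho>))) * (1 + 2 * (x - \<rho>) * real (card S))"
      unfolding x_def
    proof (rule dsol_max_site_bound[where b = "1 / (V m - \<rho>)" and S = S and K = K and \<eta> = \<eta> and \<rho> = \<rho>], unfold x_def[symmetric] d_def[symmetric])
      show "20 * d * (1 / (x - \<rho>)) \<le> \<eta>"
      proof -
        have "20 * d * (1 / (x - \<rho>)) \<le> 20 * d * (2 / h)" using d by (intro mult_left_mono b) auto
        also have "\<dots> \<le> \<eta>" using \<eta>(3) h0 by (simp add: field_simps)
        finally show ?thesis .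
      qed
      show "16 * d\<^sup>2 * (1 / (x - \<rho>)) \<le> 1"
      proof -
        have "16 * d\<^sup>2 * (1 / (x - \<rho>)) \<le> 16 * d\<^sup>2 * (2 / h)" using d by (intro mult_left_mono b) auto
        also have "\<dots> \<le> 1" using \<eta>(4) h0 by (simp add: field_simps)
        finally show ?thesis .
      qed
      show "real (card S) * exp (- \<eta> * K) \<le> 1 / (x - \<rho>) / 4"
      proof -
        have "4 * (x - \<rho>) * real (card S) * exp (- \<eta> * K) \<le> 4 * X * N * exp (- \<eta> * K)"
          using x\<rho> x cardS by (intro mult_right_mono mult_mono) auto
        also have "\<dots> \<le> 1" by (rule K)
        finally show ?thesis using x\<rho> by (simp add: field_simps)
      qed
      show "K \<le> real (nrm (x - y))" if "x \<in> S" "y \<in> S" "x \<noteq> y" for x y :: "int ^ 'd"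
        by (rule sep) (use that B in \<open>auto simp: S_def lball_def\<close>)
    qed (use B \<eta> x\<rho> t0 finite_subset[OF B(1) fin] in \<open>auto simp: S_def x_def\<close>)
    also have "\<dots> \<le> exp (Y - D + e1) * (1 + 2 * X * N)"
    proof (rule mult_mono)
      have "2 * (x - \<rho>) * real (card S) \<le> 2 * X * N" using x\<rho> x cardS by (intro mult_mono) auto
      then show "1 + 2 * (x - \<rho>) * real (card S) \<le> 1 + 2 * X * N" by simp
      have "ln x - 2 * \<rho> / x \<le> ln (x - \<rho>)" by (rule ln_diff_ge_ratio) (use x h in auto)
      moreover have "2 * \<rho> / x \<le> 2 * \<rho> / h" using x h h0 by (intro divide_left_mono) auto
      ultimately have "2 * \<eta> - ln (x - \<rho>) \<le> (2 * \<eta> + 2 * \<rho> / h) - ln x" by linarith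
      then have "real (nrm m) * (2 * \<eta> - ln (x - \<rho>)) \<le> real (nrm m) * ((2 * \<eta> + 2 * \<rho> / h) - ln x)"
        by (rule mult_left_mono) simp
      also have "\<dots> = real (nrm m) * (2 * \<eta> + 2 * \<rho> / h) - real (nrm m) * ln x" by (simp add: algebra_simps)
      also have "real (nrm m) * (2 * \<eta> + 2 * \<rho> / h) \<le> real R * (2 * \<eta> + 2 * \<rho> / h)"
        using mR \<eta> h h0 by (intro mult_right_mono) auto
      finally have 1: "(x + 1) * t + entr m + real (nrm m) * (2 * \<eta> - ln (x - \<rho>)) \<le> Phi t x m + e1"
        by (simp add: Phi_def e1_def algebra_simps)
      have "Phi t x m \<le> Y - D"
      proof (cases "2 * real (nrm m) \<le> t * x")
        case True
        then show ?thesis unfolding Y_def x_def by (intro others mR) (use B False in \<open>auto simp: x_def\<close>)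
      next
        \<comment> \<open>Sites too distant to be admissible have \<open>t * x < 2 * nrm m\<close>;
          as \<open>ln x >= 2 + ln d\<close> outweighs this and the entropy,
          \<open>Phi t x m <= 0\<close>. This is where \<open>exp 2 * d <= h\<close> enters.\<close>
        case False
        have "2 + ln d = ln (exp 2 * d)" using d by (simp add: ln_mult)
        also have "\<dots> \<le> ln x" using h x d by (intro ln_mono) auto
        finally have "real (nrm m) * (2 + ln d) \<le> real (nrm m) * ln x" by (intro mult_left_mono) auto
        with entr_bounds(2)[of m] False have "Phi t x m \<le> 0"
          by (simp add: Phi_def d_def algebra_simps)
        also have "0 \<le> Y - D" using D by (simp add: Y_def)
        finally show ?thesis .
      qed
      with 1 show "exp ((x + 1) * t + entr m + real (nrm m) * (2 * \<eta> - ln (x - \<rho>))) \<le> exp (Y - D + e1)" by simp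
    qed (use x\<rho> x in auto)
    finally show ?thesis using False by (simp add: F_def)
  qed
  have XN: "0 \<le> 1 + 2 * X * N" using N0 hX h0 by simp
  have "(\<Sum>x\<in>lball R - {Z1, Z2}. dsol V (lball R) t x) \<le>
    (\<Sum>m\<in>{m\<in>lball R. h \<le> V m}. (c + (if m \<in> {Z1, Z2} then 0 else 1)) * F m) + exp (h * t)"
    unfolding c_def d_def
    by (rule dsol_mass_decomposition[OF fin t0 _ _ Fbound]) (use g gap in \<open>auto simp: d_def lball_def\<close>)
  also have "(\<Sum>m\<in>{m\<in>lball R. h \<le> V m}. (c + (if m \<in> {Z1, Z2} then 0 else 1)) * F m) \<le>
      (\<Sum>m\<in>{m\<in>lball R. h \<le> V m}. (if m \<in> {Z1, Z2} then c * u t m else 0) + (1 + c) * (exp (Y - D + e1) * (1 + 2 * X * N)))"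
    by (rule sum_mono) (use c0 XN in \<open>auto simp: F_def add.commute\<close>)
  also have "\<dots> = (\<Sum>m\<in>{m\<in>lball R. h \<le> V m} \<inter> {Z1, Z2}. c * u t m) +
       real (card {m\<in>lball R :: (int ^ 'd) set. h \<le> V m}) * ((1 + c) * (exp (Y - D + e1) * (1 + 2 * X * N)))"
    using fin by (simp add: sum.distrib sum.If_cases Int_def)
  also have "(\<Sum>m\<in>{m\<in>lball R. h \<le> V m} \<inter> {Z1, Z2}. c * u t m) \<le> (\<Sum>m\<in>{Z1, Z2}. c * u t m)"
    by (rule sum_mono2) (use c0 sol(1) t0 in auto)
  also have "\<dots> = c * (u t Z1 + u t Z2)" using Z by (simp add: distrib_left)
  also have "real (card {m\<in>lball R :: (int ^ 'd) set. h \<le> V m}) * ((1 + c) * (exp (Y - D + e1) * (1 + 2 * X * N)))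
       \<le> N * ((1 + c) * (exp (Y - D + e1) * (1 + 2 * X * N)))"
    unfolding N_def using c0 XN fin by (intro mult_right_mono of_nat_mono card_mono) (auto simp: N_def)
  finally have "(\<Sum>x\<in>lball R - {Z1, Z2}. dsol V (lball R) t x) \<le>
    c * (u t Z1 + u t Z2) + N * ((1 + c) * (exp (Y - D + e1) * (1 + 2 * X * N))) + exp (h * t)" by simp
  with mass(2) Z have "total_mass u t \<le> (1 + c) * (u t Z1 + u t Z2) + (1 + c) * N * (1 + 2 * X * N) * exp (Y - D + e1) + exp (h * t) + 2 * K0"
    by (simp add: algebra_simps)
  moreover have "(1 + c) * N * (1 + 2 * X * N) * exp (Y - D + e1) \<le> (u t Z1 + u t Z2) * ((1 + c) * N * (1 + 2 * X * N) * exp (e1 + e2 - D))"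
  proof -
    have "exp (Y - D + e1) = exp (Y - e2) * exp (e1 + e2 - D)" by (simp flip: exp_add)
    also have "\<dots> \<le> (u t Z1 + u t Z2) * exp (e1 + e2 - D)" by (intro mult_right_mono lower') simp
    finally have "(1 + c) * N * (1 + 2 * X * N) * exp (Y - D + e1) \<le> (1 + c) * N * (1 + 2 * X * N) * ((u t Z1 + u t Z2) * exp (e1 + e2 - D))"
      using c0 N0 XN by (intro mult_left_mono) auto
    then show ?thesis by (simp add: mult_ac)
  qed
  moreover have small: "exp z \<le> (u t Z1 + u t Z2) * exp (z + e2 - P0)" for z
  proof -
    have "exp z \<le> exp (Y - e2) * exp (z + e2 - P0)" using P0 by (simp add: Y_def flip: exp_add)
    also have "\<dots> \<le> (u t Z1 + u t Z2) * exp (z + e2 - P0)" by (intro mult_right_mono lower') simp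
    finally show ?thesis .
  qed
  moreover have "2 * K0 * exp 0 \<le> 2 * K0 * ((u t Z1 + u t Z2) * exp (0 + e2 - P0))"
    using K00 by (intro mult_left_mono small) auto
  then have "2 * K0 \<le> (u t Z1 + u t Z2) * (2 * K0 * exp (e2 - P0))" by (simp add: algebra_simps)
  ultimately show "total_mass u t \<le> (u t Z1 + u t Z2) * (1 + c + (1 + c) * N * (1 + 2 * X * N) * exp (e1 + e2 - D)
        + exp (h * t + e2 - P0) + 2 * K0 * exp (e2 - P0))"
    using small[of "h * t"] unfolding distrib_left by (simp add: algebra_simps)
qed

section \<open>Pareto fields\<close>

lemma powr_minus_diff_le:
  fixes y w \<alpha> :: real
  assumes "0 < y" "0 \<le> w" "0 \<le> \<alpha>"
  shows "y powr (-\<alpha>) - (y + w) powr (-\<alpha>) \<le> \<alpha> * y powr (-\<alpha> - 1) * w"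
proof -
  define s where "s = w / y"
  have s: "0 \<le> s" using assms by (simp add: s_def)
  have "1 - \<alpha> * s \<le> 1 - \<alpha> * ln (1 + s)"
    using assms ln_add_one_self_le_self[OF s] by (simp add: mult_left_mono)
  also have "\<dots> \<le> exp (- (\<alpha> * ln (1 + s)))"
    using exp_ge_add_one_self[of "- (\<alpha> * ln (1 + s))"] by simp
  also have "\<dots> = (1 + s) powr (-\<alpha>)" using s by (simp add: powr_def)
  finally have "y powr (-\<alpha>) * (1 - \<alpha> * s) \<le> y powr (-\<alpha>) * (1 + s) powr (-\<alpha>)"
    by (intro mult_left_mono) auto
  also have "\<dots> = (y + w) powr (-\<alpha>)"
    using assms s by (simp add: s_def distrib_left flip: powr_mult)
  also have "y powr (-\<alpha>) * (1 - \<alpha> * s) = y powr (-\<alpha>) - \<alpha> * y powr (-\<alpha> - 1) * w"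
    using assms by (simp add: s_def powr_diff algebra_simps)
  finally show ?thesis by simp
qed

text \<open>The slope of \<open>Phi t x m\<close> in \<open>x\<close> is
  \<open>t - nrm m / x\<close>, between \<open>t / 2\<close> and \<open>t\<close> as long as
  \<open>2 * nrm m <= t * x\<close>. Windows for \<open>Phi\<close> thus translate into windows for
  the potential that are shorter by a factor of order \<open>t\<close>.\<close>

lemma Phi_increment:
  fixes m :: "int ^ 'd"
  assumes "0 < a" "a \<le> b" "2 * real (nrm m) \<le> t * a"
  shows "t / 2 * (b - a) \<le> Phi t b m - Phi t a m" "Phi t b m - Phi t a m \<le> t * (b - a)"
proof -
  have "ln (b / a) \<le> b / a - 1" using assms by (intro ln_le_minus_one) auto
  then have "ln b - ln a \<le> (b - a) / a" using assms by (simp add: ln_div diff_divide_distrib)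
  then have "real (nrm m) * (ln b - ln a) \<le> real (nrm m) * ((b - a) / a)" by (intro mult_left_mono) auto
  also have "\<dots> = real (nrm m) / a * (b - a)" by simp
  also have "\<dots> \<le> t / 2 * (b - a)" using assms by (intro mult_right_mono) (auto simp: field_simps)
  finally show "t / 2 * (b - a) \<le> Phi t b m - Phi t a m" by (simp add: Phi_def field_simps)
  have "0 \<le> real (nrm m) * (ln b - ln a)" using assms by simp
  then show "Phi t b m - Phi t a m \<le> t * (b - a)" by (simp add: Phi_def algebra_simps)
qed

locale pareto_field = prob_space M for M :: "'w measure" +
  fixes \<xi> :: "int ^ 'd \<Rightarrow> 'w \<Rightarrow> real" and \<alpha> :: real
  assumes indep: "indep_vars (\<lambda>_. borel) \<xi> UNIV"
    and dist: "\<And>z x. x \<ge> 1 \<Longrightarrow> prob {\<omega> \<in> space M. \<xi> z \<omega> < x} = 1 - x powr (-\<alpha>)"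
    and \<alpha>_pos: "0 < \<alpha>"
begin

lemma field_measurable [measurable]: "\<xi> z \<in> borel_measurable M"
  using indep by (auto simp: indep_vars_def)

lemma prob_ge:
  assumes "1 \<le> x" shows "prob {\<omega> \<in> space M. x \<le> \<xi> z \<omega>} = x powr (-\<alpha>)"
proof -
  have "prob {\<omega> \<in> space M. \<not> \<xi> z \<omega> < x} = 1 - prob {\<omega> \<in> space M. \<xi> z \<omega> < x}"
    by (rule prob_neg) measurable
  then show ?thesis using dist[OF assms, of z] by (simp add: not_less)
qed

lemma AE_ge_1: "AE \<omega> in M. \<forall>z. 1 \<le> \<xi> z \<omega>"
proof -
  have "AE \<omega> in M. 1 \<le> \<xi> z \<omega>" for z
  proof -
    have "prob {\<omega> \<in> space M. 1 \<le> \<xi> z \<omega>} = 1" by (simp add: prob_ge)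
    then show ?thesis by (subst (asm) prob_Collect_eq_1) auto
  qed
  then show ?thesis by (subst AE_all_countable) (rule countableI_type | simp)+
qed

lemma prob_interval_le:
  assumes "1 \<le> y" "0 \<le> w"
  shows "prob {\<omega> \<in> space M. y \<le> \<xi> z \<omega> \<and> \<xi> z \<omega> < y + w} \<le> \<alpha> * y powr (-\<alpha> - 1) * w"
proof -
  have "{\<omega> \<in> space M. y \<le> \<xi> z \<omega> \<and> \<xi> z \<omega> < y + w} = {\<omega> \<in> space M. y \<le> \<xi> z \<omega>} - {\<omega> \<in> space M. y + w \<le> \<xi> z \<omega>}"
    by auto
  also have "prob \<dots> = prob {\<omega> \<in> space M. y \<le> \<xi> z \<omega>} - prob {\<omega> \<in> space M. y + w \<le> \<xi> z \<omega>}"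
    by (rule finite_measure_Diff) (use assms in auto)
  also have "\<dots> = y powr (-\<alpha>) - (y + w) powr (-\<alpha>)" using assms by (simp add: prob_ge)
  also have "\<dots> \<le> \<alpha> * y powr (-\<alpha> - 1) * w"
    by (rule powr_minus_diff_le) (use assms \<alpha>_pos in auto)
  finally show ?thesis .
qed

lemma prob_indep:
  assumes "finite J" "J \<noteq> {}" "\<And>j. j \<in> J \<Longrightarrow> A j \<in> sets borel"
  shows "prob {\<omega> \<in> space M. \<forall>j\<in>J. \<xi> j \<omega> \<in> A j} = (\<Prod>j\<in>J. prob {\<omega> \<in> space M. \<xi> j \<omega> \<in> A j})"
proof -
  have "{\<omega> \<in> space M. \<forall>j\<in>J. \<xi> j \<omega> \<in> A j} = (\<Inter>j\<in>J. \<xi> j -` A j \<inter> space M)" using assms(2) by auto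
  also have "prob \<dots> = (\<Prod>j\<in>J. prob (\<xi> j -` A j \<inter> space M))"
    by (rule indep_varsD[OF indep]) (use assms in auto)
  also have "\<dots> = (\<Prod>j\<in>J. prob {\<omega> \<in> space M. \<xi> j \<omega> \<in> A j})"
    by (intro prod.cong refl arg_cong[of _ _ prob]) auto
  finally show ?thesis .
qed

lemma prob_indep2:
  assumes "x \<noteq> y" "A \<in> sets borel" "B \<in> sets borel"
  shows "prob {\<omega> \<in> space M. \<xi> x \<omega> \<in> A \<and> \<xi> y \<omega> \<in> B} = prob {\<omega> \<in> space M. \<xi> x \<omega> \<in> A} * prob {\<omega> \<in> space M. \<xi> y \<omega> \<in> B}"
  using prob_indep[of "{x, y}" "\<lambda>j. if j = x then A else B"] assms by (simp add: eq_commute[of x y])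

lemma prob_indep3:
  assumes "x \<noteq> y" "x \<noteq> z" "y \<noteq> z" "A \<in> sets borel" "B \<in> sets borel" "C \<in> sets borel"
  shows "prob {\<omega> \<in> space M. \<xi> x \<omega> \<in> A \<and> \<xi> y \<omega> \<in> B \<and> \<xi> z \<omega> \<in> C} =
    prob {\<omega> \<in> space M. \<xi> x \<omega> \<in> A} * (prob {\<omega> \<in> space M. \<xi> y \<omega> \<in> B} * prob {\<omega> \<in> space M. \<xi> z \<omega> \<in> C})"
  using prob_indep[of "{x, y, z}" "\<lambda>j. if j = x then A else if j = y then B else C"] assms
  by (simp add: eq_commute[of x y] eq_commute[of x z] eq_commute[of y z])

lemma prob_max_ge_le:
  assumes "1 \<le> L"
  shows "prob {\<omega> \<in> space M. \<exists>x\<in>lball n. L \<le> \<xi> x \<omega>} \<le> real (card (lball n :: (int ^ 'd) set)) * L powr (-\<alpha>)"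
proof -
  have "prob {\<omega> \<in> space M. \<exists>x\<in>lball n. L \<le> \<xi> x \<omega>} = prob (\<Union>x\<in>lball n. {\<omega> \<in> space M. L \<le> \<xi> x \<omega>})"
    by (intro arg_cong[of _ _ prob]) auto
  also have "\<dots> \<le> (\<Sum>x\<in>lball n. prob {\<omega> \<in> space M. L \<le> \<xi> x \<omega>})"
    by (rule finite_measure_subadditive_finite) (auto simp: finite_lball)
  also have "\<dots> = real (card (lball n :: (int ^ 'd) set)) * L powr (-\<alpha>)" using assms by (simp add: prob_ge)
  finally show ?thesis .
qed

lemma prob_all_less_le:
  assumes "1 \<le> L" "finite B" "B \<noteq> {}"
  shows "prob {\<omega> \<in> space M. \<forall>x\<in>B. \<xi> x \<omega> < L} \<le> exp (- real (card B) * L powr (-\<alpha>))"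
proof -
  have "prob {\<omega> \<in> space M. \<forall>x\<in>B. \<xi> x \<omega> < L} = (\<Prod>x\<in>B. prob {\<omega> \<in> space M. \<xi> x \<omega> < L})"
    using prob_indep[OF assms(2,3), of "\<lambda>_. {..<L}"] by simp
  also have "\<dots> = (1 - L powr (-\<alpha>)) ^ card B" using dist[OF assms(1)] by simp
  also have "\<dots> \<le> exp (- (L powr (-\<alpha>))) ^ card B"
  proof (rule power_mono)
    show "1 - L powr (-\<alpha>) \<le> exp (- (L powr (-\<alpha>)))"
      using exp_ge_add_one_self[of "- (L powr (-\<alpha>))"] by simp
    show "0 \<le> 1 - L powr (-\<alpha>)" using dist[OF assms(1), of undefined] by (metis measure_nonneg)
  qed
  also have "\<dots> = exp (- real (card B) * L powr (-\<alpha>))" by (simp flip: exp_of_nat_mult)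
  finally show ?thesis .
qed

text \<open>Indexed by a site and a displacement, so that a union bound counts the product of the
  two ball sizes; the second site may lie outside \<open>lball R\<close>.\<close>

definition close_pair_event :: "nat \<Rightarrow> nat \<Rightarrow> real \<Rightarrow> 'w set" where
  "close_pair_event R k \<rho> = (\<Union>x\<in>lball R. \<Union>w\<in>lball k - {0}. {\<omega> \<in> space M. \<rho> \<le> \<xi> x \<omega> \<and> \<rho> \<le> \<xi> (x + w) \<omega>})"

lemma close_pair_event_sets [measurable]: "close_pair_event R k \<rho> \<in> events"
  unfolding close_pair_event_def by (intro sets.finite_UN finite_lball finite_Diff) measurable

lemma prob_close_pair_event_le:
  assumes "1 \<le> \<rho>"
  shows "prob (close_pair_event R k \<rho>) \<le>
    real (card (lball R :: (int ^ 'd) set)) * real (card (lball k :: (int ^ 'd) set)) * \<rho> powr (-2 * \<alpha>)"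
proof -
  let ?E = "\<lambda>x w. {\<omega> \<in> space M. \<rho> \<le> \<xi> x \<omega> \<and> \<rho> \<le> \<xi> (x + w) \<omega>}"
  have E: "prob (?E x w) = \<rho> powr (-2 * \<alpha>)" if "w \<noteq> 0" for x w
    using prob_indep2[of x "x + w" "{\<rho>..}" "{\<rho>..}"] that assms
    by (simp add: prob_ge flip: powr_add)
  have "prob (close_pair_event R k \<rho>) \<le> (\<Sum>x\<in>lball R. prob (\<Union>w\<in>lball k - {0}. ?E x w))"
    unfolding close_pair_event_def
    by (rule finite_measure_subadditive_finite) (auto simp: finite_lball intro!: sets.finite_UN)
  also have "\<dots> \<le> (\<Sum>x\<in>(lball R :: (int ^ 'd) set). \<Sum>w\<in>lball k - {0 :: int ^ 'd}. prob (?E x w))"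
    by (intro sum_mono finite_measure_subadditive_finite) (auto simp: finite_lball)
  also have "\<dots> \<le> (\<Sum>x\<in>(lball R :: (int ^ 'd) set). \<Sum>w\<in>(lball k :: (int ^ 'd) set). \<rho> powr (-2 * \<alpha>))"
  proof (rule sum_mono)
    fix x :: "int ^ 'd"
    have "(\<Sum>w\<in>lball k - {0 :: int ^ 'd}. prob (?E x w)) = (\<Sum>w\<in>lball k - {0 :: int ^ 'd}. \<rho> powr (-2 * \<alpha>))"
      by (intro sum.cong refl E) simp
    also have "\<dots> \<le> (\<Sum>w\<in>(lball k :: (int ^ 'd) set). \<rho> powr (-2 * \<alpha>))"
      by (intro sum_mono2 finite_lball) auto
    finally show "(\<Sum>w\<in>lball k - {0 :: int ^ 'd}. prob (?E x w)) \<le> (\<Sum>w\<in>(lball k :: (int ^ 'd) set). \<rho> powr (-2 * \<alpha>))" .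
  qed
  finally show ?thesis by simp
qed

text \<open>Replaces conditioning on \<open>\<xi> x\<close>.\<close>

lemma prob_by_cells:
  assumes Ev: "Ev \<in> events" and h: "1 \<le> h" and s: "0 < s" and c: "0 \<le> c"
    and sub: "Ev \<subseteq> {\<omega> \<in> space M. h \<le> \<xi> x \<omega>}"
    and cell: "\<And>a. h \<le> a \<Longrightarrow> prob (Ev \<inter> {\<omega> \<in> space M. a \<le> \<xi> x \<omega> \<and> \<xi> x \<omega> < a + s})
        \<le> c * prob {\<omega> \<in> space M. a \<le> \<xi> x \<omega> \<and> \<xi> x \<omega> < a + s}"
  shows "prob Ev \<le> c * h powr (-\<alpha>)"
proof -
  define a where "a j = h + real j * s" for j
  define I where "I j = {\<omega> \<in> space M. a j \<le> \<xi> x \<omega> \<and> \<xi> x \<omega> < a j + s}" for j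
  have I_meas [measurable]: "I j \<in> events" for j unfolding I_def by measurable
  have ha: "h \<le> a j" for j using s by (simp add: a_def)
  have Un: "(\<Union>j. I j) = {\<omega> \<in> space M. h \<le> \<xi> x \<omega>}"
  proof (intro set_eqI iffI)
    fix \<omega> assume "\<omega> \<in> {\<omega> \<in> space M. h \<le> \<xi> x \<omega>}"
    then have \<omega>: "\<omega> \<in> space M" "h \<le> \<xi> x \<omega>" by auto
    define j where "j = nat \<lfloor>(\<xi> x \<omega> - h) / s\<rfloor>"
    have "0 \<le> (\<xi> x \<omega> - h) / s" using \<omega> s by simp
    then have "real j \<le> (\<xi> x \<omega> - h) / s" "(\<xi> x \<omega> - h) / s < real j + 1"
      unfolding j_def by linarith+
    then have "\<omega> \<in> I j" using s \<omega> by (auto simp: I_def a_def field_simps)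
    then show "\<omega> \<in> (\<Union>j. I j)" by auto
  next
    fix \<omega> assume "\<omega> \<in> (\<Union>j. I j)"
    then show "\<omega> \<in> {\<omega> \<in> space M. h \<le> \<xi> x \<omega>}" using ha by (auto simp: I_def intro: order_trans)
  qed
  have disj: "disjoint_family I"
    unfolding disjoint_family_on_def
  proof (intro ballI impI)
    fix i j :: nat assume ij: "i \<noteq> j"
    have *: "I i \<inter> I j = {}" if "i < j" for i j
    proof -
      have "a i + s \<le> a j"
      proof -
        have "real (Suc i) * s \<le> real j * s" using that s by (intro mult_right_mono) auto
        then show ?thesis by (simp add: a_def algebra_simps)
      qed
      then show ?thesis by (auto simp: I_def)
    qed
    show "I i \<inter> I j = {}" using *[of i j] *[of j i] ij by (cases "i < j") auto
  qed
  have "(\<lambda>j. prob (I j)) sums prob (\<Union>j. I j)"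
    by (rule finite_measure_UNION) (use disj in auto)
  then have 1: "(\<lambda>j. c * prob (I j)) sums (c * h powr (-\<alpha>))"
    unfolding Un using h by (simp add: prob_ge sums_mult)
  have "(\<lambda>j. prob (Ev \<inter> I j)) sums prob (\<Union>j. Ev \<inter> I j)"
    by (rule finite_measure_UNION) (use disj Ev in \<open>auto simp: disjoint_family_on_def\<close>)
  also have "(\<Union>j. Ev \<inter> I j) = Ev" using sub Un by auto
  finally have 2: "(\<lambda>j. prob (Ev \<inter> I j)) sums prob Ev" .
  show ?thesis by (rule sums_le[OF _ 2 1]) (use cell ha in \<open>auto simp: I_def\<close>)
qed

definition tie_event :: "nat \<Rightarrow> real \<Rightarrow> real \<Rightarrow> 'w set" where
  "tie_event R h g = (\<Union>x\<in>lball R. \<Union>y\<in>lball R - {x}.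
     {\<omega> \<in> space M. h \<le> \<xi> x \<omega> \<and> \<xi> x \<omega> - g < \<xi> y \<omega> \<and> \<xi> y \<omega> \<le> \<xi> x \<omega>})"

lemma tie_event_sets [measurable]: "tie_event R h g \<in> events"
  unfolding tie_event_def by (intro sets.finite_UN finite_lball finite_Diff) measurable

text \<open>Once \<open>\<xi> x\<close> is confined to a cell of width \<open>g\<close>, a tie
  forces \<open>\<xi> y\<close> into an interval of length \<open>2 * g\<close> starting above
  \<open>h / 2\<close>, and independence applies.\<close>

lemma prob_tie_event_le:
  assumes h: "2 \<le> h" and g: "0 < g" "2 * g \<le> h"
  shows "prob (tie_event R h g) \<le>
    (real (card (lball R :: (int ^ 'd) set)))\<^sup>2 * (\<alpha> * (h / 2) powr (-\<alpha> - 1) * (2 * g) * h powr (-\<alpha>))"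
proof -
  let ?E = "\<lambda>x y. {\<omega> \<in> space M. h \<le> \<xi> x \<omega> \<and> \<xi> x \<omega> - g < \<xi> y \<omega> \<and> \<xi> y \<omega> \<le> \<xi> x \<omega>}"
  let ?p = "\<alpha> * (h / 2) powr (-\<alpha> - 1) * (2 * g) * h powr (-\<alpha>)"
  have p0: "0 \<le> ?p" using \<alpha>_pos g by simp
  have E: "prob (?E x y) \<le> ?p" if "x \<noteq> y" for x y
  proof (rule prob_by_cells[where x = x and s = g])
    fix a assume a: "h \<le> a"
    have "prob (?E x y \<inter> {\<omega> \<in> space M. a \<le> \<xi> x \<omega> \<and> \<xi> x \<omega> < a + g})
      \<le> prob {\<omega> \<in> space M. \<xi> x \<omega> \<in> {a..<a + g} \<and> \<xi> y \<omega> \<in> {a - g..<(a - g) + 2 * g}}"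
      by (rule finite_measure_mono) auto
    also have "\<dots> = prob {\<omega> \<in> space M. \<xi> x \<omega> \<in> {a..<a + g}} * prob {\<omega> \<in> space M. \<xi> y \<omega> \<in> {a - g..<(a - g) + 2 * g}}"
      by (rule prob_indep2[OF that]) auto
    finally have 1: "prob (?E x y \<inter> {\<omega> \<in> space M. a \<le> \<xi> x \<omega> \<and> \<xi> x \<omega> < a + g})
      \<le> prob {\<omega> \<in> space M. \<xi> x \<omega> \<in> {a..<a + g}} * prob {\<omega> \<in> space M. \<xi> y \<omega> \<in> {a - g..<(a - g) + 2 * g}}" .
    have "prob {\<omega> \<in> space M. \<xi> y \<omega> \<in> {a - g..<(a - g) + 2 * g}} \<le> \<alpha> * (a - g) powr (-\<alpha> - 1) * (2 * g)"
      using prob_interval_le[of "a - g" "2 * g" y] a h g by simp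
    also have "\<dots> \<le> \<alpha> * (h / 2) powr (-\<alpha> - 1) * (2 * g)"
      using a h g \<alpha>_pos by (intro mult_right_mono mult_left_mono powr_mono2') auto
    finally have "prob {\<omega> \<in> space M. \<xi> x \<omega> \<in> {a..<a + g}} * prob {\<omega> \<in> space M. \<xi> y \<omega> \<in> {a - g..<(a - g) + 2 * g}}
      \<le> prob {\<omega> \<in> space M. \<xi> x \<omega> \<in> {a..<a + g}} * (\<alpha> * (h / 2) powr (-\<alpha> - 1) * (2 * g))"
      by (rule mult_left_mono) simp
    from order_trans[OF 1 this] show "prob (?E x y \<inter> {\<omega> \<in> space M. a \<le> \<xi> x \<omega> \<and> \<xi> x \<omega> < a + g})
      \<le> (\<alpha> * (h / 2) powr (-\<alpha> - 1) * (2 * g)) * prob {\<omega> \<in> space M. a \<le> \<xi> x \<omega> \<and> \<xi> x \<omega> < a + g}"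
      by (simp add: mult.commute)
  qed (use h g \<alpha>_pos in auto)
  have "prob (tie_event R h g) \<le> (\<Sum>x\<in>lball R. prob (\<Union>y\<in>lball R - {x}. ?E x y))"
    unfolding tie_event_def
    by (rule finite_measure_subadditive_finite) (auto simp: finite_lball intro!: sets.finite_UN)
  also have "\<dots> \<le> (\<Sum>x\<in>(lball R :: (int ^ 'd) set). \<Sum>y\<in>lball R - {x}. prob (?E x y))"
    by (intro sum_mono finite_measure_subadditive_finite) (auto simp: finite_lball)
  also have "\<dots> \<le> (\<Sum>x\<in>(lball R :: (int ^ 'd) set). \<Sum>y\<in>lball R - {x}. ?p)"
    by (intro sum_mono E) auto
  also have "\<dots> \<le> (\<Sum>x\<in>(lball R :: (int ^ 'd) set). \<Sum>y\<in>(lball R :: (int ^ 'd) set). ?p)"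
    by (intro sum_mono sum_mono2 finite_lball p0) auto
  also have "\<dots> = (real (card (lball R :: (int ^ 'd) set)))\<^sup>2 * ?p" by (simp add: power2_eq_square)
  finally show ?thesis .
qed

definition triple_event :: "real \<Rightarrow> real \<Rightarrow> real \<Rightarrow> int ^ 'd \<Rightarrow> int ^ 'd \<Rightarrow> int ^ 'd \<Rightarrow> 'w set" where
  "triple_event t h \<Delta> x y z = {\<omega> \<in> space M.
     (\<forall>m\<in>{x, y, z}. h \<le> \<xi> m \<omega> \<and> 2 * real (nrm m) \<le> t * \<xi> m \<omega>) \<and>
     \<bar>Phi t (\<xi> y \<omega>) y - Phi t (\<xi> x \<omega>) x\<bar> \<le> \<Delta> \<and> \<bar>Phi t (\<xi> z \<omega>) z - Phi t (\<xi> x \<omega>) x\<bar> \<le> \<Delta>}"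

lemma triple_event_sets [measurable]: "triple_event t h \<Delta> x y z \<in> events"
  unfolding triple_event_def Phi_def by measurable

text \<open>The slope of \<open>Phi\<close> is at least \<open>t / 2\<close> on admissible values,
  so \<open>J\<close> has diameter at most \<open>6 * \<Delta> / t\<close>; doubling this length
  fits \<open>J\<close> into a half-open interval that starts at \<open>Inf J\<close>.\<close>

lemma level_set_in_interval:
  fixes m :: "int ^ 'd" and c :: real
  assumes h: "1 \<le> h" and t: "0 < t" and \<Delta>: "0 < \<Delta>"
  defines "J \<equiv> {v. h \<le> v \<and> 2 * real (nrm m) \<le> t * v \<and> c - \<Delta> \<le> Phi t v m \<and> Phi t v m \<le> c + 2 * \<Delta>}"
  obtains v0 where "h \<le> v0" "J \<subseteq> {v0..<v0 + 12 * \<Delta> / t}"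
proof (cases "J = {}")
  case True
  then show ?thesis using that[of h] by auto
next
  case False
  have bdd: "bdd_below J" by (auto simp: J_def bdd_below_def)
  have "v < Inf J + 12 * \<Delta> / t" if v: "v \<in> J" for v
  proof -
    have "v - 6 * \<Delta> / t \<le> Inf J"
    proof (rule cInf_greatest[OF False])
      fix a assume a: "a \<in> J"
      show "v - 6 * \<Delta> / t \<le> a"
      proof (cases "a \<le> v")
        case True
        have "t / 2 * (v - a) \<le> Phi t v m - Phi t a m"
          by (rule Phi_increment) (use a h True in \<open>auto simp: J_def\<close>)
        also have "\<dots> \<le> 3 * \<Delta>" using a v by (auto simp: J_def)
        finally show ?thesis using t by (simp add: field_simps)
      next
        case False
        moreover have "0 \<le> 6 * \<Delta> / t" using t \<Delta> by simp
        ultimately show ?thesis by linarith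
      qed
    qed
    moreover have "6 * \<Delta> / t < 12 * \<Delta> / t" using t \<Delta> by (intro divide_strict_right_mono) auto
    ultimately show ?thesis by linarith
  qed
  moreover have "Inf J \<le> v" if "v \<in> J" for v using that bdd by (rule cInf_lower)
  moreover have "h \<le> Inf J" by (rule cInf_greatest[OF False]) (auto simp: J_def)
  ultimately show ?thesis using that[of "Inf J"] by (auto simp: subset_iff)
qed

text \<open>On a cell of width \<open>\<Delta> / t\<close> for \<open>\<xi> x\<close> the value of
  \<open>Phi\<close> at \<open>x\<close> varies by at most \<Delta>. A near tie then confines
  \<open>\<xi> y\<close> and \<open>\<xi> z\<close> separately to fixed intervals of length
  \<open>12 * \<Delta> / t\<close>, and independence gives the square.\<close>

lemma prob_triple_event_le:
  assumes h: "1 \<le> h" and t: "0 < t" and \<Delta>: "0 < \<Delta>" and ne: "x \<noteq> y" "x \<noteq> z" "y \<noteq> z"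
  shows "prob (triple_event t h \<Delta> x y z) \<le> (\<alpha> * h powr (-\<alpha> - 1) * (12 * \<Delta> / t))\<^sup>2 * h powr (-\<alpha>)"
proof (rule prob_by_cells[where x = x and s = "\<Delta> / t"])
  fix a assume a: "h \<le> a"
  define a' where "a' = max a (2 * real (nrm x) / t)"
  define c where "c = Phi t a' x"
  define w where "w = 12 * \<Delta> / t"
  have w: "0 \<le> w" using \<Delta> t by (simp add: w_def)
  obtain vy where vy: "h \<le> vy" "{v. h \<le> v \<and> 2 * real (nrm y) \<le> t * v \<and> c - \<Delta> \<le> Phi t v y \<and> Phi t v y \<le> c + 2 * \<Delta>} \<subseteq> {vy..<vy + w}"
    unfolding w_def by (rule level_set_in_interval[OF h t \<Delta>, of y c])
  obtain vz where vz: "h \<le> vz" "{v. h \<le> v \<and> 2 * real (nrm z) \<le> t * v \<and> c - \<Delta> \<le> Phi t v z \<and> Phi t v z \<le> c + 2 * \<Delta>} \<subseteq> {vz..<vz + w}"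
    unfolding w_def by (rule level_set_in_interval[OF h t \<Delta>, of z c])
  let ?I = "{\<omega> \<in> space M. a \<le> \<xi> x \<omega> \<and> \<xi> x \<omega> < a + \<Delta> / t}"
  have sub: "triple_event t h \<Delta> x y z \<inter> ?I \<subseteq>
    {\<omega> \<in> space M. \<xi> x \<omega> \<in> {a..<a + \<Delta> / t} \<and> \<xi> y \<omega> \<in> {vy..<vy + w} \<and> \<xi> z \<omega> \<in> {vz..<vz + w}}"
  proof
    fix \<omega> assume "\<omega> \<in> triple_event t h \<Delta> x y z \<inter> ?I"
    then have \<omega>: "\<omega> \<in> space M" "a \<le> \<xi> x \<omega>" "\<xi> x \<omega> < a + \<Delta> / t" "2 * real (nrm x) \<le> t * \<xi> x \<omega>"
      "h \<le> \<xi> y \<omega>" "2 * real (nrm y) \<le> t * \<xi> y \<omega>" "h \<le> \<xi> z \<omega>" "2 * real (nrm z) \<le> t * \<xi> z \<omega>"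
      "\<bar>Phi t (\<xi> y \<omega>) y - Phi t (\<xi> x \<omega>) x\<bar> \<le> \<Delta>" "\<bar>Phi t (\<xi> z \<omega>) z - Phi t (\<xi> x \<omega>) x\<bar> \<le> \<Delta>"
      by (auto simp: triple_event_def)
    have "2 * real (nrm x) / t \<le> a'" by (simp add: a'_def)
    then have "2 * real (nrm x) \<le> t * a'" using t by (simp add: field_simps)
    moreover have "0 < a'" using a h by (simp add: a'_def less_max_iff_disj)
    moreover have "a' \<le> \<xi> x \<omega>" using \<omega> t by (simp add: a'_def field_simps)
    ultimately have a': "0 < a'" "a' \<le> \<xi> x \<omega>" "2 * real (nrm x) \<le> t * a'" by auto
    have inc: "t / 2 * (\<xi> x \<omega> - a') \<le> Phi t (\<xi> x \<omega>) x - c" "Phi t (\<xi> x \<omega>) x - c \<le> t * (\<xi> x \<omega> - a')"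
      unfolding c_def by (rule Phi_increment[OF a'])+
    have "0 \<le> t / 2 * (\<xi> x \<omega> - a')" using a' t by simp
    moreover have "t * (\<xi> x \<omega> - a') \<le> \<Delta>"
    proof -
      have "\<xi> x \<omega> - a' \<le> \<Delta> / t" using \<omega> by (simp add: a'_def)
      then have "t * (\<xi> x \<omega> - a') \<le> t * (\<Delta> / t)" using t by (intro mult_left_mono) auto
      then show ?thesis using t by simp
    qed
    ultimately have "c \<le> Phi t (\<xi> x \<omega>) x" "Phi t (\<xi> x \<omega>) x \<le> c + \<Delta>" using inc by linarith+
    with \<omega> have "\<xi> y \<omega> \<in> {vy..<vy + w}" "\<xi> z \<omega> \<in> {vz..<vz + w}"
      by (intro subsetD[OF vy(2)] subsetD[OF vz(2)] CollectI conjI; linarith)+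
    with \<omega> show "\<omega> \<in> {\<omega> \<in> space M. \<xi> x \<omega> \<in> {a..<a + \<Delta> / t} \<and> \<xi> y \<omega> \<in> {vy..<vy + w} \<and> \<xi> z \<omega> \<in> {vz..<vz + w}}"
      by auto
  qed
  have p: "prob {\<omega> \<in> space M. \<xi> m \<omega> \<in> {v..<v + w}} \<le> \<alpha> * h powr (-\<alpha> - 1) * w" if "h \<le> v" for v m
  proof -
    have "prob {\<omega> \<in> space M. \<xi> m \<omega> \<in> {v..<v + w}} \<le> \<alpha> * v powr (-\<alpha> - 1) * w"
      using prob_interval_le[of v w m] that h w by simp
    also have "\<dots> \<le> \<alpha> * h powr (-\<alpha> - 1) * w"
      using that h w \<alpha>_pos by (intro mult_right_mono mult_left_mono powr_mono2') auto
    finally show ?thesis .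
  qed
  have "prob (triple_event t h \<Delta> x y z \<inter> ?I) \<le>
    prob {\<omega> \<in> space M. \<xi> x \<omega> \<in> {a..<a + \<Delta> / t} \<and> \<xi> y \<omega> \<in> {vy..<vy + w} \<and> \<xi> z \<omega> \<in> {vz..<vz + w}}"
    by (rule finite_measure_mono[OF sub]) measurable
  also have "\<dots> = prob {\<omega> \<in> space M. \<xi> x \<omega> \<in> {a..<a + \<Delta> / t}} *
     (prob {\<omega> \<in> space M. \<xi> y \<omega> \<in> {vy..<vy + w}} * prob {\<omega> \<in> space M. \<xi> z \<omega> \<in> {vz..<vz + w}})"
    by (rule prob_indep3[OF ne]) auto
  also have "\<dots> \<le> prob {\<omega> \<in> space M. \<xi> x \<omega> \<in> {a..<a + \<Delta> / t}} * ((\<alpha> * h powr (-\<alpha> - 1) * w) * (\<alpha> * h powr (-\<alpha> - 1) * w))"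
    using \<alpha>_pos w by (intro mult_left_mono mult_mono p vy vz) auto
  finally show "prob (triple_event t h \<Delta> x y z \<inter> ?I) \<le> (\<alpha> * h powr (-\<alpha> - 1) * (12 * \<Delta> / t))\<^sup>2 * prob ?I"
    by (simp add: power2_eq_square w_def mult_ac)
next
  show "triple_event t h \<Delta> x y z \<subseteq> {\<omega> \<in> space M. h \<le> \<xi> x \<omega>}"
    by (auto simp: triple_event_def)
qed (use h t \<Delta> in simp_all)

definition triple_grid_event :: "nat \<Rightarrow> real \<Rightarrow> real \<Rightarrow> real \<Rightarrow> nat \<Rightarrow> real \<Rightarrow> 'w set" where
  "triple_grid_event R T h s J \<Delta> = (\<Union>(j, x, y, z)\<in>{(j, x, y, z). j \<le> J \<and> x \<in> lball R \<and> y \<in> lball R \<and> z \<in> lball R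
      \<and> x \<noteq> y \<and> x \<noteq> z \<and> y \<noteq> z}. triple_event (T + real j * s) h \<Delta> x y z)"

lemma finite_triples:
  "finite {(j, x, y, z). j \<le> (J :: nat) \<and> x \<in> lball R \<and> y \<in> lball R \<and> z \<in> (lball R :: (int ^ 'd) set) \<and> x \<noteq> y \<and> x \<noteq> z \<and> y \<noteq> z}"
  by (rule finite_subset[of _ "{..J} \<times> lball R \<times> lball R \<times> lball R"]) (auto intro!: finite_cartesian_product finite_lball)

lemma triple_grid_event_sets [measurable]: "triple_grid_event R T h s J \<Delta> \<in> events"
  unfolding triple_grid_event_def by (intro sets.finite_UN finite_triples) auto

lemma prob_triple_grid_event_le:
  assumes h: "1 \<le> h" and T: "0 < T" and s: "0 \<le> s" and \<Delta>: "0 < \<Delta>"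
  shows "prob (triple_grid_event R T h s J \<Delta>) \<le>
    real (Suc J) * real (card (lball R :: (int ^ 'd) set)) ^ 3 * ((\<alpha> * h powr (-\<alpha> - 1) * (12 * \<Delta> / T))\<^sup>2 * h powr (-\<alpha>))"
proof -
  let ?L = "lball R :: (int ^ 'd) set"
  let ?S = "{(j, x, y, z). j \<le> J \<and> x \<in> ?L \<and> y \<in> ?L \<and> z \<in> ?L \<and> x \<noteq> y \<and> x \<noteq> z \<and> y \<noteq> z}"
  let ?p = "(\<alpha> * h powr (-\<alpha> - 1) * (12 * \<Delta> / T))\<^sup>2 * h powr (-\<alpha>)"
  have "prob (triple_grid_event R T h s J \<Delta>) \<le> (\<Sum>(j, x, y, z)\<in>?S. prob (triple_event (T + real j * s) h \<Delta> x y z))"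
    unfolding triple_grid_event_def
    by (rule order_trans[OF finite_measure_subadditive_finite[OF finite_triples]])
       (auto simp: case_prod_beta)
  also have "\<dots> \<le> (\<Sum>i\<in>?S. ?p)"
  proof (intro sum_mono, clarify)
    fix j and x y z :: "int ^ 'd" assume ne: "x \<noteq> y" "x \<noteq> z" "y \<noteq> z"
    have Tj: "0 < T + real j * s" "T \<le> T + real j * s" using T s by (auto intro: add_pos_nonneg)
    have "prob (triple_event (T + real j * s) h \<Delta> x y z) \<le> (\<alpha> * h powr (-\<alpha> - 1) * (12 * \<Delta> / (T + real j * s)))\<^sup>2 * h powr (-\<alpha>)"
      by (rule prob_triple_event_le[OF h Tj(1) \<Delta> ne])
    also have "\<dots> \<le> ?p"
      using Tj T \<Delta> \<alpha>_pos by (intro mult_right_mono power_mono mult_left_mono divide_left_mono) auto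
    finally show "prob (triple_event (T + real j * s) h \<Delta> x y z) \<le> ?p" .
  qed
  also have "\<dots> = real (card ?S) * ?p" by simp
  also have "\<dots> \<le> real (card ({..J} \<times> ?L \<times> ?L \<times> ?L)) * ?p"
    by (intro mult_right_mono of_nat_mono card_mono) (auto intro!: finite_cartesian_product finite_lball)
  also have "\<dots> = real (Suc J) * real (card ?L) ^ 3 * ?p"
    by (simp add: card_cartesian_product power3_eq_cube algebra_simps)
  finally show ?thesis .
qed

text \<open>Rounding \<open>t\<close> up to the next grid time preserves admissibility and raises
  each \<open>Phi\<close> by at most \<open>s * X\<close>, because \<open>Phi\<close> grows in time
  at the rate of the potential. The enlarged tolerance \<open>D + 2 * s * X\<close> absorbs
  this.\<close>

lemma no_triple_tie:
  assumes \<omega>: "\<omega> \<in> space M" "\<omega> \<notin> triple_grid_event R T h s J (D + 2 * s * X)"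
    and T: "0 < T" and s: "0 < s" "T \<le> real J * s" and t: "T \<le> t" "t \<le> 2 * T" and h: "0 < h"
    and X: "\<And>m. m \<in> lball R \<Longrightarrow> \<xi> m \<omega> \<le> X"
    and xyz: "x \<in> lball R" "y \<in> lball R" "z \<in> lball R" "x \<noteq> y" "x \<noteq> z" "y \<noteq> z"
    and Q: "\<And>m. m \<in> {x, y, z} \<Longrightarrow> h \<le> \<xi> m \<omega> \<and> 2 * real (nrm m) \<le> t * \<xi> m \<omega>"
  shows "\<not> (\<bar>Phi t (\<xi> y \<omega>) y - Phi t (\<xi> x \<omega>) x\<bar> \<le> D \<and> \<bar>Phi t (\<xi> z \<omega>) z - Phi t (\<xi> x \<omega>) x\<bar> \<le> D)"
proof
  assume close: "\<bar>Phi t (\<xi> y \<omega>) y - Phi t (\<xi> x \<omega>) x\<bar> \<le> D \<and> \<bar>Phi t (\<xi> z \<omega>) z - Phi t (\<xi> x \<omega>) x\<bar> \<le> D"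
  define j where "j = nat \<lceil>(t - T) / s\<rceil>"
  define t' where "t' = T + real j * s"
  have j0: "0 \<le> (t - T) / s" using t s by simp
  then have j: "(t - T) / s \<le> real j" "real j < (t - T) / s + 1" unfolding j_def by linarith+
  then have t': "t \<le> t'" "t' \<le> t + s" using s by (auto simp: t'_def field_simps)
  have "(t - T) / s \<le> real J" using t s by (simp add: field_simps)
  then have jJ: "j \<le> J" unfolding j_def by linarith
  have \<xi>: "0 \<le> \<xi> m \<omega>" "\<xi> m \<omega> \<le> X" if "m \<in> {x, y, z}" for m
    using Q[OF that] h X[of m] that xyz by auto
  have move: "0 \<le> Phi t' (\<xi> m \<omega>) m - Phi t (\<xi> m \<omega>) m" "Phi t' (\<xi> m \<omega>) m - Phi t (\<xi> m \<omega>) m \<le> s * X" if "m \<in> {x, y, z}" for m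
  proof -
    have e: "Phi t' (\<xi> m \<omega>) m - Phi t (\<xi> m \<omega>) m = (t' - t) * \<xi> m \<omega>" by (simp add: Phi_def algebra_simps)
    show "0 \<le> Phi t' (\<xi> m \<omega>) m - Phi t (\<xi> m \<omega>) m" unfolding e using t' \<xi>[OF that] by simp
    show "Phi t' (\<xi> m \<omega>) m - Phi t (\<xi> m \<omega>) m \<le> s * X"
      unfolding e using t' \<xi>[OF that] s by (intro mult_mono) auto
  qed
  have sX: "0 \<le> s * X" using move[of x] by auto
  have "h \<le> \<xi> m \<omega> \<and> 2 * real (nrm m) \<le> t' * \<xi> m \<omega>" if "m \<in> {x, y, z}" for m
  proof -
    have "t * \<xi> m \<omega> \<le> t' * \<xi> m \<omega>" using t' \<xi>[OF that] by (intro mult_right_mono) auto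
    with Q[OF that] show ?thesis by linarith
  qed
  moreover have "\<bar>Phi t' (\<xi> y \<omega>) y - Phi t' (\<xi> x \<omega>) x\<bar> \<le> D + 2 * s * X" "\<bar>Phi t' (\<xi> z \<omega>) z - Phi t' (\<xi> x \<omega>) x\<bar> \<le> D + 2 * s * X"
    using close move[of x] move[of y] move[of z] sX by auto
  ultimately have "\<omega> \<in> triple_event t' h (D + 2 * s * X) x y z"
    using \<omega>(1) unfolding triple_event_def by blast
  then have "\<omega> \<in> triple_grid_event R T h s J (D + 2 * s * X)"
    unfolding triple_grid_event_def t'_def using jJ xyz by (auto intro!: bexI[of _ "(j, x, y, z)"])
  with \<omega>(2) show False by simp
qed

end

section \<open>Almost sure properties of the field at dyadic scales\<close>

lemma card_lball_le:
  assumes "1 \<le> y"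
  shows "real (card (lball (nat \<lfloor>y\<rfloor>) :: (int ^ 'd) set)) \<le> 3 ^ CARD('d) * y powr real CARD('d)"
proof -
  have "real (card (lball (nat \<lfloor>y\<rfloor>) :: (int ^ 'd) set)) \<le> real ((2 * nat \<lfloor>y\<rfloor> + 1) ^ CARD('d))"
    using card_lball[where 'd = 'd] by (rule of_nat_mono)
  also have "\<dots> = (2 * real (nat \<lfloor>y\<rfloor>) + 1) ^ CARD('d)" by (simp add: add.commute)
  also have "\<dots> \<le> (3 * y) ^ CARD('d)"
    using assms by (intro power_mono) linarith+
  also have "\<dots> = 3 ^ CARD('d) * y powr real CARD('d)"
    using assms by (simp add: power_mult_distrib powr_realpow)
  finally show ?thesis .
qed

text \<open>Any negative power of 2 ^ k is geometric in k, hence summable; the size of the exponent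
  is immaterial.\<close>

lemma (in prob_space) borel_cantelli_dyadic:
  assumes A: "\<And>k. A k \<in> events" and p: "p < 0"
    and le: "\<And>k. prob (A k) \<le> C * (2 ^ k) powr p"
  shows "AE \<omega> in M. \<forall>\<^sub>F k in sequentially. \<omega> \<notin> A k"
proof -
  have "(2 ^ k) powr p = (2 powr p) ^ k" for k :: nat
    by (simp add: powr_powr mult.commute flip: powr_realpow)
  moreover have "2 powr p < (1 :: real)" using p powr_less_mono[of p 0 2] by simp
  ultimately have "summable (\<lambda>k. C * (2 ^ k) powr p)"
    by (auto intro!: summable_mult summable_geometric)
  then have "summable (\<lambda>k. prob (A k))"
    by (rule summable_comparison_test'[where N = 0]) (use le in simp)
  then have "AE \<omega> in M. \<forall>\<^sub>F k in sequentially. \<omega> \<in> space M - A k"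
    by (intro borel_cantelli_AE1) (use A in \<open>auto simp: emeasure_eq_measure\<close>)
  then show ?thesis by (rule AE_mp) (auto intro!: AE_I2 elim: eventually_mono)
qed

context pareto_field
begin

text \<open>The union bound over \<open>lball (2 ^ k)\<close> has exponent
  \<open>d - \<gamma> * \<alpha> < 0\<close>, so from some scale on the maximum over the ball is
  below \<open>(2 ^ k) powr \<gamma>\<close>. The sites of one initial ball go into
  \<open>C\<close>; any other site is compared with the smallest dyadic ball containing it, whose
  radius is at most twice its norm.\<close>

lemma AE_growth:
  assumes \<gamma>: "real CARD('d) < \<gamma> * \<alpha>"
  shows "AE \<omega> in M. \<exists>C\<ge>0. \<forall>x. \<xi> x \<omega> \<le> C * (1 + real (nrm x)) powr \<gamma>"
proof -
  have \<gamma>0: "0 < \<gamma>" using \<gamma> \<alpha>_pos by (metis of_nat_0_le_iff order_le_less_trans zero_less_mult_pos2)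
  define A where "A k = {\<omega> \<in> space M. \<exists>x\<in>lball (2 ^ k). (2 ^ k) powr \<gamma> \<le> \<xi> x \<omega>}" for k :: nat
  have "AE \<omega> in M. \<forall>\<^sub>F k in sequentially. \<omega> \<notin> A k"
  proof (rule borel_cantelli_dyadic)
    fix k :: nat
    show "A k \<in> events"
      unfolding A_def by (intro sets.sets_Collect_finite_Ex finite_lball) measurable
    have T: "1 \<le> (2 ^ k :: real)" by simp
    have "prob (A k) \<le> real (card (lball (2 ^ k) :: (int ^ 'd) set)) * ((2 ^ k) powr \<gamma>) powr (-\<alpha>)"
      unfolding A_def using ge_one_powr_ge_zero[OF T, of \<gamma>] \<gamma>0 by (intro prob_max_ge_le) auto
    also have "real (card (lball (2 ^ k) :: (int ^ 'd) set)) \<le> 3 ^ CARD('d) * (2 ^ k) powr real CARD('d)"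
      using card_lball_le[OF T, where 'd = 'd] by (simp add: nat_power_eq)
    finally show "prob (A k) \<le> 3 ^ CARD('d) * (2 ^ k) powr (real CARD('d) - \<gamma> * \<alpha>)"
      by (simp add: powr_powr mult_right_mono powr_add[symmetric] diff_conv_add_uminus mult.assoc
           del: add_uminus_conv_diff)
  qed (use \<gamma> in simp)
  then show ?thesis
  proof (rule AE_mp, intro AE_I2 impI)
    fix \<omega> assume \<omega>: "\<omega> \<in> space M" and "\<forall>\<^sub>F k in sequentially. \<omega> \<notin> A k"
    then obtain n0 where n0: "\<And>n. n0 \<le> n \<Longrightarrow> \<omega> \<notin> A n" by (auto simp: eventually_sequentially)
    define C1 where "C1 = Max (insert 0 ((\<lambda>x. \<xi> x \<omega>) ` (lball (2 ^ n0) :: (int ^ 'd) set)))"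
    define C where "C = max C1 (2 powr \<gamma>)"
    have C1: "\<xi> x \<omega> \<le> C1" if "x \<in> lball (2 ^ n0)" for x
      unfolding C1_def using that by (intro Max_ge) (auto simp: finite_lball)
    have "\<xi> x \<omega> \<le> C * (1 + real (nrm x)) powr \<gamma>" for x
    proof (cases "x \<in> lball (2 ^ n0)")
      case True
      have "\<xi> x \<omega> \<le> C * 1" using C1[OF True] by (simp add: C_def)
      also have "\<dots> \<le> C * (1 + real (nrm x)) powr \<gamma>"
        using \<gamma>0 by (intro mult_left_mono ge_one_powr_ge_zero) (auto simp: C_def le_max_iff_disj)
      finally show ?thesis .
    next
      case False
      define n where "n = (LEAST n. nrm x \<le> 2 ^ n)"
      have ex: "nrm x \<le> 2 ^ nrm x" by (simp add: less_imp_le)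
      then have n: "nrm x \<le> 2 ^ n" unfolding n_def by (rule LeastI)
      have "n0 < n"
      proof (rule ccontr)
        assume "\<not> n0 < n"
        then have "(2::nat) ^ n \<le> 2 ^ n0" by (intro power_increasing) auto
        with n False show False by (simp add: lball_def)
      qed
      then obtain n' where n': "n = Suc n'" "n0 \<le> n'" by (cases n) auto
      have "\<not> nrm x \<le> 2 ^ n'"
      proof
        assume "nrm x \<le> 2 ^ n'"
        then have "n \<le> n'" unfolding n_def by (rule Least_le)
        with n' show False by simp
      qed
      then have "2 ^ n \<le> 2 * nrm x" using n' by simp
      then have n2: "(2::real) ^ n \<le> 2 * real (nrm x)" by (metis of_nat_le_iff of_nat_mult of_nat_numeral of_nat_power)
      have "\<omega> \<notin> A n" using n0 \<open>n0 < n\<close> by simp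
      then have "\<not> (2 ^ n) powr \<gamma> \<le> \<xi> x \<omega>" using n \<omega> unfolding A_def lball_def by blast
      then have "\<xi> x \<omega> \<le> (2 ^ n) powr \<gamma>" by simp
      also have "\<dots> \<le> (2 * (1 + real (nrm x))) powr \<gamma>"
        using n2 \<gamma>0 by (intro powr_mono2) auto
      also have "\<dots> = 2 powr \<gamma> * (1 + real (nrm x)) powr \<gamma>" by (rule powr_mult) 
      also have "\<dots> \<le> C * (1 + real (nrm x)) powr \<gamma>" by (intro mult_right_mono) (auto simp: C_def)
      finally show ?thesis .
    qed
    moreover have "0 \<le> C" by (simp add: C_def le_max_iff_disj)
    ultimately show "\<exists>C\<ge>0. \<forall>x. \<xi> x \<omega> \<le> C * (1 + real (nrm x)) powr \<gamma>" by blast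
  qed
qed

end

locale pareto_pam = pareto_field M \<xi> \<alpha> for M :: "'w measure" and \<xi> :: "int ^ 'd \<Rightarrow> 'w \<Rightarrow> real" and \<alpha> +
  assumes \<alpha>_gt: "real CARD('d) < \<alpha>"
begin

definition d :: real where "d = real CARD('d)"
text \<open>
  At time scale \<open>T\<close> the relevant sites have distance about \<open>T powr (1 + q)\<close> and potential about \<open>T powr q\<close>; note
  \<open>\<alpha> * q = d * (1 + q)\<close>. Everything below holds up to factors that are small powers of \<open>T\<close>, measured in
  multiples of \<open>e\<close>. The value of \<open>w\<close> makes the exponent of \<open>T\<close> in the bound for near ties of three sites equal
  to \<open>- 2 * e\<close>.
\<close>

definition q :: real where "q = d / (\<alpha> - d)"
definition w :: real where "w = 3 * d + 6 * \<alpha> + 8"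
definition e :: real where "e = q / (4 * (d + 2 * \<alpha> + 4) * (w + 6))"

text \<open>Roles at scale T: competing sites lie in \<open>lball (R_of T)\<close> and have
  potential between \<open>h_of T\<close> and \<open>X_of T\<close>; \<open>D_of T\<close> is the
  tolerance for near ties; sites above \<open>\<rho>_of T\<close> are at least \<open>K_of T\<close>
  apart; \<open>g_of T\<close> is the potential gap below any site that reaches
  \<open>h_of T\<close>; \<open>s_of T\<close> and \<open>J_of T\<close> are mesh and length of the
  time grid. The mesh satisfies \<open>s_of T * X_of T = D_of T\<close>, and
  \<open>R_of T * \<rho>_of T / h_of T\<close> is at most
  \<open>T powr (-2 * e) * D_of T\<close>.\<close>

definition R_of :: "real \<Rightarrow> nat" where "R_of T = nat \<lfloor>T powr (1 + q + e)\<rfloor>"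
definition h_of :: "real \<Rightarrow> real" where "h_of T = T powr (q - 2 * e)"
definition X_of :: "real \<Rightarrow> real" where "X_of T = T powr (q + 2 * e)"
definition D_of :: "real \<Rightarrow> real" where "D_of T = T powr (1 + q - w * e)"
definition \<rho>_of :: "real \<Rightarrow> real" where "\<rho>_of T = T powr (q - (w + 5) * e)"
definition K_of :: "real \<Rightarrow> real" where "K_of T = T powr ((w + 4) * e)"
definition g_of :: "real \<Rightarrow> real" where "g_of T = T powr e"
definition s_of :: "real \<Rightarrow> real" where "s_of T = T powr (1 - (w + 2) * e)"
definition J_of :: "real \<Rightarrow> nat" where "J_of T = nat \<lceil>T powr ((w + 2) * e)\<rceil>"
text \<open>Potentials of size \<open>L_of T\<close> first appear at distance about
  \<open>T powr (1 + q - e - e / q)\<close>. Subtracting only half of \<open>e / q\<close> makes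
  such a site likely within \<open>r_of T\<close>, while the travel cost
  \<open>r_of T * ln (X_of T)\<close> stays below \<open>T * L_of T\<close>.\<close>

definition r_of :: "real \<Rightarrow> real" where "r_of T = T powr (1 + q - e - e / (2 * q))"
definition L_of :: "real \<Rightarrow> real" where "L_of T = T powr (q - e)"

lemma d_ge_1: "1 \<le> d" by (simp add: d_def Suc_le_eq)

text \<open>By \<alpha> q = d (1 + q) the leading parts are - \<alpha> q for close pairs, - q for
  ties and 0 for triples, where the corrections leave exactly - 2 e; the low exponent is e (\<alpha>
  - d) / 2.\<close>

lemma exponents:
  shows q_pos: "0 < q" and e_pos: "0 < e" and \<alpha>_q: "\<alpha> * q = d * (1 + q)"
    and we: "0 < w" "(w + 6) * e * 20 \<le> q"
    and close_pair_exponent_neg: "d * (1 + q + e) + d * ((w + 4) * e) - 2 * \<alpha> * (q - (w + 5) * e) < 0"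
    and tie_exponent_neg: "2 * d * (1 + q + e) - (\<alpha> + 1) * (q - 2 * e) + e - \<alpha> * (q - 2 * e) < 0"
    and triple_exponent_neg: "(w + 2) * e + 3 * d * (1 + q + e) - 2 * (\<alpha> + 1) * (q - 2 * e) + 2 * (q - w * e) - \<alpha> * (q - 2 * e) < 0"
    and low_exponent_pos: "0 < d * (1 + q - e - e / (2 * q)) - \<alpha> * (q - e)"
proof -
  have d1: "1 \<le> d" by (rule d_ge_1)
  have \<alpha>d: "d < \<alpha>" using \<alpha>_gt by (simp add: d_def)
  show q: "0 < q" using d1 \<alpha>d by (simp add: q_def)
  show w: "0 < w" using d1 \<alpha>d by (simp add: w_def)
  have P: "0 < (d + 2 * \<alpha> + 4) * (w + 6)" using d1 \<alpha>d w by simp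
  have "0 < 4 * (d + 2 * \<alpha> + 4) * (w + 6)" using d1 \<alpha>d w by (intro mult_pos_pos) auto
  then show e: "0 < e" unfolding e_def using q by (intro divide_pos_pos)
  show \<alpha>q: "\<alpha> * q = d * (1 + q)" using \<alpha>d by (simp add: q_def field_simps)
  \<comment> \<open>The origin of the formula for \<open>e\<close>: the corrections to the leading
    parts for close pairs and ties are bounded through
    \<open>(d + 2 * \<alpha> + 4) * (w + 6) * e\<close>, which this choice makes equal to
    \<open>q / 4\<close>.\<close>
  have main: "4 * ((d + 2 * \<alpha> + 4) * ((w + 6) * e)) = q" unfolding e_def using P by (simp add: field_simps)
  have we: "0 < (w + 6) * e" using w e by simp
  have "5 * ((w + 6) * e) \<le> (d + 2 * \<alpha> + 4) * ((w + 6) * e)"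
    using we d1 \<alpha>d by (intro mult_right_mono) auto
  with main show "(w + 6) * e * 20 \<le> q" by simp
  have "(d + 2 * \<alpha>) * ((w + 5) * e) \<le> (d + 2 * \<alpha> + 4) * ((w + 6) * e)"
    using e w d1 \<alpha>d by (intro mult_mono) auto
  then have "4 * ((d + 2 * \<alpha>) * ((w + 5) * e)) \<le> q" using main by simp
  moreover have "d * (1 + q + e) + d * ((w + 4) * e) - 2 * \<alpha> * (q - (w + 5) * e) =
      d + d * q - 2 * (\<alpha> * q) + (d + 2 * \<alpha>) * ((w + 5) * e)" by (simp add: algebra_simps)
  moreover have "q \<le> d * q" using d1 q by simp
  moreover have \<alpha>q': "\<alpha> * q = d + d * q" using \<alpha>q by (simp add: algebra_simps)
  ultimately show "d * (1 + q + e) + d * ((w + 4) * e) - 2 * \<alpha> * (q - (w + 5) * e) < 0"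
    using d1 q by linarith
  have "(d + 2 * \<alpha> + 4) * (6 * e) \<le> (d + 2 * \<alpha> + 4) * ((w + 6) * e)"
    using e w d1 \<alpha>d by (intro mult_left_mono mult_right_mono) auto
  then have "24 * ((d + 2 * \<alpha> + 4) * e) \<le> q" using main by simp
  moreover have "(2 * d + 4 * \<alpha> + 3) * e \<le> 24 * ((d + 2 * \<alpha> + 4) * e) - e"
  proof -
    have "(2 * d + 4 * \<alpha> + 4) * e \<le> (24 * (d + 2 * \<alpha> + 4)) * e"
      using e d1 \<alpha>d by (intro mult_right_mono) auto
    then show ?thesis by (simp add: algebra_simps)
  qed
  moreover have "2 * d * (1 + q + e) - (\<alpha> + 1) * (q - 2 * e) + e - \<alpha> * (q - 2 * e) =
     2 * (d + d * q) - 2 * (\<alpha> * q) - q + (2 * d + 4 * \<alpha> + 3) * e" by (simp add: algebra_simps)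
  ultimately show "2 * d * (1 + q + e) - (\<alpha> + 1) * (q - 2 * e) + e - \<alpha> * (q - 2 * e) < 0"
    unfolding \<alpha>q using e by (simp add: algebra_simps)
  have "(w + 2) * e + 3 * d * (1 + q + e) - 2 * (\<alpha> + 1) * (q - 2 * e) + 2 * (q - w * e) - \<alpha> * (q - 2 * e) =
     3 * (d + d * q) - 3 * (\<alpha> * q) - 2 * e"
    by (simp add: w_def algebra_simps)
  then show "(w + 2) * e + 3 * d * (1 + q + e) - 2 * (\<alpha> + 1) * (q - 2 * e) + 2 * (q - w * e) - \<alpha> * (q - 2 * e) < 0"
    unfolding \<alpha>q using e by (simp add: algebra_simps)
  have "d / (2 * q) = (\<alpha> - d) / 2" using d1 \<alpha>d by (simp add: q_def)
  then have "d * (e / (2 * q)) = e * ((\<alpha> - d) / 2)" by (metis mult.commute times_divide_eq_right)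
  then have "d * (1 + q - e - e / (2 * q)) - \<alpha> * (q - e) = d + d * q - \<alpha> * q + e * ((\<alpha> - d) / 2)"
    by (simp add: field_simps)
  moreover have "0 < e * ((\<alpha> - d) / 2)" using e \<alpha>d by simp
  ultimately show "0 < d * (1 + q - e - e / (2 * q)) - \<alpha> * (q - e)"
    using \<alpha>q' by linarith
qed

lemma exponents_small: "0 < w * e" "20 * (w * e) + 120 * e \<le> q"
  using we e_pos by (simp_all add: algebra_simps)

lemma card_R:
  assumes "1 \<le> T"
  shows "real (card (lball (R_of T) :: (int ^ 'd) set)) \<le> 3 ^ CARD('d) * T powr (d * (1 + q + e))"
proof -
  have "1 \<le> T powr (1 + q + e)" using assms q_pos e_pos by (intro ge_one_powr_ge_zero) auto
  from card_lball_le[OF this, where 'd = 'd] show ?thesis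
    by (simp add: R_of_def powr_powr d_def mult.commute)
qed

section \<open>The bad events and their probabilities\<close>

definition max_event :: "real \<Rightarrow> 'w set" where
  "max_event T = {\<omega> \<in> space M. \<exists>x\<in>lball (R_of T). X_of T \<le> \<xi> x \<omega>}"

text \<open>Dividing by \<open>d\<close> puts the cube inside the ball of radius
  \<open>r_of T\<close>, while its exact cardinality keeps the probability explicit.\<close>

definition low_event :: "real \<Rightarrow> 'w set" where
  "low_event T = {\<omega> \<in> space M. \<forall>x\<in>cube (nat \<lfloor>r_of T / d\<rfloor>). \<xi> x \<omega> < L_of T}"

definition bad_event :: "real \<Rightarrow> 'w set" where
  "bad_event T = max_event T \<union> low_event T \<union> close_pair_event (R_of T) (nat \<lfloor>K_of T\<rfloor>) (\<rho>_of T)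
     \<union> tie_event (R_of T) (h_of T) (g_of T)
     \<union> triple_grid_event (R_of T) T (h_of T) (s_of T) (J_of T) (D_of T + 2 * s_of T * X_of T)"

lemma max_event_sets [measurable]: "max_event T \<in> events"
  unfolding max_event_def by (intro sets.sets_Collect_finite_Ex finite_lball) measurable

lemma low_event_sets [measurable]: "low_event T \<in> events"
  unfolding low_event_def by (intro sets.sets_Collect_finite_All finite_cube) measurable

lemma prob_max_event:
  assumes T: "1 \<le> T"
  shows "prob (max_event T) \<le> 3 ^ CARD('d) * T powr (d * e - 2 * \<alpha> * e)"
proof -
  have "1 \<le> X_of T" unfolding X_of_def using T q_pos e_pos by (intro ge_one_powr_ge_zero) auto
  then have "prob (max_event T) \<le> real (card (lball (R_of T) :: (int ^ 'd) set)) * X_of T powr (-\<alpha>)"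
    unfolding max_event_def by (rule prob_max_ge_le)
  also have "\<dots> \<le> (3 ^ CARD('d) * T powr (d * (1 + q + e))) * X_of T powr (-\<alpha>)"
    by (intro mult_right_mono card_R T) auto
  also have "X_of T powr (-\<alpha>) = T powr (- (\<alpha> * q + 2 * \<alpha> * e))"
    unfolding X_of_def powr_powr by (simp add: algebra_simps)
  also have "3 ^ CARD('d) * T powr (d * (1 + q + e)) * T powr (- (\<alpha> * q + 2 * \<alpha> * e)) =
      3 ^ CARD('d) * T powr (d * (1 + q + e) + - (\<alpha> * q + 2 * \<alpha> * e))"
    by (simp only: powr_add mult.assoc)
  also have "d * (1 + q + e) + - (\<alpha> * q + 2 * \<alpha> * e) = d * e - 2 * \<alpha> * e"
    unfolding \<alpha>_q by (simp add: algebra_simps)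
  finally show ?thesis .
qed

lemma prob_low_event:
  assumes T: "1 \<le> T"
  shows "prob (low_event T) \<le> d powr d * T powr (- (d * (1 + q - e - e / (2 * q)) - \<alpha> * (q - e)))"
proof -
  define p where "p = d * (1 + q - e - e / (2 * q)) - \<alpha> * (q - e)"
  define n where "n = nat \<lfloor>r_of T / d\<rfloor>"
  have eq: "e \<le> q" using exponents_small e_pos by (simp add: algebra_simps)
  have L: "1 \<le> L_of T" unfolding L_of_def using T eq by (intro ge_one_powr_ge_zero) auto
  have r0: "0 < r_of T" using T by (simp add: r_of_def)
  have "(r_of T / d) powr d \<le> (2 * real n + 1) powr d"
  proof (rule powr_mono2)
    have "0 \<le> r_of T / d" using r0 d_ge_1 by simp
    then show "r_of T / d \<le> 2 * real n + 1" unfolding n_def by linarith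
  qed (use r0 d_ge_1 in auto)
  also have "\<dots> = real (card (cube n :: (int ^ 'd) set))"
    unfolding card_cube d_def by (simp add: powr_realpow add.commute)
  finally have card: "(r_of T / d) powr d \<le> real (card (cube n :: (int ^ 'd) set))" .
  have "prob (low_event T) \<le> exp (- real (card (cube n :: (int ^ 'd) set)) * L_of T powr (-\<alpha>))"
    unfolding low_event_def n_def[symmetric]
    by (rule prob_all_less_le[OF L finite_cube]) (auto simp: cube_def intro!: exI[of _ 0])
  also have "\<dots> \<le> exp (- ((r_of T / d) powr d * L_of T powr (-\<alpha>)))"
    using card by (simp add: mult_right_mono)
  also have "(r_of T / d) powr d * L_of T powr (-\<alpha>) = T powr p / d powr d"
  proof -
    have "r_of T powr d = T powr (d * (1 + q - e - e / (2 * q)))"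
      unfolding r_of_def powr_powr by (simp add: mult.commute)
    moreover have "L_of T powr (-\<alpha>) = T powr (- (\<alpha> * (q - e)))"
      unfolding L_of_def powr_powr by (simp add: mult.commute)
    moreover have "T powr p = T powr (d * (1 + q - e - e / (2 * q))) * T powr (- (\<alpha> * (q - e)))"
      unfolding p_def by (simp flip: powr_add)
    ultimately show ?thesis by (simp add: powr_divide)
  qed
  \<comment> \<open>The stretched exponential is weakened to a negative power, which is enough along
    dyadic scales.\<close>
  also have "exp (- (T powr p / d powr d)) \<le> 1 / (T powr p / d powr d)"
  proof -
    define y where "y = T powr p / d powr d"
    have y: "0 < y" using T d_ge_1 by (simp add: y_def)
    have "y \<le> exp y" using exp_ge_add_one_self[of y] by linarith
    then have "exp (- y) \<le> 1 / y" using y by (simp add: exp_minus field_simps)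
    then show ?thesis by (simp add: y_def)
  qed
  also have "\<dots> = d powr d * T powr (- p)" by (simp add: powr_minus divide_simps)
  finally show ?thesis by (simp add: p_def)
qed

lemma prob_close_pair:
  assumes T: "1 \<le> T"
  shows "prob (close_pair_event (R_of T) (nat \<lfloor>K_of T\<rfloor>) (\<rho>_of T)) \<le> 
    9 ^ CARD('d) * T powr (d * (1 + q + e) + d * ((w + 4) * e) - 2 * \<alpha> * (q - (w + 5) * e))"
proof -
  have "0 \<le> q - (w + 5) * e" using exponents_small e_pos by (simp add: algebra_simps)
  then have \<rho>: "1 \<le> \<rho>_of T" unfolding \<rho>_of_def using T by (intro ge_one_powr_ge_zero) auto
  have K: "1 \<le> K_of T" unfolding K_of_def using T we e_pos by (intro ge_one_powr_ge_zero) auto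
  have "prob (close_pair_event (R_of T) (nat \<lfloor>K_of T\<rfloor>) (\<rho>_of T)) \<le> 
    real (card (lball (R_of T) :: (int ^ 'd) set)) * real (card (lball (nat \<lfloor>K_of T\<rfloor>) :: (int ^ 'd) set)) * \<rho>_of T powr (-2 * \<alpha>)"
    by (rule prob_close_pair_event_le[OF \<rho>])
  also have "\<dots> \<le> (3 ^ CARD('d) * T powr (d * (1 + q + e))) * (3 ^ CARD('d) * K_of T powr real CARD('d)) * \<rho>_of T powr (-2 * \<alpha>)"
    using card_R[OF T] card_lball_le[OF K, where 'd = 'd] by (intro mult_right_mono mult_mono) auto
  also have "K_of T powr real CARD('d) = T powr (d * ((w + 4) * e))"
    unfolding K_of_def powr_powr d_def by (simp add: mult.commute)
  also have "\<rho>_of T powr (-2 * \<alpha>) = T powr (- 2 * \<alpha> * (q - (w + 5) * e))"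
    unfolding \<rho>_of_def powr_powr by (simp add: mult.commute)
  also have "3 ^ CARD('d) * T powr (d * (1 + q + e)) * (3 ^ CARD('d) * T powr (d * ((w + 4) * e))) * T powr (- 2 * \<alpha> * (q - (w + 5) * e))
     = (3 ^ CARD('d) * 3 ^ CARD('d)) * T powr (d * (1 + q + e) + d * ((w + 4) * e) + - 2 * \<alpha> * (q - (w + 5) * e))"
    by (simp only: powr_add mult_ac)
  also have "(3::real) ^ CARD('d) * 3 ^ CARD('d) = 9 ^ CARD('d)" by (simp flip: power_mult_distrib)
  finally show ?thesis by simp
qed

lemma prob_tie:
  assumes T: "1 \<le> T" and h: "2 \<le> h_of T" "2 * g_of T \<le> h_of T"
  shows "prob (tie_event (R_of T) (h_of T) (g_of T)) \<le> 
    9 ^ CARD('d) * \<alpha> * 2 powr (\<alpha> + 2) * T powr (2 * d * (1 + q + e) - (\<alpha> + 1) * (q - 2 * e) + e - \<alpha> * (q - 2 * e))"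
proof -
  have g: "0 < g_of T" using T by (simp add: g_of_def)
  have "prob (tie_event (R_of T) (h_of T) (g_of T)) \<le> 
    (real (card (lball (R_of T) :: (int ^ 'd) set)))\<^sup>2 * (\<alpha> * (h_of T / 2) powr (-\<alpha> - 1) * (2 * g_of T) * h_of T powr (-\<alpha>))"
    by (rule prob_tie_event_le[OF h(1) g h(2)])
  also have "\<dots> \<le> (3 ^ CARD('d) * T powr (d * (1 + q + e)))\<^sup>2 * (\<alpha> * (h_of T / 2) powr (-\<alpha> - 1) * (2 * g_of T) * h_of T powr (-\<alpha>))"
    using card_R[OF T] \<alpha>_pos g by (intro mult_right_mono power_mono) auto
  also have "(h_of T / 2) powr (-\<alpha> - 1) = 2 powr (\<alpha> + 1) * T powr ((q - 2 * e) * (-\<alpha> - 1))"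
  proof -
    have "(h_of T / 2) powr (-\<alpha> - 1) = h_of T powr (-\<alpha> - 1) / 2 powr (-\<alpha> - 1)"
      by (rule powr_divide)
    also have "h_of T powr (-\<alpha> - 1) = T powr ((q - 2 * e) * (-\<alpha> - 1))" unfolding h_of_def powr_powr ..
    also have "T powr ((q - 2 * e) * (-\<alpha> - 1)) / 2 powr (-\<alpha> - 1) = 2 powr - (-\<alpha> - 1) * T powr ((q - 2 * e) * (-\<alpha> - 1))"
      by (subst powr_minus) (simp add: divide_inverse mult.commute)
    finally show ?thesis by (simp add: add.commute)
  qed
  also have "(3 ^ CARD('d) * T powr (d * (1 + q + e)))\<^sup>2 = 9 ^ CARD('d) * T powr (2 * d * (1 + q + e))"
  proof -
    have "(T powr (d * (1 + q + e)))\<^sup>2 = T powr (2 * d * (1 + q + e))"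
      using T by (simp add: powr_powr mult_ac flip: powr_realpow)
    moreover have "((3::real) ^ CARD('d))\<^sup>2 = 9 ^ CARD('d)"
      by (simp add: power_mult[symmetric] mult.commute[of _ 2] power_mult)
    ultimately show ?thesis by (simp add: power_mult_distrib)
  qed
  also have "9 ^ CARD('d) * T powr (2 * d * (1 + q + e)) * (\<alpha> * (2 powr (\<alpha> + 1) * T powr ((q - 2 * e) * (-\<alpha> - 1))) * (2 * g_of T) * h_of T powr (-\<alpha>))
     = 9 ^ CARD('d) * \<alpha> * (2 powr (\<alpha> + 1) * 2) * T powr (2 * d * (1 + q + e) + (q - 2 * e) * (-\<alpha> - 1) + e + (q - 2 * e) * (-\<alpha>))"
    unfolding g_of_def h_of_def powr_powr by (simp only: powr_add mult_ac)
  also have "2 powr (\<alpha> + 1) * 2 = 2 powr (\<alpha> + 2)" by (simp add: powr_add)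
  also have "2 * d * (1 + q + e) + (q - 2 * e) * (-\<alpha> - 1) + e + (q - 2 * e) * (-\<alpha>) =
     2 * d * (1 + q + e) - (\<alpha> + 1) * (q - 2 * e) + e - \<alpha> * (q - 2 * e)" by (simp add: algebra_simps)
  finally show ?thesis .
qed

lemma s_X: "s_of T * X_of T = D_of T"
  unfolding s_of_def X_of_def D_of_def by (simp add: algebra_simps flip: powr_add)

lemma prob_triple_grid:
  assumes T: "1 \<le> T"
  shows "prob (triple_grid_event (R_of T) T (h_of T) (s_of T) (J_of T) (D_of T + 2 * s_of T * X_of T)) \<le>
    3 * 27 ^ CARD('d) * (36 * \<alpha>)\<^sup>2 * T powr ((w + 2) * e + 3 * d * (1 + q + e) - 2 * (\<alpha> + 1) * (q - 2 * e) + 2 * (q - w * e) - \<alpha> * (q - 2 * e))"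
proof -
  have "0 \<le> q - 2 * e" using exponents_small e_pos by (simp add: algebra_simps)
  then have h: "1 \<le> h_of T" unfolding h_of_def using T by (intro ge_one_powr_ge_zero) auto
  have D: "0 < D_of T" using T by (simp add: D_of_def)
  have s: "0 \<le> s_of T" by (simp add: s_of_def)
  have T0: "0 < T" using T by simp
  have \<Delta>: "D_of T + 2 * s_of T * X_of T = 3 * D_of T" using s_X[of T] by simp
  have J: "real (Suc (J_of T)) \<le> 3 * T powr ((w + 2) * e)"
  proof -
    have "1 \<le> T powr ((w + 2) * e)" using T we e_pos by (intro ge_one_powr_ge_zero) auto
    then show ?thesis unfolding J_of_def by linarith
  qed
  let ?p = "(\<alpha> * h_of T powr (-\<alpha> - 1) * (12 * (3 * D_of T) / T))\<^sup>2 * h_of T powr (-\<alpha>)"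
  have "prob (triple_grid_event (R_of T) T (h_of T) (s_of T) (J_of T) (3 * D_of T)) \<le>
     real (Suc (J_of T)) * real (card (lball (R_of T) :: (int ^ 'd) set)) ^ 3 * ?p"
    using D by (intro prob_triple_grid_event_le h T0 s) auto
  also have "\<dots> \<le> 3 * T powr ((w + 2) * e) * (3 ^ CARD('d) * T powr (d * (1 + q + e))) ^ 3 * ?p"
    using card_R[OF T] by (intro mult_right_mono mult_mono power_mono J) auto
  also have "(3 ^ CARD('d) * T powr (d * (1 + q + e))) ^ 3 = 27 ^ CARD('d) * T powr (3 * d * (1 + q + e))"
  proof -
    have "(T powr (d * (1 + q + e))) ^ 3 = T powr (3 * d * (1 + q + e))"
      using T by (simp add: powr_powr mult_ac flip: powr_realpow)
    moreover have "((3::real) ^ CARD('d)) ^ 3 = 27 ^ CARD('d)"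
      by (simp add: power_mult[symmetric] mult.commute[of _ 3] power_mult)
    ultimately show ?thesis by (simp add: power_mult_distrib)
  qed
  also have "\<alpha> * h_of T powr (-\<alpha> - 1) * (12 * (3 * D_of T) / T) = 36 * \<alpha> * T powr ((q - 2 * e) * (-\<alpha> - 1) + (q - w * e))"
  proof -
    have "D_of T / T = T powr (q - w * e)" using T by (simp add: D_of_def powr_diff powr_add)
    then have "12 * (3 * D_of T) / T = 36 * T powr (q - w * e)" by simp
    moreover have "h_of T powr (-\<alpha> - 1) = T powr ((q - 2 * e) * (-\<alpha> - 1))"
      unfolding h_of_def powr_powr ..
    ultimately show ?thesis by (simp only: powr_add mult_ac)
  qed
  also have "(36 * \<alpha> * T powr ((q - 2 * e) * (-\<alpha> - 1) + (q - w * e)))\<^sup>2 = (36 * \<alpha>)\<^sup>2 * T powr (2 * ((q - 2 * e) * (-\<alpha> - 1) + (q - w * e)))"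
    using T by (simp add: power_mult_distrib powr_powr mult.commute[of _ 2] flip: powr_realpow)
  also have "3 * T powr ((w + 2) * e) * (27 ^ CARD('d) * T powr (3 * d * (1 + q + e))) *
     ((36 * \<alpha>)\<^sup>2 * T powr (2 * ((q - 2 * e) * (-\<alpha> - 1) + (q - w * e))) * h_of T powr (-\<alpha>)) =
     3 * 27 ^ CARD('d) * (36 * \<alpha>)\<^sup>2 * T powr ((w + 2) * e + 3 * d * (1 + q + e) + 2 * ((q - 2 * e) * (-\<alpha> - 1) + (q - w * e)) + (q - 2 * e) * (-\<alpha>))"
    unfolding h_of_def powr_powr by (simp only: powr_add mult_ac)
  also have "(w + 2) * e + 3 * d * (1 + q + e) + 2 * ((q - 2 * e) * (-\<alpha> - 1) + (q - w * e)) + (q - 2 * e) * (-\<alpha>) =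
     (w + 2) * e + 3 * d * (1 + q + e) - 2 * (\<alpha> + 1) * (q - 2 * e) + 2 * (q - w * e) - \<alpha> * (q - 2 * e)"
    by (simp add: algebra_simps)
  finally show ?thesis unfolding \<Delta> .
qed

lemma AE_not_bad: "AE \<omega> in M. \<forall>\<^sub>F k in sequentially. \<omega> \<notin> bad_event (2 ^ k)"
proof -
  have one: "1 \<le> (2 ^ k :: real)" for k :: nat by simp
  have "AE \<omega> in M. \<forall>\<^sub>F k in sequentially. \<omega> \<notin> max_event (2 ^ k)"
    using \<alpha>_gt e_pos by (intro borel_cantelli_dyadic[OF _ _ prob_max_event[OF one]]) (auto simp: d_def)
  moreover have "AE \<omega> in M. \<forall>\<^sub>F k in sequentially. \<omega> \<notin> low_event (2 ^ k)"
    using low_exponent_pos by (intro borel_cantelli_dyadic[OF _ _ prob_low_event[OF one]]) auto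
  moreover have "AE \<omega> in M. \<forall>\<^sub>F k in sequentially. \<omega> \<notin> close_pair_event (R_of (2 ^ k)) (nat \<lfloor>K_of (2 ^ k)\<rfloor>) (\<rho>_of (2 ^ k))"
    using close_pair_exponent_neg by (intro borel_cantelli_dyadic[OF _ _ prob_close_pair[OF one]]) auto
  moreover have "AE \<omega> in M. \<forall>\<^sub>F k in sequentially. \<omega> \<notin> triple_grid_event (R_of (2 ^ k)) (2 ^ k) (h_of (2 ^ k)) (s_of (2 ^ k)) (J_of (2 ^ k)) (D_of (2 ^ k) + 2 * s_of (2 ^ k) * X_of (2 ^ k))"
    using triple_exponent_neg by (intro borel_cantelli_dyadic[OF _ _ prob_triple_grid[OF one]]) auto
  moreover have "AE \<omega> in M. \<forall>\<^sub>F k in sequentially. \<omega> \<notin> tie_event (R_of (2 ^ k)) (h_of (2 ^ k)) (g_of (2 ^ k))"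
  proof -
    have e3: "0 < q - 2 * e" "e < q - 2 * e" using exponents_small e_pos by (simp_all add: algebra_simps)
    have "\<forall>\<^sub>F T in at_top. 2 \<le> T powr (q - 2 * e)" "\<forall>\<^sub>F T in at_top. 2 * T powr e \<le> T powr (q - 2 * e)"
      using e3 e_pos by real_asymp+
    then have "\<forall>\<^sub>F T in at_top. 2 \<le> h_of T \<and> 2 * g_of T \<le> h_of T"
      unfolding h_of_def g_of_def by eventually_elim simp
    moreover have "filterlim (\<lambda>k. 2 ^ k :: real) at_top sequentially" by real_asymp
    ultimately have "\<forall>\<^sub>F k in sequentially. 2 \<le> h_of (2 ^ k) \<and> 2 * g_of (2 ^ k) \<le> h_of (2 ^ k)"
      by (rule eventually_compose_filterlim)
    then obtain k0 where k0: "\<And>k. k0 \<le> k \<Longrightarrow> 2 \<le> h_of (2 ^ k) \<and> 2 * g_of (2 ^ k) \<le> h_of (2 ^ k)"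
      by (auto simp: eventually_sequentially)
    \<comment> \<open>The bound for ties is valid only at large scales; the finitely many earlier
      events are replaced by the empty set.\<close>
    define A where "A k = (if k0 \<le> k then tie_event (R_of (2 ^ k)) (h_of (2 ^ k)) (g_of (2 ^ k)) else {})" for k
    have "AE \<omega> in M. \<forall>\<^sub>F k in sequentially. \<omega> \<notin> A k"
    proof (rule borel_cantelli_dyadic[OF _ tie_exponent_neg])
      show "prob (A k) \<le> 9 ^ CARD('d) * \<alpha> * 2 powr (\<alpha> + 2) * (2 ^ k) powr (2 * d * (1 + q + e) - (\<alpha> + 1) * (q - 2 * e) + e - \<alpha> * (q - 2 * e))" for k
        using prob_tie[OF one] k0[of k] \<alpha>_pos by (auto simp: A_def)
    qed (auto simp: A_def)
    then show ?thesis
    proof (rule AE_mp, intro AE_I2 impI)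
      fix \<omega> assume "\<forall>\<^sub>F k in sequentially. \<omega> \<notin> A k"
      with eventually_ge_at_top[of k0] show "\<forall>\<^sub>F k in sequentially. \<omega> \<notin> tie_event (R_of (2 ^ k)) (h_of (2 ^ k)) (g_of (2 ^ k))"
        by eventually_elim (simp add: A_def)
    qed
  qed
  ultimately show ?thesis
  proof eventually_elim
    case (elim \<omega>)
    from elim(1-5) show ?case
      by eventually_elim (simp add: bad_event_def)
  qed
qed

end

section \<open>The two cities\<close>

text \<open>Among the maximisers the one with the least index in the enumeration of the countable
  type is taken: \<open>LEAST\<close> over measurable predicates is measurable, whereas an arbitrary
  choice need not be.\<close>

lemma measurable_argmax_selection:
  fixes f :: "'b :: countable \<Rightarrow> 'w \<Rightarrow> real"
  assumes B: "finite B" and f: "\<And>y. f y \<in> borel_measurable M"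
    and P: "\<And>y. Measurable.pred M (P y)"
    and ne: "\<And>\<omega>. \<omega> \<in> space M \<Longrightarrow> \<exists>y\<in>B. P y \<omega>"
  obtains Z where "Z \<in> measurable M (count_space UNIV)"
    and "\<And>\<omega>. \<omega> \<in> space M \<Longrightarrow> Z \<omega> \<in> B \<and> P (Z \<omega>) \<omega>"
    and "\<And>\<omega> y. \<omega> \<in> space M \<Longrightarrow> y \<in> B \<Longrightarrow> P y \<omega> \<Longrightarrow> f y \<omega> \<le> f (Z \<omega>) \<omega>"
proof -
  define G where "G n \<omega> \<longleftrightarrow> from_nat n \<in> B \<and> P (from_nat n) \<omega> \<and> (\<forall>y\<in>B. P y \<omega> \<longrightarrow> f y \<omega> \<le> f (from_nat n) \<omega>)"
    for n \<omega>
  define Z where "Z \<omega> = (from_nat (LEAST n. G n \<omega>) :: 'b)" for \<omega>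
  have "Measurable.pred M (G n)" for n
    unfolding G_def
    by (intro pred_intros_logic pred_intros_finite B P) (use f in measurable)
  then have "(\<lambda>\<omega>. LEAST n. G n \<omega>) \<in> measurable M (count_space UNIV)"
    by (intro measurable_Least)
  then have "Z \<in> measurable M (count_space UNIV)"
    unfolding Z_def by (rule measurable_compose) simp
  moreover have G: "G (LEAST n. G n \<omega>) \<omega>" if \<omega>: "\<omega> \<in> space M" for \<omega>
  proof -
    define A where "A = {y \<in> B. P y \<omega>}"
    have A: "finite A" "A \<noteq> {}" using B ne[OF \<omega>] by (auto simp: A_def)
    then have "Max ((\<lambda>y. f y \<omega>) ` A) \<in> (\<lambda>y. f y \<omega>) ` A" by (intro Max_in) auto
    then obtain z where z: "z \<in> A" "Max ((\<lambda>y. f y \<omega>) ` A) = f z \<omega>" by (rule imageE)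
    have "f y \<omega> \<le> f z \<omega>" if "y \<in> A" for y
      unfolding z(2)[symmetric] using A that by (intro Max_ge) auto
    then have "G (to_nat z) \<omega>" using z(1) by (auto simp: G_def A_def)
    then show ?thesis by (rule LeastI)
  qed
  ultimately show thesis
    by (intro that[of Z]) (auto simp: G_def Z_def)
qed

context pareto_pam
begin

text \<open>The default 0 for inadmissible sites is harmless: outside the bad event, at a scale with
  \<open>scale_ok\<close>, some admissible site of the ball has \<open>Phi\<close> at least
  \<open>P_of T > 0\<close>, so the best site is admissible.\<close>

definition score :: "real \<Rightarrow> real \<Rightarrow> int ^ 'd \<Rightarrow> 'w \<Rightarrow> real" where
  "score T t m \<omega> = (if h_of T \<le> \<xi> m \<omega> \<and> 2 * real (nrm m) \<le> t * \<xi> m \<omega> then Phi t (\<xi> m \<omega>) m else 0)"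

lemma score_measurable [measurable]: "score T t m \<in> borel_measurable M"
  unfolding score_def Phi_def by measurable

lemma R_of_ge_1: "1 \<le> T \<Longrightarrow> 1 \<le> R_of T"
proof -
  assume "1 \<le> T"
  then have "1 \<le> T powr (1 + q + e)" using q_pos e_pos by (intro ge_one_powr_ge_zero) auto
  then show ?thesis unfolding R_of_def by linarith
qed

lemma two_site_selection:
  assumes "1 \<le> T"
  obtains Z1 Z2 where "Z1 \<in> measurable M (count_space UNIV)" "Z2 \<in> measurable M (count_space UNIV)"
    and "\<And>\<omega>. \<omega> \<in> space M \<Longrightarrow> Z1 \<omega> \<in> lball (R_of T) \<and> Z2 \<omega> \<in> lball (R_of T) \<and> Z1 \<omega> \<noteq> Z2 \<omega>"
    and "\<And>\<omega> y. \<omega> \<in> space M \<Longrightarrow> y \<in> lball (R_of T) \<Longrightarrow> score T t y \<omega> \<le> score T t (Z1 \<omega>) \<omega>"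
    and "\<And>\<omega> y. \<omega> \<in> space M \<Longrightarrow> y \<in> lball (R_of T) \<Longrightarrow> y \<noteq> Z1 \<omega> \<Longrightarrow> score T t y \<omega> \<le> score T t (Z2 \<omega>) \<omega>"
proof -
  have two: "0 \<in> lball (R_of T)" "axis i 1 \<in> lball (R_of T)" "axis i 1 \<noteq> (0 :: int ^ 'd)" for i
    using R_of_ge_1[OF assms] by (auto simp: lball_def axis_eq_0_iff)
  obtain Z1 where Z1: "Z1 \<in> measurable M (count_space UNIV)"
    "\<And>\<omega>. \<omega> \<in> space M \<Longrightarrow> Z1 \<omega> \<in> lball (R_of T)"
    "\<And>\<omega> y. \<omega> \<in> space M \<Longrightarrow> y \<in> lball (R_of T) \<Longrightarrow> score T t y \<omega> \<le> score T t (Z1 \<omega>) \<omega>"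
    by (rule measurable_argmax_selection[of "lball (R_of T)" "score T t" M "\<lambda>_ _. True"])
       (use two finite_lball in auto)
  have P: "Measurable.pred M (\<lambda>\<omega>. y \<noteq> Z1 \<omega>)" for y
    using Z1(1) by measurable
  have ne: "\<exists>y\<in>lball (R_of T). y \<noteq> Z1 \<omega>" for \<omega> using two by metis
  obtain Z2 where Z2: "Z2 \<in> measurable M (count_space UNIV)"
    "\<And>\<omega>. \<omega> \<in> space M \<Longrightarrow> Z2 \<omega> \<in> lball (R_of T) \<and> Z2 \<omega> \<noteq> Z1 \<omega>"
    "\<And>\<omega> y. \<omega> \<in> space M \<Longrightarrow> y \<in> lball (R_of T) \<Longrightarrow> y \<noteq> Z1 \<omega> \<Longrightarrow> score T t y \<omega> \<le> score T t (Z2 \<omega>) \<omega>"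
    by (rule measurable_argmax_selection[of "lball (R_of T)" "score T t" M "\<lambda>y \<omega>. y \<noteq> Z1 \<omega>"])
       (use P ne finite_lball in auto)
  show thesis
  proof (rule that[OF Z1(1) Z2(1)])
    fix \<omega> assume "\<omega> \<in> space M"
    from Z1(2)[OF this] Z2(2)[OF this]
    show "Z1 \<omega> \<in> lball (R_of T) \<and> Z2 \<omega> \<in> lball (R_of T) \<and> Z1 \<omega> \<noteq> Z2 \<omega>" by auto
  qed (use Z1 Z2 in auto)
qed

text \<open>The exponent makes \<open>\<eta>_of T * K_of T = T powr e\<close>, so that
  \<open>exp (- \<eta> * K)\<close> beats every power of T, and
  \<open>T powr (1 + q + e) * \<eta>_of T\<close> smaller than \<open>D_of T\<close> by the factor
  \<open>T powr (-2 * e)\<close>.\<close>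

definition \<eta>_of :: "real \<Rightarrow> real" where "\<eta>_of T = T powr (- (w + 3) * e)"
definition N_of :: "real \<Rightarrow> real" where "N_of T = 3 ^ CARD('d) * T powr (d * (1 + q + e))"
definition P_of :: "real \<Rightarrow> real" where "P_of T = T powr (1 + q - e) / 2"
definition E1_of :: "real \<Rightarrow> real" where "E1_of T = 2 * T + 4 * T powr (1 + (q - w * e) - 2 * e)"
definition E2_of :: "real \<Rightarrow> real" where "E2_of T = 4 * d * T + d * (ln (T powr (1 + q + e) + 1) + 1)"
definition c_of :: "real \<Rightarrow> real" where "c_of T = 2 * d / (T powr e - 2 * d)"

definition err_of :: "real \<Rightarrow> real \<Rightarrow> real" where
  "err_of K0 T = 1 + c_of T + (1 + c_of T) * N_of T * (1 + 2 * X_of T * N_of T) * exp (E1_of T + E2_of T - D_of T)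
     + exp (2 * T powr (1 + q - 2 * e) + E2_of T - P_of T) + 2 * K0 * exp (E2_of T - P_of T)"

definition scale_ok :: "real \<Rightarrow> bool" where
  "scale_ok T \<longleftrightarrow> 1 \<le> T \<and> exp 2 * d \<le> h_of T \<and> 2 * \<rho>_of T \<le> h_of T \<and> 40 * d \<le> h_of T * \<eta>_of T \<and>
     32 * d\<^sup>2 \<le> h_of T \<and> 4 * X_of T * N_of T * exp (- (T powr e)) \<le> 1 \<and> 2 * d < g_of T \<and>
     D_of T \<le> P_of T \<and> r_of T * ln (X_of T) \<le> P_of T \<and> 2 * r_of T \<le> T powr (1 + q - e)"

lemma eventually_scale_ok: "\<forall>\<^sub>F T in at_top. scale_ok T"
proof -
  note ex = e_pos q_pos exponents_small d_ge_1
  define b where "b = w * e"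
  have b: "0 < b" "20 * b + 120 * e \<le> q" using exponents_small by (simp_all add: b_def)
  have 1: "\<forall>\<^sub>F T in at_top. 1 \<le> (T :: real)" by (rule eventually_ge_at_top)
  have 2: "\<forall>\<^sub>F T in at_top. exp 2 * d \<le> T powr (q - 2 * e)"
    using ex b by (intro eventually_ge_at_top[THEN eventually_compose_filterlim]) real_asymp
  have 3: "\<forall>\<^sub>F T in at_top. 2 * T powr (q - (b + 5 * e)) \<le> T powr (q - 2 * e)"
    using ex b by real_asymp
  have "0 < q - 2 * e - b - 3 * e" using b e_pos by linarith
  then have 4: "\<forall>\<^sub>F T in at_top. 40 * d \<le> T powr (q - 2 * e - b - 3 * e)"
    by (intro eventually_ge_at_top[THEN eventually_compose_filterlim]) real_asymp
  have 5: "\<forall>\<^sub>F T in at_top. 32 * d\<^sup>2 \<le> T powr (q - 2 * e)"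
    using ex b by (intro eventually_ge_at_top[THEN eventually_compose_filterlim]) real_asymp
  have "0 < d * (1 + q + e)" "0 < q + 2 * e" "(0::real) < 3 ^ CARD('d)" using ex by auto
  then have 6: "\<forall>\<^sub>F T in at_top. 4 * T powr (q + 2 * e) * (3 ^ CARD('d) * T powr (d * (1 + q + e))) * exp (- (T powr e)) \<le> 1"
    using e_pos by real_asymp
  have 7: "\<forall>\<^sub>F T in at_top. 2 * d < T powr e"
    using e_pos by (intro eventually_gt_at_top[THEN eventually_compose_filterlim]) real_asymp
  have eb: "e < b" using e_pos d_ge_1 \<alpha>_pos by (simp add: b_def w_def mult_less_cancel_right1)
  then have 8: "\<forall>\<^sub>F T in at_top. T powr (1 + q - b) \<le> T powr (1 + q - e) / 2"
    by real_asymp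
  have eq: "e < q" using b e_pos by linarith
  have 9: "\<forall>\<^sub>F T in at_top. T powr (1 + q - e - e / (2 * q)) * ln (T powr (q + 2 * e)) \<le> T powr (1 + q - e) / 2"
    using e_pos q_pos eq by real_asymp
  have 10: "\<forall>\<^sub>F T in at_top. 2 * T powr (1 + q - e - e / (2 * q)) \<le> T powr (1 + q - e)"
    using e_pos q_pos by real_asymp
  show ?thesis
    using 1 2 3 4 5 6 7 8 9 10
  proof eventually_elim
    case (elim T)
    have eq1: "q - (w + 5) * e = q - (b + 5 * e)" by (simp add: b_def algebra_simps)
    have eq2: "h_of T * \<eta>_of T = T powr (q - 2 * e - b - 3 * e)"
      unfolding h_of_def \<eta>_of_def by (simp add: b_def algebra_simps flip: powr_add)
    have eq3: "1 + q - w * e = 1 + q - b" by (simp add: b_def)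
    show ?case
      using elim unfolding scale_ok_def eq2 \<rho>_of_def D_of_def eq1 eq3 unfolding h_of_def \<rho>_of_def X_of_def N_of_def g_of_def D_of_def P_of_def r_of_def
      by simp
  qed
qed

text \<open>\<open>D_of T\<close> exceeds both terms of \<open>E1_of T\<close> and the order T of
  \<open>E2_of T\<close> by powers of T, and \<open>P_of T\<close> exceeds
  \<open>2 * T powr (1 + q - 2 * e)\<close> likewise; the exponentials then absorb the polynomial
  prefactors. \<open>c_of T\<close> vanishes because the gap diverges.\<close>

lemma err_of_tendsto:
  assumes "0 \<le> K0" shows "(err_of K0 \<longlongrightarrow> 1) at_top"
proof -
  define b where "b = q - w * e"
  have b: "2 * e < b" "2 * e < q" using exponents_small e_pos by (auto simp: b_def)
  have p: "0 < d * (1 + q + e)" "0 < q + 2 * e" "0 < 1 + q + e" "(0::real) < 3 ^ CARD('d)"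
    using d_ge_1 q_pos e_pos by (auto intro: add_pos_pos)
  have 1: "(c_of \<longlongrightarrow> 0) at_top" unfolding c_of_def using e_pos by real_asymp
  have 2: "((\<lambda>T. (1 + c_of T) * N_of T * (1 + 2 * X_of T * N_of T) * exp (E1_of T + E2_of T - D_of T)) \<longlongrightarrow> 0) at_top"
    unfolding c_of_def N_of_def X_of_def E1_of_def E2_of_def D_of_def add_diff_eq[symmetric] b_def[symmetric]
    using e_pos b(1) p d_ge_1 by real_asymp
  have 3: "((\<lambda>T. exp (2 * T powr (1 + q - 2 * e) + E2_of T - P_of T)) \<longlongrightarrow> 0) at_top"
    unfolding E2_of_def P_of_def using e_pos b(2) p(3) d_ge_1 by real_asymp
  have 4: "((\<lambda>T. 2 * K0 * exp (E2_of T - P_of T)) \<longlongrightarrow> 0) at_top"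
    unfolding E2_of_def P_of_def using e_pos b(2) p(3) d_ge_1 assms by real_asymp
  show ?thesis
    unfolding err_of_def using tendsto_add[OF tendsto_add[OF tendsto_add[OF tendsto_add[OF tendsto_const[of 1] 1] 2] 3] 4]
    by simp
qed

text \<open>Outside the bad event all hypotheses of \<open>two_site_ratio_bounds\<close> hold
  simultaneously for every \<open>t\<close> in the dyadic interval, and the errors are bounded by a
  function of the scale alone.\<close>

lemma good_scale_ratio_bounds:
  assumes sol: "nonneg_pam_solution (\<lambda>z. \<xi> z \<omega>) u" and \<omega>: "\<omega> \<in> space M" "\<omega> \<notin> bad_event T"
    and ok: "scale_ok T" and t: "T \<le> t" "t \<le> 2 * T" and \<xi>: "\<And>x. 1 \<le> \<xi> x \<omega>"
    and growth: "\<And>x. \<xi> x \<omega> \<le> C * (1 + real (nrm x)) powr \<gamma>" and \<gamma>: "0 \<le> \<gamma>" "\<gamma> < 1" and C: "0 \<le> C"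
    and far: "\<And>n. R_of T < n \<Longrightarrow> (C * (1 + real n) powr \<gamma> + 2 * d * exp 2) * (2 * T) \<le> real n"
    and K0: "\<And>F :: (int ^ 'd) set. finite F \<Longrightarrow> (\<Sum>x\<in>F. exp (- real (nrm x) / 2)) \<le> K0"
    and Z: "Z1 \<in> lball (R_of T)" "Z2 \<in> lball (R_of T)" "Z1 \<noteq> Z2"
    and Z1: "\<And>y. y \<in> lball (R_of T) \<Longrightarrow> score T t y \<omega> \<le> score T t Z1 \<omega>"
    and Z2: "\<And>y. y \<in> lball (R_of T) \<Longrightarrow> y \<noteq> Z1 \<Longrightarrow> score T t y \<omega> \<le> score T t Z2 \<omega>"
  shows "0 < u t Z1 + u t Z2" "u t Z1 + u t Z2 \<le> total_mass u t"
    "total_mass u t \<le> (u t Z1 + u t Z2) * err_of K0 T"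
proof -
  define V where "V = (\<lambda>z. \<xi> z \<omega>)"
  define R where "R = R_of T"
  define Q where "Q m \<longleftrightarrow> h_of T \<le> V m \<and> 2 * real (nrm m) \<le> t * V m" for m
  have T: "1 \<le> T" using ok by (simp add: scale_ok_def)
  have t0: "0 < t" using T t by simp
  have h: "exp 2 * d \<le> h_of T" "2 * \<rho>_of T \<le> h_of T" "40 * d \<le> h_of T * \<eta>_of T" "32 * d\<^sup>2 \<le> h_of T"
    using ok by (auto simp: scale_ok_def)
  have h0: "0 < h_of T" using T by (simp add: h_of_def)
  have d1: "1 \<le> d" by (rule d_ge_1)
  have bad: "\<omega> \<notin> max_event T" "\<omega> \<notin> low_event T" "\<omega> \<notin> close_pair_event R (nat \<lfloor>K_of T\<rfloor>) (\<rho>_of T)"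
    "\<omega> \<notin> tie_event R (h_of T) (g_of T)"
    "\<omega> \<notin> triple_grid_event R T (h_of T) (s_of T) (J_of T) (D_of T + 2 * s_of T * X_of T)"
    using \<omega>(2) by (auto simp: bad_event_def R_def)
  have X: "V x < X_of T" if "nrm x \<le> R" for x
  proof -
    have "\<not> X_of T \<le> \<xi> x \<omega>"
      using bad(1) \<omega>(1) that unfolding max_event_def R_def lball_def by blast
    then show ?thesis by (simp add: V_def)
  qed
  have V1: "1 \<le> V x" for x using \<xi> by (simp add: V_def)
  have score: "score T t m \<omega> = (if Q m then Phi t (V m) m else 0)" for m
    by (simp add: score_def Q_def V_def)
  have r0: "0 \<le> r_of T" by (simp add: r_of_def)
  \<comment> \<open>A guaranteed competitor from the complement of \<open>low_event\<close>: close
    enough to be admissible and high enough for \<open>Phi\<close> to reach \<open>P_of T\<close>.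
    This bounds the best score from below.\<close>
  obtain m where m: "real (nrm m) \<le> r_of T" "L_of T \<le> V m"
  proof -
    obtain m where m: "m \<in> cube (nat \<lfloor>r_of T / d\<rfloor>)" "L_of T \<le> V m"
      using bad(2) \<omega>(1) by (auto simp: low_event_def V_def not_less)
    have "m \<in> lball (CARD('d) * nat \<lfloor>r_of T / d\<rfloor>)" using cube_subset_lball m(1) by blast
    then have "nrm m \<le> CARD('d) * nat \<lfloor>r_of T / d\<rfloor>" by (simp add: lball_def)
    then have "real (nrm m) \<le> real (CARD('d) * nat \<lfloor>r_of T / d\<rfloor>)" by (rule of_nat_mono)
    also have "\<dots> = d * real (nat \<lfloor>r_of T / d\<rfloor>)" by (simp add: d_def)
    also have "\<dots> \<le> d * (r_of T / d)"
    proof (rule mult_left_mono)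
      have "0 \<le> r_of T / d" using r0 d1 by simp
      then show "real (nat \<lfloor>r_of T / d\<rfloor>) \<le> r_of T / d" by linarith
    qed (use d1 in simp)
    finally show thesis using that m(2) d1 by simp
  qed
  have rR: "r_of T \<le> T powr (1 + q + e)"
    unfolding r_of_def using T e_pos q_pos by (intro powr_mono) (auto simp: algebra_simps add_nonneg_nonneg)
  have mR: "nrm m \<le> R" unfolding R_def R_of_def using m(1) rR by linarith
  have TL: "T * L_of T = T powr (1 + q - e)" using T by (simp add: L_of_def powr_diff powr_add)
  have tV: "T powr (1 + q - e) \<le> t * V m"
    unfolding TL[symmetric] using T t m V1[of m] by (intro mult_mono) (auto simp: L_of_def)
  have Qm: "Q m"
  proof -
    have "h_of T \<le> L_of T" unfolding h_of_def L_of_def using T e_pos by (intro powr_mono) auto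
    moreover have "2 * real (nrm m) \<le> t * V m" using m tV ok by (auto simp: scale_ok_def)
    ultimately show ?thesis using m by (simp add: Q_def)
  qed
  have Pm: "P_of T \<le> Phi t (V m) m"
  proof -
    have "real (nrm m) * ln (V m) \<le> r_of T * ln (X_of T)"
      using m X[OF mR] V1[of m] r0 by (intro mult_mono) (auto simp: ln_ge_zero)
    also have "\<dots> \<le> P_of T" using ok by (simp add: scale_ok_def)
    finally show ?thesis using tV entr_bounds(1)[of m] by (simp add: Phi_def P_of_def)
  qed
  have P0: "0 < P_of T" using T by (simp add: P_of_def)
  have "score T t m \<omega> \<le> score T t Z1 \<omega>" by (rule Z1) (use mR in \<open>simp add: lball_def R_def\<close>)
  then have QZ1: "Q Z1" "P_of T \<le> Phi t (V Z1) Z1"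
    using Qm Pm P0 unfolding score by (auto split: if_splits)
  have DP: "D_of T \<le> P_of T" using ok by (simp add: scale_ok_def)
  \<comment> \<open>A third site \<open>z\<close> never beats \<open>Z2\<close>. If
    \<open>Z2\<close> is inadmissible, \<open>z\<close> has \<open>Phi\<close> at most 0, which
    suffices by \<open>D_of T <= P_of T\<close>. Otherwise a \<open>z\<close> within
    \<open>D_of T\<close> of \<open>Z1\<close> would put \<open>Z2\<close> there too, and the three
    sites would nearly tie.\<close>
  have others: "Phi t (V z) z \<le> Phi t (V Z1) Z1 - D_of T" if z: "nrm z \<le> R" "Q z" "z \<noteq> Z1" "z \<noteq> Z2" for z
  proof -
    have zR: "z \<in> lball (R_of T)" using z by (simp add: lball_def R_def)
    have z1: "Phi t (V z) z \<le> Phi t (V Z1) Z1" using Z1[OF zR] z(2) QZ1 unfolding score by simp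
    have z2: "Phi t (V z) z \<le> (if Q Z2 then Phi t (V Z2) Z2 else 0)" using Z2[OF zR z(3)] z(2) unfolding score by simp
    show ?thesis
    proof (cases "Q Z2")
      case False
      then show ?thesis using z2 QZ1 DP by simp
    next
      case True
      have z3: "Phi t (V Z2) Z2 \<le> Phi t (V Z1) Z1" using Z1[OF Z(2)] True QZ1 unfolding score by simp
      have "\<not> (\<bar>Phi t (\<xi> Z2 \<omega>) Z2 - Phi t (\<xi> Z1 \<omega>) Z1\<bar> \<le> D_of T \<and> \<bar>Phi t (\<xi> z \<omega>) z - Phi t (\<xi> Z1 \<omega>) Z1\<bar> \<le> D_of T)"
      proof (rule no_triple_tie[OF \<omega>(1) bad(5)])
        show "T \<le> real (J_of T) * s_of T"
        proof -
          have "T powr ((w + 2) * e) \<le> real (J_of T)" unfolding J_of_def by linarith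
          then have "T powr ((w + 2) * e) * s_of T \<le> real (J_of T) * s_of T"
            by (intro mult_right_mono) (auto simp: s_of_def)
          moreover have "T powr ((w + 2) * e) * s_of T = T"
            unfolding s_of_def using T by (simp flip: powr_add)
          ultimately show ?thesis by simp
        qed
        show "\<xi> m \<omega> \<le> X_of T" if "m \<in> lball R" for m using X[of m] that by (simp add: lball_def V_def)
        show "h_of T \<le> \<xi> m \<omega> \<and> 2 * real (nrm m) \<le> t * \<xi> m \<omega>" if "m \<in> {Z1, Z2, z}" for m
          using that QZ1(1) True z(2) by (auto simp: Q_def V_def)
      qed (use T t Z zR z h0 in \<open>auto simp: s_of_def R_def\<close>)
      then show ?thesis using z1 z2 z3 True unfolding V_def by auto
    qed
  qed
  define N where "N = real (card (lball R :: (int ^ 'd) set))"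
  have N: "0 \<le> N" "N \<le> N_of T" using card_R[OF T] by (auto simp: N_def N_of_def R_def)
  have X0: "0 < X_of T" using T by (simp add: X_of_def)
  have N_of0: "0 \<le> N_of T" using N by linarith
  have \<eta>K: "\<eta>_of T * K_of T = T powr e"
    unfolding \<eta>_of_def K_of_def by (simp add: algebra_simps flip: powr_add)
  have \<eta>: "0 < \<eta>_of T" "\<eta>_of T \<le> 1"
  proof -
    show "0 < \<eta>_of T" using T by (simp add: \<eta>_of_def)
    have "T powr (- (w + 3) * e) \<le> T powr 0"
      using T we e_pos by (intro powr_mono) (auto simp: mult_nonpos_nonneg)
    then show "\<eta>_of T \<le> 1" using T by (simp add: \<eta>_of_def)
  qed
  have XN: "4 * X_of T * N * exp (- \<eta>_of T * K_of T) \<le> 1"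
  proof -
    have "4 * X_of T * N * exp (- \<eta>_of T * K_of T) \<le> 4 * X_of T * N_of T * exp (- (T powr e))"
      using N X0 \<eta>K by (intro mult_mono) auto
    also have "\<dots> \<le> 1" using ok by (simp add: scale_ok_def)
    finally show ?thesis .
  qed
  have sep: "K_of T \<le> real (nrm (x - y))"
    if "nrm x \<le> R" "nrm y \<le> R" "x \<noteq> y" "\<rho>_of T < V x" "\<rho>_of T < V y" for x y
  proof (rule ccontr)
    assume "\<not> K_of T \<le> real (nrm (x - y))"
    then have "nrm (y - x) \<le> nat \<lfloor>K_of T\<rfloor>" unfolding nrm_minus_commute[of y x] by linarith
    then have "\<omega> \<in> close_pair_event R (nat \<lfloor>K_of T\<rfloor>) (\<rho>_of T)"
      unfolding close_pair_event_def using that \<omega>(1)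
      by (auto simp: lball_def V_def intro!: bexI[of _ x] bexI[of _ "y - x"])
    with bad(3) show False by simp
  qed
  have gap: "V y \<le> V x - g_of T" if "nrm x \<le> R" "nrm y \<le> R" "x \<noteq> y" "h_of T \<le> V x" "V y \<le> V x" for x y
  proof (rule ccontr)
    assume "\<not> V y \<le> V x - g_of T"
    then have "\<omega> \<in> tie_event R (h_of T) (g_of T)"
      unfolding tie_event_def using that \<omega>(1)
      by (auto simp: lball_def V_def intro!: bexI[of _ x] bexI[of _ y])
    with bad(4) show False by simp
  qed
  have far': "(C * (1 + real n) powr \<gamma> + 2 * real CARD('d) * exp 2) * t \<le> real n" if "R < n" for n
  proof -
    have "(C * (1 + real n) powr \<gamma> + 2 * real CARD('d) * exp 2) * t \<le> (C * (1 + real n) powr \<gamma> + 2 * d * exp 2) * (2 * T)"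
      using t C d1 by (intro mult_mono) (auto simp: d_def)
    also have "\<dots> \<le> real n" using far that by (simp add: R_def)
    finally show ?thesis .
  qed
  have g: "2 * d < g_of T" using ok by (simp add: scale_ok_def)
  have sol': "nonneg_pam_solution V u" using sol by (simp add: V_def)
  have V0: "0 \<le> V x" for x using V1[of x] by simp
  have growth': "V x \<le> C * (1 + real (nrm x)) powr \<gamma>" for x using growth by (simp add: V_def)
  have X': "V x \<le> X_of T" if "nrm x \<le> R" for x using X[OF that] by simp
  have \<rho>0: "0 \<le> \<rho>_of T" by (simp add: \<rho>_of_def)
  have Z1': "nrm Z1 \<le> R" "h_of T \<le> V Z1" "2 * real (nrm Z1) \<le> t * V Z1"
    using Z(1) QZ1(1) by (auto simp: lball_def R_def Q_def)
  have DP': "D_of T \<le> Phi t (V Z1) Z1" using DP QZ1(2) by simp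
  have others': "Phi t (V m) m \<le> Phi t (V Z1) Z1 - D_of T"
    if "nrm m \<le> R" "h_of T \<le> V m" "2 * real (nrm m) \<le> t * V m" "m \<noteq> Z1" "m \<noteq> Z2" for m
    using others[of m] that by (simp add: Q_def)
  let ?c = "2 * d / (g_of T - 2 * d)"
  let ?e1 = "t + real R * (2 * \<eta>_of T + 2 * \<rho>_of T / h_of T)"
  let ?e2 = "2 * d * t + d * (ln (real (Suc R)) + 1)"
  have main: "0 < u t Z1 + u t Z2" "u t Z1 + u t Z2 \<le> total_mass u t"
    "total_mass u t \<le> (u t Z1 + u t Z2) * (1 + ?c + (1 + ?c) * N * (1 + 2 * X_of T * N) * exp (?e1 + ?e2 - D_of T)
        + exp (h_of T * t + ?e2 - P_of T) + 2 * K0 * exp (?e2 - P_of T))"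
    unfolding N_def d_def
    using two_site_ratio_bounds[OF sol' V0 t0 growth' \<gamma> C far' K0 X' h(1)[unfolded d_def] h(2) \<rho>0
          \<eta> h(3,4)[unfolded d_def] XN[unfolded N_def] sep g[unfolded d_def] gap Z(3) Z1' DP' others' QZ1(2)]
    by - (assumption+)
  show "0 < u t Z1 + u t Z2" "u t Z1 + u t Z2 \<le> total_mass u t" by (rule main)+
  have R_le: "real R \<le> T powr (1 + q + e)" unfolding R_def R_of_def by (simp add: of_nat_floor)
  have e1: "?e1 \<le> E1_of T"
  proof -
    have "real R * (2 * \<eta>_of T + 2 * \<rho>_of T / h_of T) \<le> T powr (1 + q + e) * (2 * \<eta>_of T + 2 * \<rho>_of T / h_of T)"
      using \<eta> h0 by (intro mult_right_mono R_le) (auto simp: \<rho>_of_def)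
    also have "\<dots> = 2 * (T powr (1 + q + e) * \<eta>_of T) + 2 * (T powr (1 + q + e) * \<rho>_of T / h_of T)"
      by (simp add: algebra_simps)
    also have "T powr (1 + q + e) * \<eta>_of T = T powr (1 + (q - w * e) - 2 * e)"
      unfolding \<eta>_of_def by (simp add: algebra_simps flip: powr_add)
    also have "T powr (1 + q + e) * \<rho>_of T / h_of T = T powr (1 + (q - w * e) - 2 * e)"
      unfolding \<rho>_of_def h_of_def by (simp add: algebra_simps flip: powr_add powr_diff)
    finally show ?thesis using t by (simp add: E1_of_def)
  qed
  have e2: "?e2 \<le> E2_of T"
  proof -
    have "ln (real (Suc R)) \<le> ln (T powr (1 + q + e) + 1)" using R_le by (intro ln_mono) auto
    then have "d * (ln (real (Suc R)) + 1) \<le> d * (ln (T powr (1 + q + e) + 1) + 1)"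
      using d1 by (intro mult_left_mono) auto
    moreover have "2 * d * t \<le> 2 * d * (2 * T)" using t d1 by (intro mult_left_mono) auto
    ultimately show ?thesis unfolding E2_of_def by linarith
  qed
  have hT: "h_of T * t \<le> 2 * T powr (1 + q - 2 * e)"
  proof -
    have "h_of T * t \<le> h_of T * (2 * T)" using t h0 by (intro mult_left_mono) auto
    also have "h_of T * T = T powr (1 + q - 2 * e)" using T by (simp add: h_of_def powr_diff powr_add)
    then have "h_of T * (2 * T) = 2 * T powr (1 + q - 2 * e)" by simp
    finally show ?thesis .
  qed
  have c: "?c = c_of T" by (simp add: c_of_def g_of_def)
  have c0: "0 \<le> c_of T" using g d1 unfolding c[symmetric] by simp
  have K00: "0 \<le> K0" using K0[of "{}"] by simp
  have "1 + ?c + (1 + ?c) * N * (1 + 2 * X_of T * N) * exp (?e1 + ?e2 - D_of T)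
        + exp (h_of T * t + ?e2 - P_of T) + 2 * K0 * exp (?e2 - P_of T) \<le> err_of K0 T"
    unfolding c err_of_def using e1 e2 hT c0 K00 N X0 N_of0
    by (intro add_mono mult_mono order_refl) auto
  from mult_left_mono[OF this less_imp_le[OF main(1)]] main(3)
  show "total_mass u t \<le> (u t Z1 + u t Z2) * err_of K0 T" by (rule order_trans[rotated])
qed

text \<open>Beyond the ball \<open>T <= n powr \<theta>\<close> with \<theta> = 1 / (1 + q + e), so
  the left side is of order at most \<open>n powr (\<gamma> + \<theta>)\<close>, and \<gamma> +
  \<theta> < 1.\<close>

lemma eventually_far:
  assumes C: "0 \<le> C" and \<gamma>: "\<gamma> = (q + e / 2) / (1 + q + e / 2)"
  shows "\<forall>\<^sub>F T in at_top. \<forall>n. R_of T < n \<longrightarrow> (C * (1 + real n) powr \<gamma> + 2 * d * exp 2) * (2 * T) \<le> real n"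
proof -
  define \<theta> where "\<theta> = 1 / (1 + q + e)"
  have pos: "0 < 1 + q + e / 2" "0 < 1 + q + e" using q_pos e_pos by auto
  have "\<gamma> = 1 - 1 / (1 + q + e / 2)" using pos by (simp add: \<gamma> field_simps)
  moreover have "1 / (1 + q + e) < 1 / (1 + q + e / 2)" using pos e_pos by (intro divide_strict_left_mono) auto
  ultimately have \<gamma>\<theta>: "\<gamma> + \<theta> < 1" by (simp add: \<theta>_def)
  have \<gamma>0: "0 < \<gamma>" "0 < \<theta>" using pos q_pos e_pos by (auto simp: \<gamma> \<theta>_def)
  have dd: "0 < 2 * d * exp 2" using d_ge_1 by simp
  have "\<forall>\<^sub>F n in sequentially. (C * (1 + real n) powr \<gamma> + 2 * d * exp 2) * (2 * real n powr \<theta>) \<le> real n"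
    using \<gamma>0 \<gamma>\<theta> C dd by real_asymp
  then obtain n1 where n1: "\<And>n. n1 \<le> n \<Longrightarrow> (C * (1 + real n) powr \<gamma> + 2 * d * exp 2) * (2 * real n powr \<theta>) \<le> real n"
    by (auto simp: eventually_sequentially)
  have "\<forall>\<^sub>F T in at_top. real n1 \<le> T powr (1 + q + e)"
    using pos by (intro eventually_ge_at_top[THEN eventually_compose_filterlim]) real_asymp
  with eventually_ge_at_top[of 1] show ?thesis
  proof eventually_elim
    case (elim T)
    show ?case
    proof (intro allI impI)
      fix n assume "R_of T < n"
      then have n: "T powr (1 + q + e) \<le> real n" unfolding R_of_def by linarith
      then have "n1 \<le> n" using elim by linarith
      have "T = (T powr (1 + q + e)) powr \<theta>" using pos elim by (simp add: powr_powr \<theta>_def)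
      also have "\<dots> \<le> real n powr \<theta>" using n \<gamma>0 by (intro powr_mono2) auto
      finally have "(C * (1 + real n) powr \<gamma> + 2 * d * exp 2) * (2 * T) \<le> (C * (1 + real n) powr \<gamma> + 2 * d * exp 2) * (2 * real n powr \<theta>)"
        using C dd by (intro mult_left_mono) auto
      also have "\<dots> \<le> real n" by (rule n1[OF \<open>n1 \<le> n\<close>])
      finally show "(C * (1 + real n) powr \<gamma> + 2 * d * exp 2) * (2 * T) \<le> real n" .
    qed
  qed
qed

section \<open>From dyadic scales to all times\<close>

definition k_of :: "real \<Rightarrow> nat" where "k_of t = nat \<lfloor>log 2 t\<rfloor>"

lemma k_of_bounds:
  assumes "1 \<le> t" shows "2 ^ k_of t \<le> t" "t \<le> 2 * 2 ^ k_of t"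
proof -
  define k where "k = \<lfloor>log 2 t\<rfloor>"
  have k0: "0 \<le> k" unfolding k_def using assms by (simp add: zero_le_floor)
  have k: "real_of_int k \<le> log 2 t" "log 2 t \<le> real_of_int k + 1" unfolding k_def by linarith+
  have e: "(2::real) ^ k_of t = 2 powr real_of_int k"
    using k0 by (simp add: k_of_def k_def[symmetric] flip: powr_realpow)
  show "2 ^ k_of t \<le> t" unfolding e using k assms by (simp add: le_log_iff)
  have "t \<le> 2 powr (real_of_int k + 1)" using k assms by (simp add: log_le_iff)
  then show "t \<le> 2 * 2 ^ k_of t" unfolding e by (simp add: powr_add)
qed

text \<open>The two sites are functions of \<xi> alone, selected by \<open>score\<close> at every
  sample point; the solution enters only in the almost sure limit, where the ratio is squeezed
  between the reciprocal of \<open>err_of\<close> and 1.\<close>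

theorem two_cities:
  assumes u: "AE \<omega> in M. nonneg_pam_solution (\<lambda>z. \<xi> z \<omega>) (u \<omega>)"
  shows "\<exists>Z1 Z2 :: real \<Rightarrow> 'w \<Rightarrow> int ^ 'd.
           (\<forall>t>0. Z1 t \<in> measurable M (count_space UNIV)) \<and>
           (\<forall>t>0. Z2 t \<in> measurable M (count_space UNIV)) \<and>
           (\<forall>t>0. \<forall>\<omega>\<in>space M. Z1 t \<omega> \<noteq> Z2 t \<omega>) \<and>
           (AE \<omega> in M. ((\<lambda>t. (u \<omega> t (Z1 t \<omega>) + u \<omega> t (Z2 t \<omega>)) / total_mass (u \<omega>) t)
                          \<longlongrightarrow> 1) at_top)"
proof -
  \<comment> \<open>The dyadic scale just below \<open>t\<close>. For \<open>0 < t < 1\<close> the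
    truncation by \<open>nat\<close> in \<open>k_of\<close> gives scale 1, so the sites are defined
    there as well.\<close>
  define T where "T t = (2::real) ^ k_of t" for t
  have T1: "1 \<le> T t" for t by (simp add: T_def)
  have "\<exists>Z. fst Z \<in> measurable M (count_space UNIV) \<and> snd Z \<in> measurable M (count_space UNIV) \<and>
     (\<forall>\<omega>\<in>space M. fst Z \<omega> \<in> lball (R_of (T t)) \<and> snd Z \<omega> \<in> lball (R_of (T t)) \<and> fst Z \<omega> \<noteq> snd Z \<omega> \<and>
       (\<forall>y\<in>lball (R_of (T t)). score (T t) t y \<omega> \<le> score (T t) t (fst Z \<omega>) \<omega>) \<and>
       (\<forall>y\<in>lball (R_of (T t)). y \<noteq> fst Z \<omega> \<longrightarrow> score (T t) t y \<omega> \<le> score (T t) t (snd Z \<omega>) \<omega>))" for t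
  proof -
    obtain Z1 Z2 where Z: "Z1 \<in> measurable M (count_space UNIV)" "Z2 \<in> measurable M (count_space UNIV)"
      "\<And>\<omega>. \<omega> \<in> space M \<Longrightarrow> Z1 \<omega> \<in> lball (R_of (T t)) \<and> Z2 \<omega> \<in> lball (R_of (T t)) \<and> Z1 \<omega> \<noteq> Z2 \<omega>"
      "\<And>\<omega> y. \<omega> \<in> space M \<Longrightarrow> y \<in> lball (R_of (T t)) \<Longrightarrow> score (T t) t y \<omega> \<le> score (T t) t (Z1 \<omega>) \<omega>"
      "\<And>\<omega> y. \<omega> \<in> space M \<Longrightarrow> y \<in> lball (R_of (T t)) \<Longrightarrow> y \<noteq> Z1 \<omega> \<Longrightarrow> score (T t) t y \<omega> \<le> score (T t) t (Z2 \<omega>) \<omega>"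
      by (rule two_site_selection[OF T1[of t], of t]) blast
    show ?thesis by (rule exI[of _ "(Z1, Z2)"]) (use Z in auto)
  qed
  then obtain Z where Z: "\<And>t. fst (Z t) \<in> measurable M (count_space UNIV)" "\<And>t. snd (Z t) \<in> measurable M (count_space UNIV)"
    "\<And>t \<omega>. \<omega> \<in> space M \<Longrightarrow> fst (Z t) \<omega> \<in> lball (R_of (T t)) \<and> snd (Z t) \<omega> \<in> lball (R_of (T t)) \<and> fst (Z t) \<omega> \<noteq> snd (Z t) \<omega>"
    "\<And>t \<omega> y. \<omega> \<in> space M \<Longrightarrow> y \<in> lball (R_of (T t)) \<Longrightarrow> score (T t) t y \<omega> \<le> score (T t) t (fst (Z t) \<omega>) \<omega>"
    "\<And>t \<omega> y. \<omega> \<in> space M \<Longrightarrow> y \<in> lball (R_of (T t)) \<Longrightarrow> y \<noteq> fst (Z t) \<omega> \<Longrightarrow> score (T t) t y \<omega> \<le> score (T t) t (snd (Z t) \<omega>) \<omega>"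
    by metis
  \<comment> \<open>Strictly between \<open>q / (1 + q) = d / \<alpha>\<close>, which almost sure
    growth requires, and \<open>(q + e) / (1 + q + e)\<close>, the largest exponent for which the
    ball of radius \<open>R_of T\<close> can control the tail.\<close>
  define \<gamma> where "\<gamma> = (q + e / 2) / (1 + q + e / 2)"
  have \<gamma>: "0 \<le> \<gamma>" "\<gamma> < 1" using q_pos e_pos by (auto simp: \<gamma>_def)
  have d\<gamma>: "real CARD('d) < \<gamma> * \<alpha>"
  proof -
    have "q / (1 + q) < \<gamma>" unfolding \<gamma>_def using q_pos e_pos by (simp add: field_simps)
    then have "q / (1 + q) * \<alpha> < \<gamma> * \<alpha>" using \<alpha>_pos by (rule mult_strict_right_mono)
    moreover have "q / (1 + q) * \<alpha> = d" using \<alpha>_q q_pos by (simp add: field_simps)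
    ultimately show ?thesis by (simp add: d_def)
  qed
  obtain K0 where K0: "0 \<le> K0" "\<And>F :: (int ^ 'd) set. finite F \<Longrightarrow> (\<Sum>x\<in>F. exp (- real (nrm x) / 2)) \<le> K0"
    using sum_exp_nrm_bounded by metis
  have T_lim: "filterlim T at_top at_top"
  proof (rule filterlim_at_top_mono)
    show "filterlim (\<lambda>t::real. t / 2) at_top at_top" by real_asymp
    show "\<forall>\<^sub>F t in at_top. t / 2 \<le> T t"
      using eventually_ge_at_top[of 1] by eventually_elim (use k_of_bounds(2) in \<open>simp add: T_def mult.commute\<close>)
  qed
  have k_lim: "filterlim k_of sequentially at_top"
  proof -
    have "filterlim (\<lambda>t. nat \<lfloor>log 2 t\<rfloor>) sequentially at_top"
      by (intro filterlim_compose[OF filterlim_nat_sequentially] filterlim_compose[OF filterlim_floor_sequentially]) real_asymp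
    then show ?thesis by (simp add: k_of_def[abs_def])
  qed
  have "AE \<omega> in M. ((\<lambda>t. (u \<omega> t (fst (Z t) \<omega>) + u \<omega> t (snd (Z t) \<omega>)) / total_mass (u \<omega>) t) \<longlongrightarrow> 1) at_top"
    using u AE_ge_1 AE_growth[OF d\<gamma>] AE_not_bad AE_space
  proof eventually_elim
    case (elim \<omega>)
    obtain C where C: "0 \<le> C" "\<And>x. \<xi> x \<omega> \<le> C * (1 + real (nrm x)) powr \<gamma>" using elim(3) by auto
    have "\<forall>\<^sub>F t in at_top. \<omega> \<notin> bad_event (T t)"
      unfolding T_def using eventually_compose_filterlim[OF elim(4) k_lim] .
    moreover have "\<forall>\<^sub>F t in at_top. scale_ok (T t)"
      by (rule eventually_compose_filterlim[OF eventually_scale_ok T_lim])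
    moreover have "\<forall>\<^sub>F t in at_top. \<forall>n. R_of (T t) < n \<longrightarrow> (C * (1 + real n) powr \<gamma> + 2 * d * exp 2) * (2 * T t) \<le> real n"
      by (rule eventually_compose_filterlim[OF eventually_far[OF C(1) \<gamma>_def] T_lim])
    ultimately have ev: "\<forall>\<^sub>F t in at_top. 
      0 < u \<omega> t (fst (Z t) \<omega>) + u \<omega> t (snd (Z t) \<omega>) \<and>
      u \<omega> t (fst (Z t) \<omega>) + u \<omega> t (snd (Z t) \<omega>) \<le> total_mass (u \<omega>) t \<and>
      total_mass (u \<omega>) t \<le> (u \<omega> t (fst (Z t) \<omega>) + u \<omega> t (snd (Z t) \<omega>)) * err_of K0 (T t)"
      using eventually_ge_at_top[of 1]
    proof eventually_elim
      case (elim t)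
      have t: "T t \<le> t" "t \<le> 2 * T t" using k_of_bounds[OF elim(4)] by (auto simp: T_def)
      note * = good_scale_ratio_bounds[OF \<open>nonneg_pam_solution (\<lambda>z. \<xi> z \<omega>) (u \<omega>)\<close> \<open>\<omega> \<in> space M\<close> elim(1,2) t _ C(2) \<gamma> C(1) _ K0(2),
         of "fst (Z t) \<omega>" "snd (Z t) \<omega>"]
      show ?case
        using \<open>\<forall>z. 1 \<le> \<xi> z \<omega>\<close> elim(3) Z(3)[OF \<open>\<omega> \<in> space M\<close>, of t] Z(4,5)[OF \<open>\<omega> \<in> space M\<close>, of _ t]
        by (intro conjI *) auto
    qed
    have err: "((\<lambda>t. err_of K0 (T t)) \<longlongrightarrow> 1) at_top"
      by (rule filterlim_compose[OF err_of_tendsto[OF K0(1)] T_lim])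
    have inv: "((\<lambda>t. 1 / err_of K0 (T t)) \<longlongrightarrow> 1) at_top"
      using tendsto_divide[OF tendsto_const[of 1] err] by simp
    have "\<forall>\<^sub>F t in at_top. 0 < err_of K0 (T t)" by (rule order_tendstoD(1)[OF err]) simp
    show ?case
    proof (rule tendsto_sandwich[OF _ _ inv tendsto_const])
      show "\<forall>\<^sub>F t in at_top. 1 / err_of K0 (T t) \<le> (u \<omega> t (fst (Z t) \<omega>) + u \<omega> t (snd (Z t) \<omega>)) / total_mass (u \<omega>) t"
        using ev \<open>\<forall>\<^sub>F t in at_top. 0 < err_of K0 (T t)\<close>
      proof eventually_elim
        case (elim t)
        then have "0 < total_mass (u \<omega>) t" by linarith
        with elim show ?case by (simp add: field_simps)
      qed
      show "\<forall>\<^sub>F t in at_top. (u \<omega> t (fst (Z t) \<omega>) + u \<omega> t (snd (Z t) \<omega>)) / total_mass (u \<omega>) t \<le> 1"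
        using ev
      proof eventually_elim
        case (elim t)
        then have "0 < total_mass (u \<omega>) t" by linarith
        with elim show ?case by (simp add: field_simps)
      qed
    qed
  qed
  then show ?thesis
    by (intro exI[of _ "\<lambda>t. fst (Z t)"] exI[of _ "\<lambda>t. snd (Z t)"] conjI) (use Z in auto)
qed

end

theorem theorem1p1:
  fixes M :: "'w measure"
    and \<xi> :: "int ^ 'd \<Rightarrow> 'w \<Rightarrow> real"
    and \<alpha> :: real
    and u :: "'w \<Rightarrow> real \<Rightarrow> int ^ 'd \<Rightarrow> real"
  assumes "prob_space M"
    and "\<alpha> > real CARD('d)"
    and "prob_space.indep_vars M (\<lambda>_. borel) \<xi> UNIV"
    and "\<And>z x. x \<ge> 1 \<Longrightarrow> measure M {\<omega> \<in> space M. \<xi> z \<omega> < x} = 1 - x powr (-\<alpha>)"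
    and "AE \<omega> in M. nonneg_pam_solution (\<lambda>z. \<xi> z \<omega>) (u \<omega>)"
  shows "\<exists>Z1 Z2 :: real \<Rightarrow> 'w \<Rightarrow> int ^ 'd.
           (\<forall>t>0. Z1 t \<in> measurable M (count_space UNIV)) \<and>
           (\<forall>t>0. Z2 t \<in> measurable M (count_space UNIV)) \<and>
           (\<forall>t>0. \<forall>\<omega>\<in>space M. Z1 t \<omega> \<noteq> Z2 t \<omega>) \<and>
           (AE \<omega> in M. ((\<lambda>t. (u \<omega> t (Z1 t \<omega>) + u \<omega> t (Z2 t \<omega>)) / total_mass (u \<omega>) t)
                          \<longlongrightarrow> 1) at_top)"
proof -
  interpret prob_space M by (rule assms(1))
  have "0 < \<alpha>" using assms(2) by (meson of_nat_0_le_iff order_le_less_trans)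
  interpret pareto_pam M \<xi> \<alpha>
    by unfold_locales (use assms \<open>0 < \<alpha>\<close> in auto)
  show ?thesis by (rule two_cities[OF assms(5)])
qed

end
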